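(* In the setting described in the context, suppose the treatments are assigned by Atkinson's $D_A$-biased coin design ($D_A$-BCD), under which $n^{-1}\sum_{i=1}^n(2T_i-1)\overset{p}{\rightarrow}0$ and $n^{-1/2}\sum_{i=1}^n(2T_i-1)\bm{x}_i\overset{d}{\rightarrow}N(\bm{0},\bm{\Sigma}/5)$ with $\bm{\Sigma}=\mathrm{diag}(\mathrm{Var}(X_1),\dots,\mathrm{Var}(X_{p+q}))$. Let $\lambda_2=1/\sigma_w$. 1. If $\mu_1-\mu_2=0$, then $$S\overset{d}{\rightarrow}N\left(0,\frac{\sigma_\epsilon^2+\frac15\sum_{j=1}^q\beta_{p+j}^2\mathrm{Var}(X_{p+j})}{\sigma_\epsilon^2+\sum_{j=1}^q\beta_{p+j}^2\mathrm{Var}(X_{p+j})}\right).$$ 2. If $\mu_1-\mu_2=\delta/\sqrt{n}$ for a fixed $\delta\neq0$, then $$S\overset{d}{\rightarrow}N\left(\frac12\lambda_2\delta,\frac{\sigma_\epsilon^2+\frac15\sum_{j=1}^q\beta_{p+j}^2\mathrm{Var}(X_{p+j})}{\sigma_\epsilon^2+\sum_{j=1}^q\beta_{p+j}^2\mathrm{Var}(X_{p+j})}\right).$$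
   Context: Setting. Fix integers $p,q\ge 0$. For each $n$ there are $n$ units; $T_i\in\{0,1\}$ is the treatment assignment of unit $i$ ($T_i=1$ for treatment 1, $T_i=0$ for treatment 2), and $\bm{x}_i=(x_{i,1},\dots,x_{i,p+q})^t$ is its covariate vector. The vectors $\bm{x}_i$ are i.i.d. over $i$; $x_{i,j}$ is distributed as $X_j$, the covariates $X_1,\dots,X_{p+q}$ are independent of each other, with $\mathbb{E}X_j=0$ and $0<\mathrm{Var}(X_j)<\infty$. The outcomes follow the true linear model $$Y_i=\mu_1T_i+\mu_2(1-T_i)+\sum_{j=1}^{p+q}\beta_jx_{i,j}+\epsilon_i,$$ where $\epsilon_1,\dots,\epsilon_n$ are i.i.d. with mean $0$ and variance $\sigma_\epsilon^2\in(0,\infty)$, independent of the covariates. The randomization uses only covariate information and external randomness: $(T_1,\dots,T_n)$ and all covariates are jointly independent of $(\epsilon_1,\dots,\epsilon_n)$. $D_A$-BCD. Units are assigned sequentially. After $n$ units have been assigned, unit $n+1$ is assigned to treatment 1 with probability $$\frac{[1-(1;\bm{x}_{n+1}^t)(\mathbf{F}_n^t\mathbf{F}_n)^{-1}\bm{b}_n]^2}{[1-(1;\bm{x}_{n+1}^t)(\mathbf{F}_n^t\mathbf{F}_n)^{-1}\bm{b}_n]^2+[1+(1;\bm{x}_{n+1}^t)(\mathbf{F}_n^t\mathbf{F}_n)^{-1}\bm{b}_n]^2},$$ where $\mathbf{F}_n=[\bm{1}_n;\mathbf{X}]$, $\mathbf{X}=(x_{i,j})_{1\le i\le n,1\le j\le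 p+q}$, and $\bm{b}_n^t=(2\bm{T}-\bm{1}_n)^t\mathbf{F}_n$ (with arbitrary assignment of an initial block of units while $\mathbf{F}_n^t\mathbf{F}_n$ is singular). The balance properties of $D_A$-BCD stated in the claim are a known result of Smith on this design and are taken as given. Working model. Only the first $p$ covariates are included: $\mathbb{E}[Y_i]=\mu_1T_i+\mu_2(1-T_i)+\sum_{j=1}^p\beta_jx_{i,j}$. Write $\bm{Y}=(Y_1,\dots,Y_n)^t$, $\bm{T}=(T_1,\dots,T_n)^t$, $\mathbf{X}_{\mathrm{in}}=(x_{i,j})_{1\le i\le n,1\le j\le p}$, $\bm{\beta}_{\mathrm{in}}=(\beta_1,\dots,\beta_p)^t$, $\bm{1}_n$ the vector of $n$ ones, $\mathbf{G}=[\bm{T};\bm{1}_n-\bm{T};\mathbf{X}_{\mathrm{in}}]$ (an $n\times(p+2)$ matrix, columns juxtaposed), and $\bm{\theta}=(\mu_1,\mu_2,\bm{\beta}_{\mathrm{in}}^t)^t$. The OLS estimator is $\hat{\bm{\theta}}=(\mathbf{G}^t\mathbf{G})^{-1}\mathbf{G}^t\bm{Y}$ (defined arbitrarily when $\mathbf{G}^t\mathbf{G}$ is singular). Test statistic for the treatment effect ($H_0:\mu_1-\mu_2=0$): $$S=\frac{\bm{L}^t\hat{\bm{\theta}}}{\sqrt{\hat\sigma_w^2\,\bm{L}^t(\mathbf{G}^t\mathbf{G})^{-1}\bm{L}}},\qquad \bm{L}=(1,-1,0,\dots,0)^t\in\mathbb{R}^{p+2},\qquad \hat\sigma_w^2=\frac{\Vert\bm{Y}-\mathbf{G}\hat{\bm{\theta}}\Vert^2}{n-p-2}.$$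 Also $\sigma_w^2=\sigma_\epsilon^2+\sum_{j=1}^q\beta_{p+j}^2\mathrm{Var}(X_{p+j})$. *)

theory Defs
  imports "HOL-Probability.Probability" "Jordan_Normal_Form.Gauss_Jordan_Elimination"
    "Jordan_Normal_Form.Determinant"
begin

text \<open>
  Units and covariates are numbered from 0.  Covariates \<open>0, \<dots>, p - 1\<close> enter the working model,
  covariates \<open>p, \<dots>, p + q - 1\<close> do not.  Matrices and vectors whose size depends on the number of
  units or covariates are those of Jordan_Normal_Form; constants with a namesake in HOL-Analysis
  are written with their theory prefix.
\<close>

section \<open>Matrix inverse, normal laws, modes of convergence\<close>

text \<open>Meaningful for nonsingular square matrices only.\<close>

definition inv_mat :: "real mat \<Rightarrow> real mat" where
  "inv_mat A = the (mat_inverse A)"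

lemma inv_mat:
  assumes A: "A \<in> carrier_mat n n" and "Determinant.det A \<noteq> 0"
  shows "inv_mat A \<in> carrier_mat n n" "A * inv_mat A = 1\<^sub>m n" "inv_mat A * A = 1\<^sub>m n"
proof -
  have "A \<in> Units (ring_mat TYPE(real) n (undefined :: unit))"
    using det_non_zero_imp_unit[OF assms] .
  then obtain B where "mat_inverse A = Some B"
    using mat_inverse(1)[OF A, where b = "undefined :: unit"] by (cases "mat_inverse A") auto
  then show "inv_mat A \<in> carrier_mat n n" "A * inv_mat A = 1\<^sub>m n" "inv_mat A * A = 1\<^sub>m n"
    using mat_inverse(2)[OF A] unfolding inv_mat_def by auto
qed

text \<open>\<open>N(m, v)\<close> with variance \<open>v > 0\<close>; note that \<^const>\<open>normal_density\<close> takes the standard deviation.\<close>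

definition normal_law :: "real \<Rightarrow> real \<Rightarrow> real measure" where
  "normal_law m v = density lborel (\<lambda>y. ennreal (normal_density m (sqrt v) y))"

text \<open>
  The law \<open>N(m, V)\<close> on \<open>\<real>\<^sup>d\<close> for positive definite \<open>V\<close>.  Here \<open>\<real>\<^sup>d\<close> is the space of functions on
  \<open>{..<d}\<close> that carries the finite product measures, so \<open>d = 0\<close> is allowed.
\<close>

definition mv_normal_law :: "nat \<Rightarrow> real Matrix.vec \<Rightarrow> real mat \<Rightarrow> (nat \<Rightarrow> real) measure" where
  "mv_normal_law d m V =
     density (\<Pi>\<^sub>M j\<in>{..<d}. lborel)
       (\<lambda>y. let w = Matrix.vec d y - m in
         ennreal (exp (- scalar_prod w (inv_mat V *\<^sub>v w) / 2)
                    / sqrt ((2 * pi) ^ d * Determinant.det V)))"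

definition conv_in_prob :: "'a measure \<Rightarrow> (nat \<Rightarrow> 'a \<Rightarrow> real) \<Rightarrow> real \<Rightarrow> bool" where
  "conv_in_prob M Z c \<longleftrightarrow>
     (\<forall>e>0. (\<lambda>n. measure M {\<omega> \<in> space M. \<bar>Z n \<omega> - c\<bar> > e}) \<longlonglongrightarrow> 0)"

abbreviation conv_in_distr :: "'a measure \<Rightarrow> (nat \<Rightarrow> 'a \<Rightarrow> real) \<Rightarrow> real measure \<Rightarrow> bool" where
  "conv_in_distr M Z N \<equiv> weak_conv_m (\<lambda>n. distr M borel (Z n)) N"

text \<open>
  Convergence in distribution of random vectors in \<open>\<real>\<^sup>d\<close>: convergence of the expectations of all
  bounded continuous functions.  The product topology on functions, restricted to
  \<open>{..<d} \<rightarrow>\<^sub>E UNIV\<close>, is the usual topology of \<open>\<real>\<^sup>d\<close>.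
\<close>

definition conv_in_distr_vec ::
    "nat \<Rightarrow> 'a measure \<Rightarrow> (nat \<Rightarrow> 'a \<Rightarrow> nat \<Rightarrow> real) \<Rightarrow> (nat \<Rightarrow> real) measure \<Rightarrow> bool" where
  "conv_in_distr_vec d M Z N \<longleftrightarrow>
     (\<forall>f :: (nat \<Rightarrow> real) \<Rightarrow> real.
        continuous_on ({..<d} \<rightarrow>\<^sub>E UNIV) f \<and> bounded (f ` ({..<d} \<rightarrow>\<^sub>E UNIV)) \<longrightarrow>
        (\<lambda>n. integral\<^sup>L (distr M (\<Pi>\<^sub>M j\<in>{..<d}. borel) (Z n)) f) \<longlonglongrightarrow> integral\<^sup>L N f)"

section \<open>Covariates and outcomes\<close>

definition cov_vec :: "nat \<Rightarrow> (nat \<Rightarrow> nat \<Rightarrow> 'a \<Rightarrow> real) \<Rightarrow> nat \<Rightarrow> 'a \<Rightarrow> nat \<Rightarrow> real" where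
  "cov_vec d x i \<omega> = (\<lambda>j\<in>{..<d}. x i j \<omega>)"

definition outcome ::
    "nat \<Rightarrow> real \<Rightarrow> real \<Rightarrow> (nat \<Rightarrow> real) \<Rightarrow> (nat \<Rightarrow> 'a \<Rightarrow> real) \<Rightarrow> (nat \<Rightarrow> nat \<Rightarrow> 'a \<Rightarrow> real) \<Rightarrow>
      (nat \<Rightarrow> 'a \<Rightarrow> real) \<Rightarrow> nat \<Rightarrow> 'a \<Rightarrow> real" where
  "outcome d \<mu>1 \<mu>2 \<beta> T x \<epsilon> i \<omega> =
     \<mu>1 * T i \<omega> + \<mu>2 * (1 - T i \<omega>) + (\<Sum>j<d. \<beta> j * x i j \<omega>) + \<epsilon> i \<omega>"

section \<open>The D_A-biased coin design\<close>

text \<open>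
  In this section and the next, the arguments \<open>t\<close>, \<open>z\<close> and \<open>y\<close> are realized treatments, covariates
  and outcomes, that is, values at one sample point.
\<close>

definition F_mat :: "nat \<Rightarrow> (nat \<Rightarrow> nat \<Rightarrow> real) \<Rightarrow> nat \<Rightarrow> real mat" where
  "F_mat d z n = Matrix.mat n (d + 1) (\<lambda>(i, j). if j = 0 then 1 else z i (j - 1))"

definition b_vec :: "nat \<Rightarrow> (nat \<Rightarrow> real) \<Rightarrow> (nat \<Rightarrow> nat \<Rightarrow> real) \<Rightarrow> nat \<Rightarrow> real Matrix.vec" where
  "b_vec d t z n = transpose_mat (F_mat d z n) *\<^sub>v Matrix.vec n (\<lambda>i. 2 * t i - 1)"

text \<open>Unit \<open>n\<close>, in the numbering from 0, is the unit that arrives after \<open>n\<close> assignments.\<close>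

definition DA_score :: "nat \<Rightarrow> (nat \<Rightarrow> real) \<Rightarrow> (nat \<Rightarrow> nat \<Rightarrow> real) \<Rightarrow> nat \<Rightarrow> real" where
  "DA_score d t z n =
     scalar_prod (Matrix.vec (d + 1) (\<lambda>j. if j = 0 then 1 else z n (j - 1)))
       (inv_mat (transpose_mat (F_mat d z n) * F_mat d z n) *\<^sub>v b_vec d t z n)"

definition DA_prob :: "nat \<Rightarrow> (nat \<Rightarrow> real) \<Rightarrow> (nat \<Rightarrow> nat \<Rightarrow> real) \<Rightarrow> nat \<Rightarrow> real" where
  "DA_prob d t z n =
     (1 - DA_score d t z n)\<^sup>2 / ((1 - DA_score d t z n)\<^sup>2 + (1 + DA_score d t z n)\<^sup>2)"

text \<open>
  The sigma-algebra generated by the first \<open>n\<close> assignments and the covariates of the first \<open>n + 1\<close>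
  units.
\<close>

definition history ::
    "'a measure \<Rightarrow> nat \<Rightarrow> (nat \<Rightarrow> 'a \<Rightarrow> real) \<Rightarrow> (nat \<Rightarrow> nat \<Rightarrow> 'a \<Rightarrow> real) \<Rightarrow> nat \<Rightarrow> 'a measure" where
  "history M d T x n =
     vimage_algebra (space M) (\<lambda>\<omega>. (\<lambda>i\<in>{..<n}. T i \<omega>, \<lambda>i\<in>{..n}. cov_vec d x i \<omega>))
       ((\<Pi>\<^sub>M i\<in>{..<n}. borel) \<Otimes>\<^sub>M (\<Pi>\<^sub>M i\<in>{..n}. \<Pi>\<^sub>M j\<in>{..<d}. borel))"

text \<open>Assignments are unrestricted as long as \<open>F\<^sup>t F\<close> is singular.\<close>

definition DA_BCD ::
    "'a measure \<Rightarrow> nat \<Rightarrow> (nat \<Rightarrow> 'a \<Rightarrow> real) \<Rightarrow> (nat \<Rightarrow> nat \<Rightarrow> 'a \<Rightarrow> real) \<Rightarrow> bool" where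
  "DA_BCD M d T x \<longleftrightarrow>
     (\<forall>i. T i \<in> borel_measurable M \<and> (\<forall>\<omega>\<in>space M. T i \<omega> \<in> {0, 1})) \<and>
     (\<forall>n. AE \<omega> in M.
        let F = F_mat d (\<lambda>i j. x i j \<omega>) n in
        Determinant.det (transpose_mat F * F) \<noteq> 0 \<longrightarrow>
        real_cond_exp M (history M d T x n) (indicator {\<omega>' \<in> space M. T n \<omega>' = 1}) \<omega> =
          DA_prob d (\<lambda>i. T i \<omega>) (\<lambda>i j. x i j \<omega>) n)"

section \<open>Least squares and the test statistic\<close>

definition G_mat :: "nat \<Rightarrow> (nat \<Rightarrow> real) \<Rightarrow> (nat \<Rightarrow> nat \<Rightarrow> real) \<Rightarrow> nat \<Rightarrow> real mat" where
  "G_mat p t z n = Matrix.mat n (p + 2)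
     (\<lambda>(i, j). if j = 0 then t i else if j = 1 then 1 - t i else z i (j - 2))"

definition ols :: "real mat \<Rightarrow> real Matrix.vec \<Rightarrow> real Matrix.vec" where
  "ols G y = inv_mat (transpose_mat G * G) *\<^sub>v (transpose_mat G *\<^sub>v y)"

definition L_vec :: "nat \<Rightarrow> real Matrix.vec" where
  "L_vec p = Matrix.vec (p + 2) (\<lambda>j. if j = 0 then 1 else if j = 1 then - 1 else 0)"

definition sigma_w_hat_sq :: "nat \<Rightarrow> real mat \<Rightarrow> real Matrix.vec \<Rightarrow> real" where
  "sigma_w_hat_sq p G y =
     (let r = y - G *\<^sub>v ols G y in scalar_prod r r / (real (dim_vec y) - real p - 2))"

text \<open>\<open>s0\<close> is the arbitrary value of the statistic when \<open>G\<^sup>t G\<close> is singular.\<close>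

definition S_stat ::
    "nat \<Rightarrow> (nat \<Rightarrow> real) \<Rightarrow> (nat \<Rightarrow> nat \<Rightarrow> real) \<Rightarrow> (nat \<Rightarrow> real) \<Rightarrow> real \<Rightarrow> nat \<Rightarrow> real" where
  "S_stat p t z y s0 n =
     (let G = G_mat p t z n; L = L_vec p; Y = Matrix.vec n y in
      if Determinant.det (transpose_mat G * G) = 0 then s0
      else scalar_prod L (ols G Y) /
           sqrt (sigma_w_hat_sq p G Y * scalar_prod L (inv_mat (transpose_mat G * G) *\<^sub>v L)))"

end

theory Submission
  imports Defs "HOL-Real_Asymp.Real_Asymp"
begin

text \<open>
  Write \<open>s\<^sub>i = 2 T\<^sub>i - 1\<close> and let \<open>u\<^sub>i\<close> be the error of the working model: the omitted covariates
  plus \<open>\<epsilon>\<^sub>i\<close>.  Since \<open>G\<^sup>t G / n\<close> converges in probability to a diagonal matrix and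
  \<open>G\<^sup>t u / \<surd>n\<close> is stochastically bounded, the statistic differs from
  \<open>(\<delta> / 2 + \<Sum>\<^sub>i s\<^sub>i u\<^sub>i / \<surd>n) / \<sigma>\<^sub>w\<close> by a term that vanishes in probability.  The balance of the
  design gives the limit law of the covariate part of \<open>\<Sum>\<^sub>i s\<^sub>i u\<^sub>i / \<surd>n\<close>, with variance reduced
  by the factor \<open>1/5\<close>.  The error part has, conditionally on the design, a characteristic function
  whose limit is that of \<open>N(0, \<sigma>\<^sub>\<epsilon>\<^sup>2)\<close> uniformly in the signs, so the two characteristic functions
  multiply in the limit although the two parts are dependent.
\<close>

section \<open>The statistic in terms of the Gram matrix\<close>

text \<open>The signs enter both parts of the signed sum and depend on the covariates, so neither a
  limit theorem for independent summands nor a moment bound applies to the covariate part: its order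
  and its law come from the balance property. The error part is tractable because
  \<open>\<epsilon>\<close> is centered: its characteristic function at
  \<open>t * s / sqrt n\<close> has no linear term, so a sign flip changes it by o(1/n) only. The
  shift \<open>\<delta> / 2\<close> arises because each arm holds about n/2 units. The inverse of
  the limit of G^t G / n has the entry 2 for either arm, so sqrt n times the numerator is close to
  \<open>\<delta>\<close> plus twice the signed sum, while sqrt n times the standard error tends to
  twice sigma_w. Included covariates drop out: their Gram entries against the arms are o(n) and
  their scores O(sqrt n). Second moments are all there is: squares of covariates need a law of large
  numbers under first moments, whereas products of distinct covariates have a second moment by
  independence, which gives the scores their order sqrt n. The Gram matrix may be singular with
  positive probability at each n; that event is negligible only in the limit, hence the exceptional
  events.\<close>

lemma inv_mat_unique:
  assumes A: "A \<in> carrier_mat n n" and B: "B \<in> carrier_mat n n" and AB: "A * B = 1\<^sub>m n"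
  shows "Determinant.det A \<noteq> 0" "inv_mat A = B"
proof -
  show d: "Determinant.det A \<noteq> 0"
    using det_mult[OF A B] AB by auto
  note I = inv_mat[OF A d]
  have "inv_mat A = inv_mat A * (A * B)" using I AB by simp
  also have "\<dots> = (inv_mat A * A) * B" using assoc_mult_mat[OF I(1) A B] by simp
  also have "\<dots> = B" using I B by simp
  finally show "inv_mat A = B" .
qed

text \<open>
  By Cramer's rule these are the entries of the inverse; in this form they are visibly measurable
  and continuous functions of the entries of \<open>A\<close>.
\<close>

definition inv_entry :: "real mat \<Rightarrow> nat \<Rightarrow> nat \<Rightarrow> real" where
  "inv_entry A k l = cofactor A l k / Determinant.det A"

text \<open>The adjugate divided by the determinant is a right inverse, and right inverses are
  unique. This links the inverse computed by elimination to the cofactor formula.\<close>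

lemma inv_mat_index:
  assumes A: "A \<in> carrier_mat n n" and d: "Determinant.det A \<noteq> 0" and "k < n" "l < n"
  shows "inv_mat A $$ (k, l) = inv_entry A k l"
proof -
  let ?B = "(1 / Determinant.det A) \<cdot>\<^sub>m adj_mat A"
  note adj = adj_mat[OF A]
  have "A * ?B = (1 / Determinant.det A) \<cdot>\<^sub>m (A * adj_mat A)"
    using mult_smult_distrib[OF A adj(1)] .
  also have "\<dots> = 1\<^sub>m n"
    unfolding adj(2) using d by (intro eq_matI) auto
  finally have "inv_mat A = ?B"
    by (intro inv_mat_unique(2)[OF A _ ]) (use adj(1) in auto)
  then show ?thesis
    using A assms(3,4) adj(1) by (simp add: adj_mat_def inv_entry_def)
qed

text \<open>Serves to trade the Gram matrix for its multiple by 1/n, the version that has a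
  limit.\<close>

lemma inv_entry_smult:
  assumes A: "A \<in> carrier_mat n n" and d: "Determinant.det A \<noteq> 0" and a: "a \<noteq> 0" and kl: "k < n" "l < n"
  shows "inv_entry (a \<cdot>\<^sub>m A) k l = inv_entry A k l / a"
proof -
  note I = inv_mat[OF A d]
  have aA: "a \<cdot>\<^sub>m A \<in> carrier_mat n n" using A by simp
  have "(a \<cdot>\<^sub>m A) * ((1 / a) \<cdot>\<^sub>m inv_mat A) = 1\<^sub>m n"
    using mult_smult_assoc_mat[OF A, of "(1 / a) \<cdot>\<^sub>m inv_mat A" n a] mult_smult_distrib[OF A I(1), of "1 / a"] I a
    by (intro eq_matI) auto
  then have *: "Determinant.det (a \<cdot>\<^sub>m A) \<noteq> 0" "inv_mat (a \<cdot>\<^sub>m A) = (1 / a) \<cdot>\<^sub>m inv_mat A"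
    using inv_mat_unique[OF aA, of "(1 / a) \<cdot>\<^sub>m inv_mat A"] I by auto
  show ?thesis
    using inv_mat_index[OF aA *(1) kl] inv_mat_index[OF A d kl] *(2) I(1) kl by simp
qed

text \<open>The columns of \<open>G_mat\<close> without a row bound, so that sums over a growing
  number of units concern one and the same sequence.\<close>

definition design_col :: "(nat \<Rightarrow> real) \<Rightarrow> (nat \<Rightarrow> nat \<Rightarrow> real) \<Rightarrow> nat \<Rightarrow> nat \<Rightarrow> real" where
  "design_col t z k i = (if k = 0 then t i else if k = 1 then 1 - t i else z i (k - 2))"

definition gram :: "nat \<Rightarrow> (nat \<Rightarrow> real) \<Rightarrow> (nat \<Rightarrow> nat \<Rightarrow> real) \<Rightarrow> nat \<Rightarrow> real mat" where
  "gram p t z n = Matrix.mat (p + 2) (p + 2)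
     (\<lambda>(k, l). \<Sum>i<n. design_col t z k i * design_col t z l i)"

lemma gram_carrier [simp]: "gram p t z n \<in> carrier_mat (p + 2) (p + 2)"
  by (simp add: gram_def)

lemma G_mat_carrier [simp]: "G_mat p t z n \<in> carrier_mat n (p + 2)"
  by (simp add: G_mat_def)

lemma G_mat_gram: "transpose_mat (G_mat p t z n) * G_mat p t z n = gram p t z n"
  by (intro eq_matI) (auto simp: gram_def scalar_prod_def lessThan_atLeast0 G_mat_def design_col_def intro!: sum.cong)

lemma G_mat_transpose_mult_vec:
  "transpose_mat (G_mat p t z n) *\<^sub>v Matrix.vec n u
     = Matrix.vec (p + 2) (\<lambda>k. \<Sum>i<n. design_col t z k i * u i)"
  by (intro eq_vecI) (auto simp: scalar_prod_def lessThan_atLeast0 G_mat_def design_col_def intro!: sum.cong)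

lemma sum_lessThan_Suc_Suc_shift:
  fixes f :: "nat \<Rightarrow> 'b::comm_monoid_add"
  shows "(\<Sum>k<p + 2. f k) = f 0 + (f 1 + (\<Sum>k<p. f (k + 2)))"
  by (simp add: sum.lessThan_Suc_shift del: sum.lessThan_Suc)

text \<open>The normal equations reproduce \<open>\<theta>\<close> exactly, so the estimation error
  depends on \<open>u\<close> alone; the second claim is Pythagoras for the projection of
  \<open>U\<close> onto the column space. This is pure algebra, valid for any vector
  \<open>u\<close>.\<close>

lemma ols_residual:
  assumes det: "Determinant.det (gram p t z n) \<noteq> 0"
    and y: "\<forall>i<n. y i = \<mu>1 * t i + \<mu>2 * (1 - t i) + (\<Sum>j<p. \<beta> j * z i j) + u i"
  defines "G \<equiv> G_mat p t z n"
    and "B \<equiv> inv_mat (gram p t z n)"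
    and "\<theta> \<equiv> Matrix.vec (p + 2) (\<lambda>k. if k = 0 then \<mu>1 else if k = 1 then \<mu>2 else \<beta> (k - 2))"
    and "g \<equiv> Matrix.vec (p + 2) (\<lambda>k. \<Sum>i<n. design_col t z k i * u i)"
    and "U \<equiv> Matrix.vec n u" and "Y \<equiv> Matrix.vec n y"
  shows "ols G Y = \<theta> + B *\<^sub>v g"
    and "scalar_prod (Y - G *\<^sub>v ols G Y) (Y - G *\<^sub>v ols G Y)
           = scalar_prod U U - scalar_prod g (B *\<^sub>v g)"
proof -
  let ?A = "gram p t z n"
  have A: "?A \<in> carrier_mat (p + 2) (p + 2)" by (rule gram_carrier)
  have G: "G \<in> carrier_mat n (p + 2)" unfolding G_def by (rule G_mat_carrier)
  have th: "\<theta> \<in> carrier_vec (p + 2)" and g: "g \<in> carrier_vec (p + 2)"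
    and U: "U \<in> carrier_vec n" and Y: "Y \<in> carrier_vec n"
    unfolding \<theta>_def g_def U_def Y_def by auto
  note I = inv_mat[OF A det, folded B_def]
  have Bg: "B *\<^sub>v g \<in> carrier_vec (p + 2)" using I(1) g by simp
  have GtG: "transpose_mat G * G = ?A" unfolding G_def by (rule G_mat_gram)
  have GtU: "transpose_mat G *\<^sub>v U = g" unfolding G_def U_def g_def by (rule G_mat_transpose_mult_vec)
  have Yeq: "Y = G *\<^sub>v \<theta> + U"
  proof (rule eq_vecI)
    fix i assume "i < dim_vec (G *\<^sub>v \<theta> + U)"
    then have i: "i < n" unfolding U_def by simp
    have "vec_index (G *\<^sub>v \<theta>) i = (\<Sum>k<p + 2. design_col t z k i * (if k = 0 then \<mu>1 else if k = 1 then \<mu>2 else \<beta> (k - 2)))"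
      using i by (auto simp: scalar_prod_def lessThan_atLeast0 G_def G_mat_def design_col_def \<theta>_def intro!: sum.cong)
    also have "\<dots> = \<mu>1 * t i + \<mu>2 * (1 - t i) + (\<Sum>j<p. \<beta> j * z i j)"
      unfolding sum_lessThan_Suc_Suc_shift by (simp add: design_col_def mult.commute)
    finally show "vec_index Y i = vec_index (G *\<^sub>v \<theta> + U) i"
      using i y G by (simp add: Y_def U_def)
  qed (auto simp: Y_def U_def)
  have Gth: "G *\<^sub>v \<theta> \<in> carrier_vec n" and GBg: "G *\<^sub>v (B *\<^sub>v g) \<in> carrier_vec n" using G th Bg by auto
  have GtY: "transpose_mat G *\<^sub>v Y = ?A *\<^sub>v \<theta> + g"
    unfolding Yeq using mult_add_distrib_mat_vec[of "transpose_mat G" "p + 2" n "G *\<^sub>v \<theta>" U] G Gth U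
      assoc_mult_mat_vec[of "transpose_mat G" "p + 2" n G "p + 2" \<theta>] th GtG GtU by simp
  have "ols G Y = B *\<^sub>v (?A *\<^sub>v \<theta>) + B *\<^sub>v g"
    unfolding ols_def GtG GtY B_def[symmetric]
    using mult_add_distrib_mat_vec[OF I(1), of "?A *\<^sub>v \<theta>" g] A th g mult_mat_vec_carrier by blast
  also have "B *\<^sub>v (?A *\<^sub>v \<theta>) = \<theta>"
    using assoc_mult_mat_vec[OF I(1) A th] I(3) th by simp
  finally show ols: "ols G Y = \<theta> + B *\<^sub>v g" .
  \<comment> \<open>The orthogonal projection of \<open>U\<close> onto the column space of
    \<open>G\<close>; hence its products with \<open>U\<close> and with itself agree.\<close>
  let ?w = "G *\<^sub>v (B *\<^sub>v g)"
  have "G *\<^sub>v ols G Y = G *\<^sub>v \<theta> + ?w"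
    unfolding ols by (rule mult_add_distrib_mat_vec[OF G th Bg])
  then have r: "Y - G *\<^sub>v ols G Y = U - ?w"
    unfolding Yeq using Gth U GBg
    by (intro eq_vecI) (auto simp del: index_mult_mat_vec simp: carrier_vecD carrier_matD(1)[OF G])
  have 1: "scalar_prod U ?w = scalar_prod g (B *\<^sub>v g)"
    using transpose_vec_mult_scalar[OF G Bg U] GtU by simp
  have "scalar_prod ?w ?w = scalar_prod (transpose_mat G *\<^sub>v ?w) (B *\<^sub>v g)"
    using transpose_vec_mult_scalar[OF G Bg GBg] by simp
  also have "transpose_mat G *\<^sub>v ?w = (?A * B) *\<^sub>v g"
    using G assoc_mult_mat_vec[of "transpose_mat G" "p + 2" n G "p + 2" "B *\<^sub>v g"] Bg GtG
      assoc_mult_mat_vec[OF A I(1) g] by simp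
  also have "\<dots> = g" using I g by simp
  finally have 2: "scalar_prod ?w ?w = scalar_prod g (B *\<^sub>v g)" .
  show "scalar_prod (Y - G *\<^sub>v ols G Y) (Y - G *\<^sub>v ols G Y)
           = scalar_prod U U - scalar_prod g (B *\<^sub>v g)"
    unfolding r using U GBg 1 2 comm_scalar_prod[OF U GBg]
    by (simp add: minus_scalar_prod_distrib[where n = n] scalar_prod_minus_distrib[where n = n])
qed

lemma L_vec_scalar_prod:
  assumes "dim_vec v = p + 2"
  shows "scalar_prod (L_vec p) v = vec_index v 0 - vec_index v 1"
proof -
  have "scalar_prod (L_vec p) v = (\<Sum>k<p + 2. (if k = 0 then 1 else if k = 1 then - 1 else 0) * vec_index v k)"
    unfolding scalar_prod_def using assms by (auto simp: L_vec_def lessThan_atLeast0 intro!: sum.cong)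
  then show ?thesis unfolding sum_lessThan_Suc_Suc_shift by simp
qed

text \<open>The coefficients of the included covariates cancel, both in the contrast and in the
  residual; what remains is the treatment difference, the error \<open>u\<close> and inverse Gram
  entries. The last factor is the quadratic form of \<open>L_vec\<close> in the inverse. This scalar
  form serves for measurability and for the limits.\<close>

lemma S_stat_eq:
  assumes y: "\<And>i. i < n \<Longrightarrow> y i = \<mu>1 * t i + \<mu>2 * (1 - t i) + (\<Sum>j<p. \<beta> j * z i j) + u i"
  defines "g \<equiv> \<lambda>k. \<Sum>i<n. design_col t z k i * u i"
    and "b \<equiv> inv_entry (gram p t z n)"
  shows "S_stat p t z y s0 n = (if Determinant.det (gram p t z n) = 0 then s0 else
     (\<mu>1 - \<mu>2 + (\<Sum>k<p + 2. (b 0 k - b 1 k) * g k)) /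
     sqrt (((\<Sum>i<n. (u i)\<^sup>2) - (\<Sum>k<p + 2. \<Sum>l<p + 2. g k * b k l * g l)) / (real n - real p - 2)
       * (b 0 0 - b 0 1 - b 1 0 + b 1 1)))"
proof (cases "Determinant.det (gram p t z n) = 0")
  case True
  then show ?thesis by (simp add: S_stat_def G_mat_gram)
next
  case det: False
  have A: "gram p t z n \<in> carrier_mat (p + 2) (p + 2)" by (rule gram_carrier)
  let ?B = "inv_mat (gram p t z n)"
  let ?g = "Matrix.vec (p + 2) g"
  note I = inv_mat[OF A det]
  note idx = inv_mat_index[OF A det, folded b_def]
  have "\<forall>i<n. y i = \<mu>1 * t i + \<mu>2 * (1 - t i) + (\<Sum>j<p. \<beta> j * z i j) + u i" using y by blast
  note ols = ols_residual[OF det this, folded g_def]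
  have Bv: "vec_index (?B *\<^sub>v v) k = (\<Sum>l<p + 2. b k l * vec_index v l)"
    if "k < p + 2" "v \<in> carrier_vec (p + 2)" for k v
    using that I(1) by (auto simp: scalar_prod_def lessThan_atLeast0 idx intro!: sum.cong)
  have dB: "dim_vec (?B *\<^sub>v v) = p + 2" for v using I(1) by simp
  have LBL: "scalar_prod (L_vec p) (?B *\<^sub>v L_vec p) = b 0 0 - b 0 1 - b 1 0 + b 1 1"
  proof -
    have "(\<Sum>l<p + 2. b k l * vec_index (L_vec p) l) = b k 0 - b k 1" for k
      unfolding sum_lessThan_Suc_Suc_shift by (simp add: L_vec_def)
    moreover have "L_vec p \<in> carrier_vec (p + 2)" by (simp add: L_vec_def)
    ultimately show ?thesis unfolding L_vec_scalar_prod[OF dB] by (subst (1 2) Bv) auto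
  qed
  have Lth: "scalar_prod (L_vec p) (ols (G_mat p t z n) (Matrix.vec n y)) = \<mu>1 - \<mu>2 + (\<Sum>k<p + 2. (b 0 k - b 1 k) * g k)"
    unfolding ols(1) using I(1)
    by (subst L_vec_scalar_prod) (auto simp: Bv sum_subtractf algebra_simps simp del: index_mult_mat_vec sum.lessThan_Suc)
  have gBg: "scalar_prod ?g (?B *\<^sub>v ?g) = (\<Sum>k<p + 2. \<Sum>l<p + 2. g k * b k l * g l)"
    unfolding scalar_prod_def dB lessThan_atLeast0[symmetric]
    by (intro sum.cong refl) (simp add: Bv sum_distrib_left mult.assoc del: index_mult_mat_vec sum.lessThan_Suc)
  have UU: "scalar_prod (Matrix.vec n u) (Matrix.vec n u) = (\<Sum>i<n. (u i)\<^sup>2)"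
    by (simp add: scalar_prod_def lessThan_atLeast0 power2_eq_square)
  show ?thesis
    using det unfolding S_stat_def Let_def G_mat_gram sigma_w_hat_sq_def ols(2) Lth LBL gBg UU by simp
qed

section \<open>Convergence in probability and stochastic boundedness\<close>

text \<open>Factoring out \<open>iexp b\<close>, which has modulus one, leaves the Taylor remainder
  of order zero at \<open>a - b\<close>.\<close>

lemma norm_iexp_diff_le: "cmod (iexp a - iexp b) \<le> \<bar>a - b\<bar>"
proof -
  have "iexp a - iexp b = iexp b * (iexp (a - b) - 1)"
    by (simp add: algebra_simps flip: exp_add)
  then have "cmod (iexp a - iexp b) = cmod (iexp (a - b) - (\<Sum>k\<le>0. (\<i> * of_real (a - b)) ^ k / fact k))"
    by (simp add: norm_mult)
  also have "\<dots> \<le> \<bar>a - b\<bar> ^ Suc 0 / fact (Suc 0)"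
    by (rule iexp_approx1)
  finally show ?thesis by simp
qed

context prob_space
begin

text \<open>
  Convergence in probability and stochastic boundedness are phrased with exceptional events, so
  that the closure rules need no measurability of the random variables.
\<close>

definition off_small :: "real \<Rightarrow> (nat \<Rightarrow> 'a \<Rightarrow> bool) \<Rightarrow> bool" where
  "off_small e Q \<longleftrightarrow> (\<exists>A. (\<forall>n. A n \<in> events) \<and>
     (\<forall>\<^sub>F n in sequentially. prob (A n) \<le> e \<and> (\<forall>\<omega>\<in>space M - A n. Q n \<omega>)))"

definition to_prob :: "(nat \<Rightarrow> 'a \<Rightarrow> real) \<Rightarrow> real \<Rightarrow> bool" where
  "to_prob Z c \<longleftrightarrow> (\<forall>e>0. off_small e (\<lambda>n \<omega>. \<bar>Z n \<omega> - c\<bar> < e))"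

definition stoch_bounded :: "(nat \<Rightarrow> 'a \<Rightarrow> real) \<Rightarrow> bool" where
  "stoch_bounded Z \<longleftrightarrow> (\<forall>e>0. \<exists>K. off_small e (\<lambda>n \<omega>. \<bar>Z n \<omega>\<bar> \<le> K))"

lemma off_small_conj:
  assumes "off_small e1 Q1" "off_small e2 Q2" "e1 + e2 \<le> e"
    and Q: "\<And>n \<omega>. Q1 n \<omega> \<Longrightarrow> Q2 n \<omega> \<Longrightarrow> Q n \<omega>"
  shows "off_small e Q"
proof -
  obtain A1 where A1: "\<forall>n. A1 n \<in> events"
    "\<forall>\<^sub>F n in sequentially. prob (A1 n) \<le> e1 \<and> (\<forall>\<omega>\<in>space M - A1 n. Q1 n \<omega>)"
    using assms(1) unfolding off_small_def by (elim exE conjE)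
  obtain A2 where A2: "\<forall>n. A2 n \<in> events"
    "\<forall>\<^sub>F n in sequentially. prob (A2 n) \<le> e2 \<and> (\<forall>\<omega>\<in>space M - A2 n. Q2 n \<omega>)"
    using assms(2) unfolding off_small_def by (elim exE conjE)
  note A = A1(1)[rule_format] A2(1)[rule_format]
  have "\<forall>\<^sub>F n in sequentially. prob (A1 n \<union> A2 n) \<le> e \<and> (\<forall>\<omega>\<in>space M - (A1 n \<union> A2 n). Q n \<omega>)"
    using A1(2) A2(2)
  proof eventually_elim
    case (elim n)
    have "prob (A1 n \<union> A2 n) \<le> e"
      using measure_Un_le[OF A(1)[of n] A(2)[of n]] assms(3) elim by linarith
    moreover have "Q n \<omega>" if "\<omega> \<in> space M - (A1 n \<union> A2 n)" for \<omega>
      by (rule Q) (use elim that in blast)+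
    ultimately show ?case by blast
  qed
  then show ?thesis unfolding off_small_def using A by (intro exI[of _ "\<lambda>n. A1 n \<union> A2 n"]) auto
qed

lemma off_small_always:
  assumes "\<forall>\<^sub>F n in sequentially. \<forall>\<omega>\<in>space M. Q n \<omega>" "0 \<le> e"
  shows "off_small e Q"
  unfolding off_small_def using assms by (intro exI[of _ "\<lambda>_. {}"]) auto

lemma off_small_mono:
  assumes "off_small e Q1" "e \<le> e'" "\<And>n \<omega>. Q1 n \<omega> \<Longrightarrow> Q n \<omega>"
  shows "off_small e' Q"
  by (rule off_small_conj[OF assms(1) off_small_always[of "\<lambda>_ _. True" 0]]) (simp_all add: assms(2,3))

text \<open>In \<open>to_prob\<close> one number bounds both the distance and the exceptional
  probability, as in the Ky Fan metric; the minimum of the two separates them.\<close>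

lemma to_probD:
  assumes "to_prob Z c" "0 < e" "0 < d"
  shows "off_small e (\<lambda>n \<omega>. \<bar>Z n \<omega> - c\<bar> < d)"
proof -
  have "off_small (min e d) (\<lambda>n \<omega>. \<bar>Z n \<omega> - c\<bar> < min e d)"
    using assms(1)[unfolded to_prob_def, rule_format, of "min e d"] assms(2,3) by simp
  then show ?thesis by (rule off_small_mono) auto
qed

text \<open>Continuous mapping theorem for constant limits. Continuity at the limit point is enough,
  which makes quotients available as soon as the limit of the denominator is nonzero.\<close>

lemma to_prob_continuous2:
  fixes f :: "real \<times> real \<Rightarrow> real"
  assumes X: "to_prob X a" and Y: "to_prob Y b" and f: "isCont f (a, b)"
  shows "to_prob (\<lambda>n \<omega>. f (X n \<omega>, Y n \<omega>)) (f (a, b))"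
  unfolding to_prob_def
proof (intro allI impI)
  fix e :: real assume e: "0 < e"
  obtain d where d: "0 < d" and fd: "\<And>z. dist z (a, b) < d \<Longrightarrow> dist (f z) (f (a, b)) < e"
    using f e unfolding continuous_at_eps_delta by blast
  have "off_small (e / 2) (\<lambda>n \<omega>. \<bar>X n \<omega> - a\<bar> < d / 2)" "off_small (e / 2) (\<lambda>n \<omega>. \<bar>Y n \<omega> - b\<bar> < d / 2)"
    using to_probD[OF X, of "e / 2" "d / 2"] to_probD[OF Y, of "e / 2" "d / 2"] e d by simp_all
  then show "off_small e (\<lambda>n \<omega>. \<bar>f (X n \<omega>, Y n \<omega>) - f (a, b)\<bar> < e)"
  proof (rule off_small_conj)
    have "\<bar>f (x, y) - f (a, b)\<bar> < e" if "\<bar>x - a\<bar> < d / 2" "\<bar>y - b\<bar> < d / 2" for x y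
    proof -
      have "dist (x, y) (a, b) \<le> dist x a + dist y b"
        unfolding dist_prod_def by (simp add: sqrt_sum_squares_le_sum)
      then show ?thesis using fd[of "(x, y)"] that by (simp add: dist_real_def)
    qed
    then show "\<bar>f (X n \<omega>, Y n \<omega>) - f (a, b)\<bar> < e"
      if "\<bar>X n \<omega> - a\<bar> < d / 2" "\<bar>Y n \<omega> - b\<bar> < d / 2" for n \<omega> using that by blast
  qed simp
qed

lemma to_prob_const: "to_prob (\<lambda>_ _. c) c"
  unfolding to_prob_def by (auto intro!: off_small_always)

lemma to_prob_seq:
  assumes "a \<longlonglongrightarrow> c"
  shows "to_prob (\<lambda>n _. a n) c"
  unfolding to_prob_def
proof (intro allI impI off_small_always)
  fix e :: real assume "0 < e"
  then have "\<forall>\<^sub>F n in sequentially. dist (a n) c < e" using assms by (simp add: tendstoD)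
  then show "\<forall>\<^sub>F n in sequentially. \<forall>\<omega>\<in>space M. \<bar>a n - c\<bar> < e" by (simp add: dist_real_def)
qed simp

lemma to_prob_add: "to_prob X a \<Longrightarrow> to_prob Y b \<Longrightarrow> to_prob (\<lambda>n \<omega>. X n \<omega> + Y n \<omega>) (a + b)"
  using to_prob_continuous2[of X a Y b "\<lambda>z. fst z + snd z"] by simp

lemma to_prob_diff: "to_prob X a \<Longrightarrow> to_prob Y b \<Longrightarrow> to_prob (\<lambda>n \<omega>. X n \<omega> - Y n \<omega>) (a - b)"
  using to_prob_continuous2[of X a Y b "\<lambda>z. fst z - snd z"] by simp

lemma to_prob_mult: "to_prob X a \<Longrightarrow> to_prob Y b \<Longrightarrow> to_prob (\<lambda>n \<omega>. X n \<omega> * Y n \<omega>) (a * b)"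
  using to_prob_continuous2[of X a Y b "\<lambda>z. fst z * snd z"] by simp

lemma to_prob_divide:
  "to_prob X a \<Longrightarrow> to_prob Y b \<Longrightarrow> b \<noteq> 0 \<Longrightarrow> to_prob (\<lambda>n \<omega>. X n \<omega> / Y n \<omega>) (a / b)"
  using to_prob_continuous2[of X a Y b "\<lambda>z. fst z / snd z"] by (auto intro!: continuous_intros)

lemma to_prob_sqrt: "to_prob X a \<Longrightarrow> to_prob (\<lambda>n \<omega>. sqrt (X n \<omega>)) (sqrt a)"
  using to_prob_continuous2[of X a X a "\<lambda>z. sqrt (fst z)"]
    isCont_o2[OF isCont_fst[OF continuous_ident] isCont_real_sqrt, of "(a, a)"] by simp

lemma to_prob_sum:
  "(\<And>i. i \<in> I \<Longrightarrow> to_prob (X i) (a i)) \<Longrightarrow> to_prob (\<lambda>n \<omega>. \<Sum>i\<in>I. X i n \<omega>) (\<Sum>i\<in>I. a i)"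
  by (induction I rule: infinite_finite_induct) (auto simp: to_prob_const intro!: to_prob_add)

lemma to_prob_prod:
  "(\<And>i. i \<in> I \<Longrightarrow> to_prob (X i) (a i)) \<Longrightarrow> to_prob (\<lambda>n \<omega>. \<Prod>i\<in>I. X i n \<omega>) (\<Prod>i\<in>I. a i)"
  by (induction I rule: infinite_finite_induct) (auto simp: to_prob_const intro!: to_prob_mult)

lemma off_small_nonzero:
  assumes "to_prob Z c" "c \<noteq> 0" "0 < e"
  shows "off_small e (\<lambda>n \<omega>. Z n \<omega> \<noteq> 0)"
  using to_probD[OF assms(1,3), of "\<bar>c\<bar>"] assms(2) by (auto elim!: off_small_mono)

text \<open>Lets the statistic be replaced by a formula that is valid only where the Gram matrix is
  nonsingular.\<close>

lemma to_prob_off_small_cong: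
  assumes Z: "to_prob Z c" and eq: "\<And>e. 0 < e \<Longrightarrow> off_small e (\<lambda>n \<omega>. Z' n \<omega> = Z n \<omega>)"
  shows "to_prob Z' c"
  unfolding to_prob_def
proof (intro allI impI)
  fix e :: real assume e: "0 < e"
  show "off_small e (\<lambda>n \<omega>. \<bar>Z' n \<omega> - c\<bar> < e)"
    by (rule off_small_conj[OF to_probD[OF Z, of "e / 2" e] eq[of "e / 2"]]) (use e in auto)
qed

lemma to_prob_cong:
  assumes "to_prob Z c" "\<forall>\<^sub>F n in sequentially. \<forall>\<omega>\<in>space M. Z' n \<omega> = Z n \<omega>"
  shows "to_prob Z' c"
  using assms(1) by (rule to_prob_off_small_cong) (use assms(2) in \<open>simp add: off_small_always\<close>)

lemma conv_in_prob_to_prob: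
  assumes "conv_in_prob M Z c" and [measurable]: "\<And>n. Z n \<in> borel_measurable M"
  shows "to_prob Z c"
  unfolding to_prob_def
proof (intro allI impI)
  fix e :: real assume e: "0 < e"
  \<comment> \<open>Half the tolerance, since the complement yields a weak inequality and
    \<open>to_prob\<close> asks for a strict one.\<close>
  let ?A = "\<lambda>n. {\<omega> \<in> space M. \<bar>Z n \<omega> - c\<bar> > e / 2}"
  have "(\<lambda>n. prob (?A n)) \<longlonglongrightarrow> 0"
    using assms(1) e unfolding conv_in_prob_def using half_gt_zero by blast
  then have "\<forall>\<^sub>F n in sequentially. prob (?A n) < e"
    using e by (simp add: order_tendstoD)
  then have "\<forall>\<^sub>F n in sequentially. prob (?A n) \<le> e \<and> (\<forall>\<omega>\<in>space M - ?A n. \<bar>Z n \<omega> - c\<bar> < e)"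
    by eventually_elim (use e in auto)
  then show "off_small e (\<lambda>n \<omega>. \<bar>Z n \<omega> - c\<bar> < e)"
    unfolding off_small_def by (intro exI[of _ ?A]) auto
qed

section \<open>Calculus of stochastic boundedness\<close>

lemma stoch_bounded_add:
  assumes "stoch_bounded X" "stoch_bounded Y"
  shows "stoch_bounded (\<lambda>n \<omega>. X n \<omega> + Y n \<omega>)"
  unfolding stoch_bounded_def
proof (intro allI impI)
  fix e :: real assume e: "0 < e"
  then obtain K L where "off_small (e / 2) (\<lambda>n \<omega>. \<bar>X n \<omega>\<bar> \<le> K)" "off_small (e / 2) (\<lambda>n \<omega>. \<bar>Y n \<omega>\<bar> \<le> L)"
    using assms unfolding stoch_bounded_def by (meson half_gt_zero)
  then have "off_small e (\<lambda>n \<omega>. \<bar>X n \<omega> + Y n \<omega>\<bar> \<le> K + L)"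
    by (rule off_small_conj) auto
  then show "\<exists>K. off_small e (\<lambda>n \<omega>. \<bar>X n \<omega> + Y n \<omega>\<bar> \<le> K)" by blast
qed

lemma stoch_bounded_mult:
  assumes "stoch_bounded X" "stoch_bounded Y"
  shows "stoch_bounded (\<lambda>n \<omega>. X n \<omega> * Y n \<omega>)"
  unfolding stoch_bounded_def
proof (intro allI impI)
  fix e :: real assume e: "0 < e"
  then obtain K L where "off_small (e / 2) (\<lambda>n \<omega>. \<bar>X n \<omega>\<bar> \<le> K)" "off_small (e / 2) (\<lambda>n \<omega>. \<bar>Y n \<omega>\<bar> \<le> L)"
    using assms unfolding stoch_bounded_def by (meson half_gt_zero)
  then have "off_small e (\<lambda>n \<omega>. \<bar>X n \<omega> * Y n \<omega>\<bar> \<le> \<bar>K\<bar> * \<bar>L\<bar>)"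
    by (rule off_small_conj) (auto simp: abs_mult intro!: mult_mono)
  then show "\<exists>K. off_small e (\<lambda>n \<omega>. \<bar>X n \<omega> * Y n \<omega>\<bar> \<le> K)" by blast
qed

lemma to_prob_stoch_bounded:
  assumes "to_prob X a"
  shows "stoch_bounded X"
  unfolding stoch_bounded_def
proof (intro allI impI)
  fix e :: real assume "0 < e"
  then have "off_small e (\<lambda>n \<omega>. \<bar>X n \<omega> - a\<bar> < 1)" by (intro to_probD[OF assms]) auto
  then have "off_small e (\<lambda>n \<omega>. \<bar>X n \<omega>\<bar> \<le> \<bar>a\<bar> + 1)" by (rule off_small_mono) auto
  then show "\<exists>K. off_small e (\<lambda>n \<omega>. \<bar>X n \<omega>\<bar> \<le> K)" by blast
qed

lemma stoch_bounded_cmult: "stoch_bounded X \<Longrightarrow> stoch_bounded (\<lambda>n \<omega>. c * X n \<omega>)"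
  using stoch_bounded_mult[OF to_prob_stoch_bounded[OF to_prob_const]] .

lemma stoch_bounded_diff:
  "stoch_bounded X \<Longrightarrow> stoch_bounded Y \<Longrightarrow> stoch_bounded (\<lambda>n \<omega>. X n \<omega> - Y n \<omega>)"
  using stoch_bounded_add[OF _ stoch_bounded_cmult[of Y "- 1"], of X] by simp

lemma stoch_bounded_sum:
  "(\<And>i. i \<in> I \<Longrightarrow> stoch_bounded (X i)) \<Longrightarrow> stoch_bounded (\<lambda>n \<omega>. \<Sum>i\<in>I. X i n \<omega>)"
  by (induction I rule: infinite_finite_induct)
    (auto simp: to_prob_stoch_bounded[OF to_prob_const] intro!: stoch_bounded_add)

text \<open>The rule o_P(1) * O_P(1) = o_P(1), by which all remainder terms are discarded.\<close>

lemma to_prob_zero_mult_bounded: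
  assumes "to_prob X 0" "stoch_bounded Y"
  shows "to_prob (\<lambda>n \<omega>. X n \<omega> * Y n \<omega>) 0"
  unfolding to_prob_def
proof (intro allI impI)
  fix e :: real assume e: "0 < e"
  then obtain K where K: "off_small (e / 2) (\<lambda>n \<omega>. \<bar>Y n \<omega>\<bar> \<le> K)"
    using assms(2) unfolding stoch_bounded_def by (meson half_gt_zero)
  \<comment> \<open>The bound \<open>K\<close> may be zero or negative; its absolute value plus one
    is a safe divisor.\<close>
  have "off_small (e / 2) (\<lambda>n \<omega>. \<bar>X n \<omega> - 0\<bar> < e / (\<bar>K\<bar> + 1))"
    using e by (intro to_probD[OF assms(1)]) auto
  from this K show "off_small e (\<lambda>n \<omega>. \<bar>X n \<omega> * Y n \<omega> - 0\<bar> < e)"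
  proof (rule off_small_conj)
    have "\<bar>x * y\<bar> < e" if "\<bar>x\<bar> < e / (\<bar>K\<bar> + 1)" "\<bar>y\<bar> \<le> K" for x y
    proof -
      have "\<bar>x\<bar> * \<bar>y\<bar> \<le> \<bar>x\<bar> * (\<bar>K\<bar> + 1)" using that by (intro mult_left_mono) auto
      also have "\<dots> < e" using that(1) by (simp add: field_simps)
      finally show ?thesis by (simp add: abs_mult)
    qed
    then show "\<bar>X n \<omega> * Y n \<omega> - 0\<bar> < e"
      if "\<bar>X n \<omega> - 0\<bar> < e / (\<bar>K\<bar> + 1)" "\<bar>Y n \<omega>\<bar> \<le> K" for n \<omega> using that by simp
  qed simp
qed

lemma stoch_bounded_div_sqrt:
  assumes "stoch_bounded Y"
  shows "to_prob (\<lambda>n \<omega>. Y n \<omega> / sqrt (real n)) 0"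
proof -
  have "(\<lambda>n. 1 / sqrt (real n)) \<longlonglongrightarrow> 0" by real_asymp
  from to_prob_zero_mult_bounded[OF to_prob_seq[OF this] assms] show ?thesis by simp
qed

section \<open>Criteria by moments and by weak limits\<close>

lemma to_prob_mean:
  assumes int: "\<And>n. integrable M (Z n)"
    and bound: "\<And>e. 0 < e \<Longrightarrow> \<forall>\<^sub>F n in sequentially. expectation (\<lambda>\<omega>. \<bar>Z n \<omega> - c\<bar>) \<le> e"
  shows "to_prob Z c"
  unfolding to_prob_def
proof (intro allI impI)
  fix e :: real assume e: "0 < e"
  have [measurable]: "\<And>n. Z n \<in> borel_measurable M" using int by auto
  let ?A = "\<lambda>n. {\<omega> \<in> space M. \<bar>Z n \<omega> - c\<bar> \<ge> e}"
  have "\<forall>\<^sub>F n in sequentially. expectation (\<lambda>\<omega>. \<bar>Z n \<omega> - c\<bar>) \<le> e * e"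
    using bound[of "e * e"] e by simp
  then have "\<forall>\<^sub>F n in sequentially. prob (?A n) \<le> e \<and> (\<forall>\<omega>\<in>space M - ?A n. \<bar>Z n \<omega> - c\<bar> < e)"
  proof eventually_elim
    case (elim n)
    \<comment> \<open>Markov's inequality at level \<open>e\<close>; the mean was bounded by
      \<open>e * e\<close> so that the quotient is at most \<open>e\<close>.\<close>
    have "prob (?A n) \<le> expectation (\<lambda>\<omega>. \<bar>Z n \<omega> - c\<bar>) / e"
      using e int by (intro integral_Markov_inequality_measure[where A = "{}"]) auto
    also have "\<dots> \<le> e" using elim e by (simp add: field_simps)
    finally show ?case by auto
  qed
  then show "off_small e (\<lambda>n \<omega>. \<bar>Z n \<omega> - c\<bar> < e)"
    unfolding off_small_def by (intro exI[of _ ?A]) auto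
qed

lemma stoch_bounded_second_moment:
  assumes [measurable]: "\<And>n. Z n \<in> borel_measurable M"
    and int: "\<And>n. integrable M (\<lambda>\<omega>. (Z n \<omega>)\<^sup>2)"
    and bound: "\<And>n. expectation (\<lambda>\<omega>. (Z n \<omega>)\<^sup>2) \<le> C"
  shows "stoch_bounded Z"
  unfolding stoch_bounded_def
proof (intro allI impI)
  fix e :: real assume e: "0 < e"
  have "0 \<le> expectation (\<lambda>\<omega>. (Z 0 \<omega>)\<^sup>2)" by simp
  with bound[of 0] have C: "0 \<le> C" by linarith
  \<comment> \<open>The summand 1 keeps \<open>K\<close> positive when \<open>C = 0\<close>.\<close>
  define K where "K = (C + 1) / e"
  have K: "0 < K" unfolding K_def using C e by simp
  let ?A = "\<lambda>n. {\<omega> \<in> space M. (Z n \<omega>)\<^sup>2 \<ge> K}"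
  have "prob (?A n) \<le> e" for n
  proof -
    have "prob (?A n) \<le> expectation (\<lambda>\<omega>. (Z n \<omega>)\<^sup>2) / K"
      using K int by (intro integral_Markov_inequality_measure[where A = "{}"]) auto
    also have "\<dots> \<le> (C + 1) / K" using bound[of n] K by (intro divide_right_mono) auto
    also have "\<dots> = e" unfolding K_def using C e by simp
    finally show ?thesis .
  qed
  moreover have "\<bar>Z n \<omega>\<bar> \<le> sqrt K" if "\<omega> \<in> space M - ?A n" for n \<omega>
    using that by (auto intro!: real_le_rsqrt)
  ultimately have "off_small e (\<lambda>n \<omega>. \<bar>Z n \<omega>\<bar> \<le> sqrt K)"
    unfolding off_small_def by (intro exI[of _ ?A]) auto
  then show "\<exists>K. off_small e (\<lambda>n \<omega>. \<bar>Z n \<omega>\<bar> \<le> K)" by blast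
qed

text \<open>Weakly convergent sequences are tight. Without atoms in the limit, the distribution
  functions converge at every point, so the small tails of the limit law carry over. Meant for sums
  of dependent terms whose moments are out of reach.\<close>

lemma weak_conv_stoch_bounded:
  assumes [measurable]: "\<And>n. Z n \<in> borel_measurable M"
    and conv: "conv_in_distr M Z N" and N: "real_distribution N" and atomless: "\<And>a. measure N {a} = 0"
  shows "stoch_bounded Z"
  unfolding stoch_bounded_def
proof (intro allI impI)
  fix e :: real assume e: "0 < e"
  interpret N: real_distribution N by fact
  have cdf: "(\<lambda>n. cdf (distr M borel (Z n)) a) \<longlonglongrightarrow> cdf N a" for a
    using conv N.isCont_cdf[of a] atomless[of a] unfolding weak_conv_m_def weak_conv_def by simp
  have "\<forall>\<^sub>F a in at_top. cdf N a > 1 - e / 4"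
    using order_tendstoD(1)[OF N.cdf_lim_at_top_prob, of "1 - e / 4"] e by simp
  moreover have "\<forall>\<^sub>F a in at_bot. cdf N a < e / 4"
    using order_tendstoD(2)[OF N.cdf_lim_at_bot, of "e / 4"] e by simp
  then have "\<forall>\<^sub>F a in at_top. cdf N (- a) < e / 4"
    by (simp add: at_bot_mirror eventually_filtermap)
  ultimately have "\<forall>\<^sub>F a in at_top. cdf N a > 1 - e / 4 \<and> cdf N (- a) < e / 4"
    by (rule eventually_conj)
  from eventually_happens[OF this] obtain K where K: "cdf N K > 1 - e / 4" "cdf N (- K) < e / 4"
    by auto
  let ?A = "\<lambda>n. {\<omega> \<in> space M. Z n \<omega> \<le> - K} \<union> {\<omega> \<in> space M. K < Z n \<omega>}"
  have "\<forall>\<^sub>F n in sequentially. cdf (distr M borel (Z n)) K > 1 - e / 4"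
    "\<forall>\<^sub>F n in sequentially. cdf (distr M borel (Z n)) (- K) < e / 4"
    by (rule order_tendstoD(1)[OF cdf K(1)] order_tendstoD(2)[OF cdf K(2)])+
  then have "\<forall>\<^sub>F n in sequentially. prob (?A n) \<le> e \<and> (\<forall>\<omega>\<in>space M - ?A n. \<bar>Z n \<omega>\<bar> \<le> K)"
  proof eventually_elim
    case (elim n)
    have cdf_eq: "cdf (distr M borel (Z n)) a = prob {\<omega> \<in> space M. Z n \<omega> \<le> a}" for a
      by (simp add: cdf_def measure_distr vimage_def Int_def conj_commute)
    have "prob (?A n) \<le> prob {\<omega> \<in> space M. Z n \<omega> \<le> - K} + prob {\<omega> \<in> space M. K < Z n \<omega>}"
      by (intro measure_Un_le) auto
    also have "prob {\<omega> \<in> space M. K < Z n \<omega>} = 1 - prob {\<omega> \<in> space M. Z n \<omega> \<le> K}"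
      by (subst prob_neg[symmetric]) (auto simp: not_le)
    finally show ?case using elim unfolding cdf_eq using e by auto
  qed
  then have "off_small e (\<lambda>n \<omega>. \<bar>Z n \<omega>\<bar> \<le> K)"
    unfolding off_small_def by (intro exI[of _ ?A]) auto
  then show "\<exists>K. off_small e (\<lambda>n \<omega>. \<bar>Z n \<omega>\<bar> \<le> K)" by blast
qed

text \<open>Slutsky's theorem on the level of characteristic functions: \<open>iexp\<close> is
  Lipschitz, which controls the difference off the exceptional event, and bounded, which controls it
  on that event.\<close>

lemma char_slutsky:
  assumes X[measurable]: "\<And>n. X n \<in> borel_measurable M" and Y[measurable]: "\<And>n. Y n \<in> borel_measurable M"
    and diff: "to_prob (\<lambda>n \<omega>. Y n \<omega> - X n \<omega>) 0"
    and lim: "(\<lambda>n. char (distr M borel (X n)) t) \<longlonglongrightarrow> c"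
  shows "(\<lambda>n. char (distr M borel (Y n)) t) \<longlonglongrightarrow> c"
proof -
  have eq: "char (distr M borel Z) t = expectation (\<lambda>\<omega>. iexp (t * Z \<omega>))"
    if [measurable]: "Z \<in> borel_measurable M" for Z :: "'a \<Rightarrow> real"
    by (simp add: char_def integral_distr)
  have "(\<lambda>n. char (distr M borel (Y n)) t - char (distr M borel (X n)) t) \<longlonglongrightarrow> 0"
  proof (rule tendstoI)
    fix e :: real assume e: "0 < e"
    \<comment> \<open>The difference is at most \<open>e'\<close> off the event and 2 on it, in
      total \<open>e' + 2 * e'\<close>, which is below \<open>e\<close>.\<close>
    define e' where "e' = e / 4"
    have e': "0 < e'" using e unfolding e'_def by simp
    have "off_small e' (\<lambda>n \<omega>. \<bar>(Y n \<omega> - X n \<omega>) - 0\<bar> < e' / (\<bar>t\<bar> + 1))"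
      using e' by (intro to_probD[OF diff]) auto
    then obtain A where A: "\<And>n. A n \<in> events" and ev:
      "\<forall>\<^sub>F n in sequentially. prob (A n) \<le> e' \<and> (\<forall>\<omega>\<in>space M - A n. \<bar>Y n \<omega> - X n \<omega>\<bar> < e' / (\<bar>t\<bar> + 1))"
      unfolding off_small_def by auto
    show "\<forall>\<^sub>F n in sequentially. dist (char (distr M borel (Y n)) t - char (distr M borel (X n)) t) 0 < e"
      using ev
    proof eventually_elim
      case (elim n)
      have [measurable]: "A n \<in> events" by (rule A)
      have int: "integrable M (\<lambda>\<omega>. iexp (t * Z \<omega>))"
        if [measurable]: "Z \<in> borel_measurable M" for Z :: "'a \<Rightarrow> real"
        by (rule integrable_const_bound[where B = 1]) auto
      have iA: "integrable M (\<lambda>\<omega>. indicator (A n) \<omega> :: real)"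
        by (rule integrable_const_bound[where B = 1]) (auto simp: indicator_def)
      have pt: "cmod (iexp (t * Y n \<omega>) - iexp (t * X n \<omega>)) \<le> e' + 2 * indicator (A n) \<omega>" if w: "\<omega> \<in> space M" for \<omega>
      proof (cases "\<omega> \<in> A n")
        case True
        have "cmod (iexp (t * Y n \<omega>) - iexp (t * X n \<omega>)) \<le> 1 + 1"
          by (rule order_trans[OF norm_triangle_ineq4]) simp
        then show ?thesis using True e' by simp
      next
        case False
        have "cmod (iexp (t * Y n \<omega>) - iexp (t * X n \<omega>)) \<le> \<bar>t * Y n \<omega> - t * X n \<omega>\<bar>" by (rule norm_iexp_diff_le)
        also have "\<dots> = \<bar>t\<bar> * \<bar>Y n \<omega> - X n \<omega>\<bar>" by (simp add: abs_mult flip: right_diff_distrib)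
        also have "\<dots> \<le> \<bar>t\<bar> * (e' / (\<bar>t\<bar> + 1))"
          using elim False w by (intro mult_left_mono) (auto simp: less_imp_le)
        also have "\<dots> \<le> e'" using e' by (simp add: field_simps)
        finally show ?thesis using False by simp
      qed
      have "cmod (char (distr M borel (Y n)) t - char (distr M borel (X n)) t)
          = cmod (expectation (\<lambda>\<omega>. iexp (t * Y n \<omega>) - iexp (t * X n \<omega>)))"
        unfolding eq[OF X] eq[OF Y] by (subst Bochner_Integration.integral_diff[OF int[OF Y] int[OF X]]) (rule refl)
      also have "\<dots> \<le> expectation (\<lambda>\<omega>. cmod (iexp (t * Y n \<omega>) - iexp (t * X n \<omega>)))"
        by (rule integral_norm_bound)
      also have "\<dots> \<le> expectation (\<lambda>\<omega>. e' + 2 * indicator (A n) \<omega>)"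
        using pt iA by (intro integral_mono integrable_norm Bochner_Integration.integrable_diff int[OF X] int[OF Y]) auto
      also have "\<dots> = e' + 2 * prob (A n)" using iA by (simp add: prob_space)
      also have "\<dots> < e" using elim e unfolding e'_def by linarith
      finally show ?case by simp
    qed
  qed
  from tendsto_add[OF this lim] show ?thesis by simp
qed

end

section \<open>Limits of determinants; normal laws\<close>

lemma det_mat_diag: "Determinant.det (mat_diag n f :: real mat) = (\<Prod>i<n. f i)"
proof -
  have "Determinant.det (mat_diag n f :: real mat) = prod_list (diag_mat (mat_diag n f))"
    by (rule det_upper_triangular[where n = n]) (auto simp: mat_diag_def)
  then show ?thesis
    unfolding prod_list_diag_prod by (simp add: lessThan_atLeast0 mat_diag_def)
qed

lemma inv_mat_diag:
  assumes "\<And>i. i < n \<Longrightarrow> f i \<noteq> 0"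
  shows "inv_mat (mat_diag n f) = mat_diag n (\<lambda>i. 1 / f i)"
proof (rule inv_mat_unique(2)[of _ n])
  have "mat_diag n f * mat_diag n (\<lambda>i. 1 / f i) = mat_diag n (\<lambda>i. f i * (1 / f i))"
    by (rule mat_diag_diag)
  also have "\<dots> = 1\<^sub>m n"
    using assms by (intro eq_matI) (auto simp: mat_diag_def)
  finally show "mat_diag n f * mat_diag n (\<lambda>i. 1 / f i) = 1\<^sub>m n" .
qed auto

lemma inv_entry_mat_diag:
  assumes f: "\<And>i. i < n \<Longrightarrow> f i \<noteq> 0" and "k < n" "l < n"
  shows "inv_entry (mat_diag n f) k l = (if k = l then 1 / f k else 0)"
proof -
  have "Determinant.det (mat_diag n f) \<noteq> 0" using f by (simp add: det_mat_diag)
  from inv_mat_index[OF mat_diag_dim this assms(2,3)] show ?thesis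
    using assms inv_mat_diag[of n f] by (auto simp: mat_diag_def)
qed

lemma measurable_det:
  assumes A: "\<And>\<omega>. A \<omega> \<in> carrier_mat m m"
    and [measurable]: "\<And>k l. k < m \<Longrightarrow> l < m \<Longrightarrow> (\<lambda>\<omega>. A \<omega> $$ (k, l) :: real) \<in> borel_measurable N"
  shows "(\<lambda>\<omega>. Determinant.det (A \<omega>)) \<in> borel_measurable N"
  unfolding det_def'[OF A]
proof (intro borel_measurable_sum borel_measurable_times borel_measurable_const borel_measurable_prod)
  fix p i assume "p \<in> {p. p permutes {0..<m}}" "i \<in> {0..<m}"
  then have "i < m" "p i < m" using permutes_in_image[of p "{0..<m}" i] by auto
  then show "(\<lambda>\<omega>. A \<omega> $$ (i, p i)) \<in> borel_measurable N" by simp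
qed

lemma mat_delete_entry:
  assumes A: "A \<in> carrier_mat m m" and "k < m - 1" "l < m - 1"
  shows "mat_delete A i j $$ (k, l) = A $$ (if k < i then k else Suc k, if l < j then l else Suc l)"
  using assms by (simp add: mat_delete_def)

lemma measurable_inv_entry:
  assumes A: "\<And>\<omega>. A \<omega> \<in> carrier_mat m m"
    and meas: "\<And>k l. k < m \<Longrightarrow> l < m \<Longrightarrow> (\<lambda>\<omega>. A \<omega> $$ (k, l) :: real) \<in> borel_measurable N"
  shows "(\<lambda>\<omega>. inv_entry (A \<omega>) i j) \<in> borel_measurable N"
proof -
  have "(\<lambda>\<omega>. Determinant.det (mat_delete (A \<omega>) j i)) \<in> borel_measurable N"
    by (rule measurable_det[OF mat_delete_carrier[OF A]])
      (auto simp: mat_delete_entry[OF A] intro!: meas)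
  then show ?thesis
    unfolding inv_entry_def cofactor_def using measurable_det[OF A meas]
    by (intro borel_measurable_divide borel_measurable_times borel_measurable_const)
qed

context prob_space
begin

text \<open>By the Leibniz formula the determinant is a polynomial in the entries.\<close>

lemma to_prob_det:
  assumes A: "\<And>n \<omega>. A n \<omega> \<in> carrier_mat m m" and Q: "Q \<in> carrier_mat m m"
    and lim: "\<And>k l. k < m \<Longrightarrow> l < m \<Longrightarrow> to_prob (\<lambda>n \<omega>. A n \<omega> $$ (k, l)) (Q $$ (k, l))"
  shows "to_prob (\<lambda>n \<omega>. Determinant.det (A n \<omega>)) (Determinant.det Q)"
  unfolding det_def'[OF A] det_def'[OF Q]
proof (intro to_prob_sum to_prob_mult to_prob_const to_prob_prod)
  fix p i assume "p \<in> {p. p permutes {0..<m}}" "i \<in> {0..<m}"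
  then have "i < m" "p i < m" using permutes_in_image[of p "{0..<m}" i] by auto
  then show "to_prob (\<lambda>n \<omega>. A n \<omega> $$ (i, p i)) (Q $$ (i, p i))" by (rule lim)
qed

text \<open>Minors and determinant converge, and the quotient is continuous where the limiting
  determinant is nonzero. The matrices themselves may be singular: \<open>inv_entry\<close> is a
  total function, with division by zero giving 0.\<close>

lemma to_prob_inv_entry:
  assumes A: "\<And>n \<omega>. A n \<omega> \<in> carrier_mat m m" and Q: "Q \<in> carrier_mat m m"
    and lim: "\<And>k l. k < m \<Longrightarrow> l < m \<Longrightarrow> to_prob (\<lambda>n \<omega>. A n \<omega> $$ (k, l)) (Q $$ (k, l))"
    and det: "Determinant.det Q \<noteq> 0"
  shows "to_prob (\<lambda>n \<omega>. inv_entry (A n \<omega>) i j) (inv_entry Q i j)"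
proof -
  have "to_prob (\<lambda>n \<omega>. Determinant.det (mat_delete (A n \<omega>) j i)) (Determinant.det (mat_delete Q j i))"
    by (rule to_prob_det[OF mat_delete_carrier[OF A] mat_delete_carrier[OF Q]])
      (auto simp: mat_delete_entry[OF A] mat_delete_entry[OF Q] intro!: lim)
  then show ?thesis
    unfolding inv_entry_def cofactor_def using to_prob_det[OF A Q lim] det
    by (intro to_prob_divide to_prob_mult to_prob_const)
qed

end

section \<open>Normal laws and their characteristic functions\<close>

lemma real_distribution_normal_law:
  assumes "0 < v"
  shows "real_distribution (normal_law m v)"
  unfolding real_distribution_def real_distribution_axioms_def normal_law_def
  using prob_space_normal_density[of "sqrt v" m] assms by simp

lemma normal_law_atomless: "measure (normal_law m v) {a} = 0"
proof -
  have "emeasure (normal_law m v) {a} = (\<integral>\<^sup>+ y. ennreal (normal_density m (sqrt v) y) * indicator {a} y \<partial>lborel)"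
    unfolding normal_law_def by (intro emeasure_density) auto
  also have "\<dots> = 0"
    using AE_lborel_singleton[of a] by (subst nn_integral_0_iff_AE) (auto elim: AE_mp simp: indicator_def)
  finally show ?thesis by (simp add: measure_def)
qed

text \<open>The law is the image of the standard normal law under the affine map with slope
  \<open>sqrt v\<close> and intercept \<open>m\<close>.\<close>

lemma char_normal_law:
  assumes v: "0 < v"
  shows "char (normal_law m v) t = iexp (t * m) * exp (- (t\<^sup>2 * v / 2))"
proof -
  interpret N: prob_space std_normal_distribution
    by (rule prob_space_normal_density) simp
  have "distributed std_normal_distribution lborel (\<lambda>x. x) std_normal_density"
    unfolding distributed_def
  proof (intro conjI)
    show "distr std_normal_distribution lborel (\<lambda>x. x) = std_normal_distribution"
      by (intro measure_eqI) (auto simp: emeasure_distr)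
  qed auto
  from N.normal_density_affine[OF this, of "sqrt v" m] v
  have "distributed std_normal_distribution lborel (\<lambda>x. m + sqrt v * x) (normal_density m (sqrt v))"
    by simp
  from distributed_distr_eq_density[OF this]
  have eq: "normal_law m v = distr std_normal_distribution lborel (\<lambda>x. m + sqrt v * x)"
    unfolding normal_law_def ..
  have "char (normal_law m v) t = (CLINT x|std_normal_distribution. iexp (t * (m + sqrt v * x)))"
    unfolding char_def eq by (subst integral_distr) auto
  also have "\<dots> = (CLINT x|std_normal_distribution. iexp (t * m) * iexp ((t * sqrt v) * x))"
    by (simp add: algebra_simps exp_add)
  also have "\<dots> = iexp (t * m) * char std_normal_distribution (t * sqrt v)"
    unfolding char_def by (rule integral_mult_right_zero)
  also have "\<dots> = iexp (t * m) * exp (- (t\<^sup>2 * v / 2))"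
    unfolding char_std_normal_distribution using v by (simp add: power_mult_distrib)
  finally show ?thesis by simp
qed

text \<open>For a diagonal covariance the quadratic form is a sum and the determinant a product over
  the coordinates, so the density factorizes. The empty product covers \<open>d = 0\<close>.\<close>

lemma mv_normal_law_diag:
  assumes f: "\<And>j. j < d \<Longrightarrow> 0 < f j"
  shows "mv_normal_law d (0\<^sub>v d) (mat_diag d f)
    = density (\<Pi>\<^sub>M j\<in>{..<d}. lborel) (\<lambda>y. ennreal (\<Prod>j<d. normal_density 0 (sqrt (f j)) (y j)))"
proof -
  have inv: "inv_mat (mat_diag d f) = mat_diag d (\<lambda>j. 1 / f j)"
    using f by (intro inv_mat_diag) (metis less_irrefl)
  have "exp (- scalar_prod (Matrix.vec d y - 0\<^sub>v d) (inv_mat (mat_diag d f) *\<^sub>v (Matrix.vec d y - 0\<^sub>v d)) / 2)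
      / sqrt ((2 * pi) ^ d * Determinant.det (mat_diag d f))
     = (\<Prod>j<d. normal_density 0 (sqrt (f j)) (y j))" for y :: "nat \<Rightarrow> real"
  proof -
    have "scalar_prod (Matrix.vec d y - 0\<^sub>v d) (inv_mat (mat_diag d f) *\<^sub>v (Matrix.vec d y - 0\<^sub>v d))
        = (\<Sum>j<d. y j * (\<Sum>k<d. (if j = k then 1 / f k else 0) * y k))"
      unfolding inv by (auto simp: scalar_prod_def mat_diag_def lessThan_atLeast0 intro!: sum.cong)
    also have "\<dots> = (\<Sum>j<d. (y j)\<^sup>2 / f j)"
    proof (intro sum.cong refl)
      fix j assume j: "j \<in> {..<d}"
      have "(\<Sum>k<d. (if j = k then 1 / f k else 0) * y k) = (\<Sum>k<d. if j = k then y k / f k else 0)"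
        by (intro sum.cong) auto
      also have "\<dots> = y j / f j" using j by simp
      finally show "y j * (\<Sum>k<d. (if j = k then 1 / f k else 0) * y k) = (y j)\<^sup>2 / f j"
        by (simp add: power2_eq_square)
    qed
    finally have 1: "exp (- scalar_prod (Matrix.vec d y - 0\<^sub>v d) (inv_mat (mat_diag d f) *\<^sub>v (Matrix.vec d y - 0\<^sub>v d)) / 2)
        = (\<Prod>j<d. exp (- ((y j)\<^sup>2 / (f j * 2))))"
      by (simp add: exp_sum sum_negf[symmetric] sum_divide_distrib)
    have 2: "sqrt ((2 * pi) ^ d * Determinant.det (mat_diag d f)) = (\<Prod>j<d. sqrt (2 * pi * f j))"
      unfolding det_mat_diag by (induction d) (auto simp: real_sqrt_mult mult_ac)
    show ?thesis
      unfolding 1 2 prod_dividef[symmetric] using f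
      by (intro prod.cong) (auto simp: normal_density_def less_imp_le mult.commute)
  qed
  then show ?thesis unfolding mv_normal_law_def Let_def by simp
qed

text \<open>Fubini over the coordinates reduces this to one-dimensional characteristic functions.
  Integrability is recorded because the integral is later split into real and imaginary
  part.\<close>

lemma integral_mv_normal_law_iexp:
  assumes f: "\<And>j. j < d \<Longrightarrow> 0 < f j"
  shows "integrable (mv_normal_law d (0\<^sub>v d) (mat_diag d f)) (\<lambda>y. iexp (\<Sum>j<d. c j * y j))"
    and "(CLINT y|mv_normal_law d (0\<^sub>v d) (mat_diag d f). iexp (\<Sum>j<d. c j * y j))
      = exp (- (\<Sum>j<d. (c j)\<^sup>2 * f j) / 2)"
proof -
  interpret product_sigma_finite "\<lambda>_::nat. lborel :: real measure" ..
  let ?N = "\<Pi>\<^sub>M j\<in>{..<d}. lborel :: real measure"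
  let ?g = "\<lambda>j y. complex_of_real (normal_density 0 (sqrt (f j)) y) * iexp (c j * y)"
  have g: "integrable lborel (?g j)" "integral\<^sup>L lborel (?g j) = exp (- ((c j)\<^sup>2 * f j / 2))" if j: "j < d" for j
  proof -
    have "integrable lborel (\<lambda>y. complex_of_real (normal_density 0 (sqrt (f j)) y))"
      using f[OF j] by (intro integrable_of_real integrable_normal_density) simp
    then show "integrable lborel (?g j)"
      by (rule Bochner_Integration.integrable_bound) (auto simp: norm_mult)
    have "integral\<^sup>L lborel (?g j) = char (normal_law 0 (f j)) (c j)"
      unfolding char_def normal_law_def by (subst integral_density) (auto simp: scaleR_conv_of_real)
    then show "integral\<^sup>L lborel (?g j) = exp (- ((c j)\<^sup>2 * f j / 2))"
      by (simp add: char_normal_law[OF f[OF j]])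
  qed
  have prod: "(\<Prod>j<d. normal_density 0 (sqrt (f j)) (y j)) *\<^sub>R iexp (\<Sum>j<d. c j * y j) = (\<Prod>j<d. ?g j (y j))" for y
    by (simp add: scaleR_conv_of_real prod.distrib exp_sum sum_distrib_left)
  have diag: "mv_normal_law d (0\<^sub>v d) (mat_diag d f)
      = density ?N (\<lambda>y. ennreal (\<Prod>j<d. normal_density 0 (sqrt (f j)) (y j)))"
    by (rule mv_normal_law_diag) (rule f)
  have [measurable]: "(\<lambda>y. \<Prod>j<d. normal_density 0 (sqrt (f j)) (y j)) \<in> borel_measurable ?N"
    "(\<lambda>y. iexp (\<Sum>j<d. c j * y j)) \<in> borel_measurable ?N" by measurable
  have pos: "AE y in ?N. 0 \<le> (\<Prod>j<d. normal_density 0 (sqrt (f j)) (y j))"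
    by (intro AE_I2 prod_nonneg) auto
  have "integrable ?N (\<lambda>y. \<Prod>j<d. ?g j (y j))"
    using g(1) by (intro product_integrable_prod) auto
  then show "integrable (mv_normal_law d (0\<^sub>v d) (mat_diag d f)) (\<lambda>y. iexp (\<Sum>j<d. c j * y j))"
    unfolding diag prod[symmetric] by (subst integrable_density) (use pos in auto)
  have "(CLINT y|mv_normal_law d (0\<^sub>v d) (mat_diag d f). iexp (\<Sum>j<d. c j * y j))
      = (CLINT y|?N. (\<Prod>j<d. ?g j (y j)))"
    unfolding diag prod[symmetric] by (rule integral_density) (use pos in auto)
  also have "\<dots> = (\<Prod>j<d. integral\<^sup>L lborel (?g j))"
    using g(1) by (intro product_integral_prod) auto
  also have "\<dots> = exp (- (\<Sum>j<d. (c j)\<^sup>2 * f j) / 2)"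
    using g(2) by (simp add: exp_sum sum_negf[symmetric] sum_divide_distrib flip: of_real_prod)
  finally show "(CLINT y|mv_normal_law d (0\<^sub>v d) (mat_diag d f). iexp (\<Sum>j<d. c j * y j))
      = exp (- (\<Sum>j<d. (c j)\<^sup>2 * f j) / 2)" .
qed

section \<open>Weak law of large numbers and signed sums\<close>

context prob_space
begin

lemma integrable_mult_of_squares:
  fixes X Y :: "'a \<Rightarrow> real"
  assumes [measurable]: "X \<in> borel_measurable M" "Y \<in> borel_measurable M"
    and "integrable M (\<lambda>\<omega>. (X \<omega>)\<^sup>2)" "integrable M (\<lambda>\<omega>. (Y \<omega>)\<^sup>2)"
  shows "integrable M (\<lambda>\<omega>. X \<omega> * Y \<omega>)"
proof (rule Bochner_Integration.integrable_bound)
  show "integrable M (\<lambda>\<omega>. (X \<omega>)\<^sup>2 + (Y \<omega>)\<^sup>2)" using assms by auto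
  have "\<bar>a * b\<bar> \<le> a\<^sup>2 + b\<^sup>2" for a b :: real
  proof -
    have "2 * \<bar>a\<bar> * \<bar>b\<bar> \<le> a\<^sup>2 + b\<^sup>2" using sum_squares_bound[of "\<bar>a\<bar>" "\<bar>b\<bar>"] by simp
    moreover have "0 \<le> \<bar>a\<bar> * \<bar>b\<bar>" by simp
    ultimately show ?thesis unfolding abs_mult by linarith
  qed
  then show "AE \<omega> in M. norm (X \<omega> * Y \<omega>) \<le> norm ((X \<omega>)\<^sup>2 + (Y \<omega>)\<^sup>2)" by simp
qed measurable

lemma uncorrelated_sum_second_moment:
  fixes V :: "nat \<Rightarrow> 'a \<Rightarrow> real"
  assumes meas: "\<And>i. V i \<in> borel_measurable M" and sq: "\<And>i. integrable M (\<lambda>\<omega>. (V i \<omega>)\<^sup>2)"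
    and uncor: "\<And>i j. i \<noteq> j \<Longrightarrow> expectation (\<lambda>\<omega>. V i \<omega> * V j \<omega>) = 0"
  shows "integrable M (\<lambda>\<omega>. (\<Sum>i<n. V i \<omega>)\<^sup>2)"
    and "expectation (\<lambda>\<omega>. (\<Sum>i<n. V i \<omega>)\<^sup>2) = (\<Sum>i<n. expectation (\<lambda>\<omega>. (V i \<omega>)\<^sup>2))"
proof -
  have eq: "(\<lambda>\<omega>. (\<Sum>i<n. V i \<omega>)\<^sup>2) = (\<lambda>\<omega>. \<Sum>i<n. \<Sum>j<n. V i \<omega> * V j \<omega>)"
    by (simp add: power2_eq_square sum_product)
  have int: "integrable M (\<lambda>\<omega>. V i \<omega> * V j \<omega>)" for i j
    by (intro integrable_mult_of_squares meas sq)
  show "integrable M (\<lambda>\<omega>. (\<Sum>i<n. V i \<omega>)\<^sup>2)"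
    unfolding eq by (intro Bochner_Integration.integrable_sum int)
  have "expectation (\<lambda>\<omega>. (\<Sum>i<n. V i \<omega>)\<^sup>2) = (\<Sum>i<n. \<Sum>j<n. expectation (\<lambda>\<omega>. V i \<omega> * V j \<omega>))"
    unfolding eq using int by (simp add: Bochner_Integration.integral_sum)
  also have "\<dots> = (\<Sum>i<n. \<Sum>j<n. if i = j then expectation (\<lambda>\<omega>. (V i \<omega>)\<^sup>2) else 0)"
    using uncor by (intro sum.cong refl) (auto simp: power2_eq_square)
  also have "\<dots> = (\<Sum>i<n. expectation (\<lambda>\<omega>. (V i \<omega>)\<^sup>2))" by simp
  finally show "expectation (\<lambda>\<omega>. (\<Sum>i<n. V i \<omega>)\<^sup>2) = (\<Sum>i<n. expectation (\<lambda>\<omega>. (V i \<omega>)\<^sup>2))" .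
qed

lemma stoch_bounded_uncorrelated_sum:
  fixes V :: "nat \<Rightarrow> 'a \<Rightarrow> real"
  assumes meas: "\<And>i. V i \<in> borel_measurable M" and sq: "\<And>i. integrable M (\<lambda>\<omega>. (V i \<omega>)\<^sup>2)"
    and uncor: "\<And>i j. i \<noteq> j \<Longrightarrow> expectation (\<lambda>\<omega>. V i \<omega> * V j \<omega>) = 0"
    and bound: "\<And>i. expectation (\<lambda>\<omega>. (V i \<omega>)\<^sup>2) \<le> C"
  shows "stoch_bounded (\<lambda>n \<omega>. (\<Sum>i<n. V i \<omega>) / sqrt (real n))"
proof (rule stoch_bounded_second_moment)
  fix n
  note U = uncorrelated_sum_second_moment[where V = V and n = n, OF meas sq uncor]
  show "(\<lambda>\<omega>. (\<Sum>i<n. V i \<omega>) / sqrt (real n)) \<in> borel_measurable M" using meas by measurable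
  have eq: "(\<lambda>\<omega>. ((\<Sum>i<n. V i \<omega>) / sqrt (real n))\<^sup>2) = (\<lambda>\<omega>. (\<Sum>i<n. V i \<omega>)\<^sup>2 / real n)"
    by (simp add: power_divide)
  show "integrable M (\<lambda>\<omega>. ((\<Sum>i<n. V i \<omega>) / sqrt (real n))\<^sup>2)"
    unfolding eq using U(1) by (rule integrable_divide) auto
  \<comment> \<open>For \<open>n = 0\<close> the normalized sum is 0 by division by zero, and the
    claimed bound then says \<open>0 \<le> C\<close>.\<close>
  have "0 \<le> expectation (\<lambda>\<omega>. (V 0 \<omega>)\<^sup>2)" by simp
  with bound[of 0] have C: "0 \<le> C" by linarith
  have "(\<Sum>i<n. expectation (\<lambda>\<omega>. (V i \<omega>)\<^sup>2)) \<le> real n * C"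
    using sum_bounded_above[of "{..<n}", OF bound] by simp
  then show "expectation (\<lambda>\<omega>. ((\<Sum>i<n. V i \<omega>) / sqrt (real n))\<^sup>2) \<le> C"
    unfolding eq using C U(2) by (cases "n = 0") (simp_all add: field_simps)
qed

lemma expectation_identically_distributed:
  fixes Z Z' :: "'a \<Rightarrow> real" and h :: "real \<Rightarrow> real"
  assumes [measurable]: "Z \<in> borel_measurable M" "Z' \<in> borel_measurable M" "h \<in> borel_measurable borel"
    and d: "distr M borel Z = distr M borel Z'"
  shows "integrable M (\<lambda>\<omega>. h (Z \<omega>)) \<longleftrightarrow> integrable M (\<lambda>\<omega>. h (Z' \<omega>))"
    and "expectation (\<lambda>\<omega>. h (Z \<omega>)) = expectation (\<lambda>\<omega>. h (Z' \<omega>))"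
  using integrable_distr_eq[of Z M borel h] integrable_distr_eq[of Z' M borel h]
    integral_distr[of Z M borel h] integral_distr[of Z' M borel h] d by auto

lemma indep_vars_expectation_mult:
  fixes Z :: "nat \<Rightarrow> 'a \<Rightarrow> real"
  assumes indep: "indep_vars (\<lambda>_. borel) Z UNIV" and "i \<noteq> j" and int: "\<And>i. integrable M (Z i)"
  shows "expectation (\<lambda>\<omega>. Z i \<omega> * Z j \<omega>) = expectation (Z i) * expectation (Z j)"
proof -
  have "expectation (\<lambda>\<omega>. \<Prod>k\<in>{i, j}. Z k \<omega>) = (\<Prod>k\<in>{i, j}. expectation (Z k))"
    using indep_vars_subset[OF indep, of "{i, j}"] int by (intro indep_vars_lebesgue_integral) auto
  then show ?thesis using \<open>i \<noteq> j\<close> by simp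
qed

text \<open>Only first moments are assumed, hence the truncation.\<close>

lemma weak_law_of_large_numbers:
  fixes Z :: "nat \<Rightarrow> 'a \<Rightarrow> real"
  assumes indep: "indep_vars (\<lambda>_. borel) Z UNIV"
    and ident: "\<And>i. distr M borel (Z i) = distr M borel (Z 0)"
    and int: "integrable M (Z 0)"
  shows "to_prob (\<lambda>n \<omega>. (\<Sum>i<n. Z i \<omega>) / real n) (expectation (Z 0))"
proof (rule to_prob_mean)
  have [measurable]: "Z i \<in> borel_measurable M" for i
    using indep unfolding indep_vars_def by simp
  have meas0: "Z i \<in> borel_measurable M" for i by measurable
  note id = expectation_identically_distributed[OF meas0 meas0 _ ident]
  have intZ: "integrable M (Z i)" for i
    using id(1)[of "\<lambda>x. x" i] int by simp
  show "integrable M (\<lambda>\<omega>. (\<Sum>i<n. Z i \<omega>) / real n)" for n using intZ by simp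
  fix e :: real assume e: "0 < e"
  define f where "f K z = (if \<bar>z\<bar> \<le> K then z else 0)" for K z :: real
  have [measurable]: "f K \<in> borel_measurable borel" for K unfolding f_def by measurable
  have fK: "\<bar>f K z\<bar> \<le> \<bar>K\<bar>" for K z unfolding f_def by auto
  have "(\<lambda>k. expectation (\<lambda>\<omega>. \<bar>Z 0 \<omega> - f (real k) (Z 0 \<omega>)\<bar>)) \<longlonglongrightarrow> expectation (\<lambda>\<omega>. 0)"
  proof (rule integral_dominated_convergence[where w = "\<lambda>\<omega>. \<bar>Z 0 \<omega>\<bar>"])
    show "integrable M (\<lambda>\<omega>. \<bar>Z 0 \<omega>\<bar>)" using int by simp
    have "(\<lambda>k. \<bar>z - f (real k) z\<bar>) \<longlonglongrightarrow> 0" for z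
    proof (rule tendsto_eventually)
      show "\<forall>\<^sub>F k in sequentially. \<bar>z - f (real k) z\<bar> = 0"
        using eventually_ge_at_top[of "nat \<lceil>\<bar>z\<bar>\<rceil>"]
        by eventually_elim (simp add: f_def nat_ceiling_le_eq)
    qed
    then show "AE \<omega> in M. (\<lambda>k. \<bar>Z 0 \<omega> - f (real k) (Z 0 \<omega>)\<bar>) \<longlonglongrightarrow> 0" by simp
  qed (auto simp: f_def)
  then have "\<forall>\<^sub>F k in sequentially. expectation (\<lambda>\<omega>. \<bar>Z 0 \<omega> - f (real k) (Z 0 \<omega>)\<bar>) < e / 3"
    using e by (intro order_tendstoD(2)) auto
  from eventually_happens[OF this] obtain k where
    k: "expectation (\<lambda>\<omega>. \<bar>Z 0 \<omega> - f (real k) (Z 0 \<omega>)\<bar>) < e / 3" by auto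
  \<comment> \<open>The truncation level is fixed before \<open>n\<close> grows: it makes the tails
    small uniformly in the unit, by identical distribution.\<close>
  define K where "K = real k"
  have K0: "0 \<le> K" unfolding K_def by simp
  define \<mu> where "\<mu> = expectation (\<lambda>\<omega>. f K (Z 0 \<omega>))"
  define V where "V i \<omega> = f K (Z i \<omega>) - \<mu>" for i \<omega>
  have [measurable]: "V i \<in> borel_measurable M" for i unfolding V_def by measurable
  have intf: "integrable M (\<lambda>\<omega>. f K (Z i \<omega>))" for i
    by (rule integrable_const_bound[where B = K]) (use fK[of K] K0 in auto)
  have mu: "\<bar>\<mu>\<bar> \<le> K"
    unfolding \<mu>_def using K0 fK[of K]
      integral_mono[of M "\<lambda>\<omega>. \<bar>f K (Z 0 \<omega>)\<bar>" "\<lambda>_. K"] intf[of 0]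
    by (intro order_trans[OF integral_abs_bound]) (auto simp: prob_space)
  have Vb: "\<bar>V i \<omega>\<bar> \<le> 2 * K" for i \<omega>
    using fK[of K "Z i \<omega>"] mu K0 unfolding V_def by linarith
  have V2: "(V i \<omega>)\<^sup>2 \<le> (2 * K)\<^sup>2" for i \<omega> using Vb[of i \<omega>] K0 abs_le_square_iff[of "V i \<omega>" "2 * K"] by simp
  have intV2: "integrable M (\<lambda>\<omega>. (V i \<omega>)\<^sup>2)" for i
    by (rule integrable_const_bound[where B = "(2 * K)\<^sup>2"]) (use V2 in auto)
  have EV2: "expectation (\<lambda>\<omega>. (V i \<omega>)\<^sup>2) \<le> (2 * K)\<^sup>2" for i
    using integral_mono[OF intV2[of i], of "\<lambda>_. (2 * K)\<^sup>2"] V2 by (simp add: prob_space)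
  have intV: "integrable M (V i)" for i unfolding V_def using intf by simp
  have "expectation (\<lambda>\<omega>. f K (Z i \<omega>)) = \<mu>" for i unfolding \<mu>_def by (intro id(2)) simp
  then have EV: "expectation (V i) = 0" for i
    unfolding V_def using intf by (simp add: prob_space)
  have "indep_vars (\<lambda>_. borel) V UNIV"
    unfolding V_def by (rule indep_vars_compose2[OF indep]) measurable
  then have uncor: "expectation (\<lambda>\<omega>. V i \<omega> * V j \<omega>) = 0" if "i \<noteq> j" for i j
    using indep_vars_expectation_mult[OF _ that intV] EV by simp
  note U = uncorrelated_sum_second_moment[where V = V, OF _ intV2 uncor]
  have EabsV: "expectation (\<lambda>\<omega>. \<bar>(\<Sum>i<n. V i \<omega>) / real n\<bar>) \<le> e / 6 + (3 / (2 * e)) * ((2 * K)\<^sup>2 / real n)"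
    if n: "0 < n" for n
  proof -
    \<comment> \<open>Passes from the first to the second absolute moment; the constants come from
      expanding the square of \<open>3 * \<bar>a\<bar> - e\<close>.\<close>
    have amgm: "\<bar>a\<bar> \<le> e / 6 + (3 / (2 * e)) * a\<^sup>2" for a
    proof -
      have "0 \<le> (3 * \<bar>a\<bar> - e)\<^sup>2" by simp
      then have "6 * e * \<bar>a\<bar> \<le> e\<^sup>2 + 9 * a\<^sup>2" by (simp add: power2_diff power_mult_distrib mult_ac add_ac)
      then show ?thesis using e by (simp add: field_simps power2_eq_square)
    qed
    have "expectation (\<lambda>\<omega>. \<bar>(\<Sum>i<n. V i \<omega>) / real n\<bar>)
        \<le> expectation (\<lambda>\<omega>. e / 6 + (3 / (2 * e)) * ((\<Sum>i<n. V i \<omega>) / real n)\<^sup>2)"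
    proof (rule integral_mono[OF _ _ amgm])
      show "integrable M (\<lambda>\<omega>. \<bar>(\<Sum>i<n. V i \<omega>) / real n\<bar>)" using intV by auto
      show "integrable M (\<lambda>\<omega>. e / 6 + (3 / (2 * e)) * ((\<Sum>i<n. V i \<omega>) / real n)\<^sup>2)"
        using U(1)[of n] by (simp add: power_divide)
    qed
    also have "\<dots> = e / 6 + (3 / (2 * e)) * ((\<Sum>i<n. expectation (\<lambda>\<omega>. (V i \<omega>)\<^sup>2)) / (real n)\<^sup>2)"
      using U[of n] by (simp add: power_divide prob_space)
    also have "\<dots> \<le> e / 6 + (3 / (2 * e)) * ((real n * (2 * K)\<^sup>2) / (real n)\<^sup>2)"
      using sum_bounded_above[of "{..<n}", OF EV2] e
      by (intro add_left_mono mult_left_mono divide_right_mono) auto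
    also have "(real n * (2 * K)\<^sup>2) / (real n)\<^sup>2 = (2 * K)\<^sup>2 / real n" using n by (simp add: power2_eq_square)
    finally show ?thesis .
  qed
  have Ediff: "expectation (\<lambda>\<omega>. \<bar>Z i \<omega> - f K (Z i \<omega>)\<bar>) \<le> e / 3" for i
    using id(2)[of "\<lambda>z. \<bar>z - f K z\<bar>" i] k unfolding K_def by simp
  have m: "\<bar>\<mu> - expectation (Z 0)\<bar> \<le> e / 3"
  proof -
    have "\<mu> - expectation (Z 0) = expectation (\<lambda>\<omega>. f K (Z 0 \<omega>) - Z 0 \<omega>)"
      unfolding \<mu>_def using intf int by simp
    also have "\<bar>\<dots>\<bar> \<le> expectation (\<lambda>\<omega>. \<bar>f K (Z 0 \<omega>) - Z 0 \<omega>\<bar>)" by (rule integral_abs_bound)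
    finally show ?thesis using Ediff[of 0] by (simp add: abs_minus_commute)
  qed
  have "(\<lambda>n. (3 / (2 * e)) * ((2 * K)\<^sup>2 / real n)) \<longlonglongrightarrow> 0" by real_asymp
  then have "\<forall>\<^sub>F n in sequentially. (3 / (2 * e)) * ((2 * K)\<^sup>2 / real n) < e / 6"
    using e by (intro order_tendstoD(2)) auto
  then show "\<forall>\<^sub>F n in sequentially. expectation (\<lambda>\<omega>. \<bar>(\<Sum>i<n. Z i \<omega>) / real n - expectation (Z 0)\<bar>) \<le> e"
    using eventually_gt_at_top[of 0]
  proof eventually_elim
    case (elim n)
    \<comment> \<open>The tolerance is split into e/3 for the cut-off tails of the sample, e/3 for
      the bias of the truncated mean, and twice e/6 for the fluctuation of the truncated
      mean.\<close>
    have pt: "\<bar>(\<Sum>i<n. Z i \<omega>) / real n - expectation (Z 0)\<bar>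
        \<le> \<bar>(\<Sum>i<n. V i \<omega>) / real n\<bar> + (\<Sum>i<n. \<bar>Z i \<omega> - f K (Z i \<omega>)\<bar>) / real n + e / 3" for \<omega>
    proof -
      have "(\<Sum>i<n. Z i \<omega>) / real n - expectation (Z 0)
          = (\<Sum>i<n. V i \<omega>) / real n + (\<Sum>i<n. Z i \<omega> - f K (Z i \<omega>)) / real n + (\<mu> - expectation (Z 0))"
        using elim(2) unfolding V_def by (simp add: sum_subtractf field_simps)
      moreover have "\<bar>(\<Sum>i<n. Z i \<omega> - f K (Z i \<omega>)) / real n\<bar> \<le> (\<Sum>i<n. \<bar>Z i \<omega> - f K (Z i \<omega>)\<bar>) / real n"
        by (simp add: abs_divide divide_right_mono sum_abs)
      ultimately show ?thesis using m by linarith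
    qed
    have intD: "integrable M (\<lambda>\<omega>. \<bar>Z i \<omega> - f K (Z i \<omega>)\<bar>)" for i
      using intZ intf by (intro integrable_abs Bochner_Integration.integrable_diff)
    have intA: "integrable M (\<lambda>\<omega>. \<bar>(\<Sum>i<n. V i \<omega>) / real n\<bar>)"
      "integrable M (\<lambda>\<omega>. (\<Sum>i<n. \<bar>Z i \<omega> - f K (Z i \<omega>)\<bar>) / real n)"
      using intV intD by (auto intro!: integrable_abs integrable_divide Bochner_Integration.integrable_sum)
    have "expectation (\<lambda>\<omega>. \<bar>(\<Sum>i<n. Z i \<omega>) / real n - expectation (Z 0)\<bar>)
        \<le> expectation (\<lambda>\<omega>. \<bar>(\<Sum>i<n. V i \<omega>) / real n\<bar> + (\<Sum>i<n. \<bar>Z i \<omega> - f K (Z i \<omega>)\<bar>) / real n + e / 3)"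
      using pt intZ intA by (intro integral_mono) (auto intro!: integrable_abs integrable_divide)
    also have "\<dots> = expectation (\<lambda>\<omega>. \<bar>(\<Sum>i<n. V i \<omega>) / real n\<bar>)
        + (\<Sum>i<n. expectation (\<lambda>\<omega>. \<bar>Z i \<omega> - f K (Z i \<omega>)\<bar>)) / real n + e / 3"
      using intA intD by (simp add: prob_space Bochner_Integration.integral_sum)
    finally have "expectation (\<lambda>\<omega>. \<bar>(\<Sum>i<n. Z i \<omega>) / real n - expectation (Z 0)\<bar>)
        \<le> expectation (\<lambda>\<omega>. \<bar>(\<Sum>i<n. V i \<omega>) / real n\<bar>)
        + (\<Sum>i<n. expectation (\<lambda>\<omega>. \<bar>Z i \<omega> - f K (Z i \<omega>)\<bar>)) / real n + e / 3" .
    moreover have "(\<Sum>i<n. expectation (\<lambda>\<omega>. \<bar>Z i \<omega> - f K (Z i \<omega>)\<bar>)) / real n \<le> e / 3"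
      using sum_bounded_above[of "{..<n}", OF Ediff] elim(2) by (simp add: field_simps)
    ultimately show ?case using EabsV[OF elim(2)] elim(1) by linarith
  qed
qed

text \<open>At \<open>u = t * s k / sqrt n\<close> the second order expansion and its remainder
  bound depend on \<open>u\<close> only through its absolute value, which no sign affects. All
  factors have modulus at most one, so the products differ by at most the sum of the differences of
  factors. One rate \<open>r\<close> therefore serves all sign patterns.\<close>

lemma char_sign_sum_uniform:
  fixes X :: "'a \<Rightarrow> real"
  assumes [measurable]: "X \<in> borel_measurable M" and int: "integrable M X"
    and sq: "integrable M (\<lambda>\<omega>. (X \<omega>)\<^sup>2)" and mean: "expectation X = 0" and var: "variance X = v"
  shows "\<exists>r. r \<longlonglongrightarrow> 0 \<and> (\<forall>n>0. \<forall>s. (\<forall>k<n. \<bar>s k\<bar> = 1) \<longrightarrow>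
    cmod ((\<Prod>k<n. char (distr M borel X) (t * s k / sqrt (real n))) - exp (- (t\<^sup>2 * v / 2))) \<le> r n)"
proof -
  let ?\<phi> = "char (distr M borel X)"
  have v: "0 \<le> v" using variance_positive[of X] var by simp
  define a where "a = t\<^sup>2 * v / 2"
  have a: "0 \<le> a" unfolding a_def using v by simp
  \<comment> \<open>The Taylor remainder under second moments: the minimum is dominated by a
    multiple of the square even if the third moment is infinite, while the cubic branch forces it to
    0 pointwise.\<close>
  define I where "I n = expectation (\<lambda>\<omega>. min (6 * (X \<omega>)\<^sup>2) (\<bar>t / sqrt (real n)\<bar> * \<bar>X \<omega>\<bar> ^ 3))" for n :: nat
  \<comment> \<open>\<open>n\<close> times the two errors per factor: the Taylor remainder, and
    replacing \<open>1 - a / n\<close> by its exponential, whose n-th power is the exact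
    limit.\<close>
  define r where "r n = t\<^sup>2 / 6 * I n + real n * \<bar>exp (- (a / real n)) - (1 - a / real n)\<bar>" for n :: nat
  interpret D: real_distribution "distr M borel X" by (rule real_distribution_distr) simp
  have "I \<longlonglongrightarrow> expectation (\<lambda>\<omega>. 0)"
    unfolding I_def
  proof (rule integral_dominated_convergence[where w = "\<lambda>\<omega>. 6 * (X \<omega>)\<^sup>2"])
    have "(\<lambda>n. min (6 * z\<^sup>2) (\<bar>t / sqrt (real n)\<bar> * \<bar>z\<bar> ^ 3)) \<longlonglongrightarrow> min (6 * z\<^sup>2) (\<bar>0\<bar> * \<bar>z\<bar> ^ 3)" for z :: real
    proof (intro tendsto_min tendsto_const tendsto_mult tendsto_rabs)
      show "(\<lambda>n. t / sqrt (real n)) \<longlonglongrightarrow> 0" by real_asymp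
    qed
    then show "AE \<omega> in M. (\<lambda>n. min (6 * (X \<omega>)\<^sup>2) (\<bar>t / sqrt (real n)\<bar> * \<bar>X \<omega>\<bar> ^ 3)) \<longlonglongrightarrow> 0"
      by (simp add: min_absorb2)
  qed (use sq in auto)
  then have "I \<longlonglongrightarrow> 0" by simp
  moreover have "(\<lambda>n. real n * \<bar>exp (- (a / real n)) - (1 - a / real n)\<bar>) \<longlonglongrightarrow> 0"
  proof (cases "a = 0")
    case False
    then have "0 < a" using a by simp
    then show ?thesis by real_asymp
  qed simp
  ultimately have "r \<longlonglongrightarrow> t\<^sup>2 / 6 * 0 + 0"
    unfolding r_def by (intro tendsto_intros)
  then have r: "r \<longlonglongrightarrow> 0" by simp
  have "cmod ((\<Prod>k<n. ?\<phi> (t * s k / sqrt (real n))) - exp (- (t\<^sup>2 * v / 2))) \<le> r n"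
    if n: "0 < n" and s: "\<forall>k<n. \<bar>s k\<bar> = 1" for n s
  proof -
    have "exp (- a) = exp (real n * (- (a / real n)))" using n by simp
    also have "\<dots> = exp (- (a / real n)) ^ n" by (rule exp_of_nat_mult)
    finally have "complex_of_real (exp (- a)) = (\<Prod>k<n. complex_of_real (exp (- (a / real n))))"
      by simp
    moreover have "complex_of_real (exp (- a)) = exp (- (t\<^sup>2 * v / 2))"
      unfolding a_def by simp
    ultimately have "cmod ((\<Prod>k<n. ?\<phi> (t * s k / sqrt (real n))) - exp (- (t\<^sup>2 * v / 2)))
        = cmod ((\<Prod>k<n. ?\<phi> (t * s k / sqrt (real n))) - (\<Prod>k<n. complex_of_real (exp (- (a / real n)))))"
      by simp
    also have "\<dots> \<le> (\<Sum>k<n. cmod (?\<phi> (t * s k / sqrt (real n)) - complex_of_real (exp (- (a / real n)))))"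
      using a by (intro norm_prod_diff) (auto simp: D.cmod_char_le_1)
    also have "\<dots> \<le> (\<Sum>k<n. t\<^sup>2 / (6 * real n) * I n + \<bar>exp (- (a / real n)) - (1 - a / real n)\<bar>)"
    proof (rule sum_mono)
      fix k assume "k \<in> {..<n}"
      then have sk: "\<bar>s k\<bar> = 1" using s by simp
      define u where "u = t * s k / sqrt (real n)"
      have u2: "u\<^sup>2 = t\<^sup>2 / real n"
        using sk abs_square_eq_1[of "s k"] unfolding u_def by (simp add: power_divide power_mult_distrib)
      have ua: "\<bar>u\<bar> = \<bar>t / sqrt (real n)\<bar>" using sk unfolding u_def by (simp add: abs_mult)
      have "cmod (?\<phi> u - (1 - u\<^sup>2 * v / 2)) \<le> u\<^sup>2 / 6 * expectation (\<lambda>\<omega>. min (6 * (X \<omega>)\<^sup>2) (\<bar>u\<bar> * \<bar>X \<omega>\<bar> ^ 3))"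
        by (rule char_approx3'[OF _ int sq mean var refl]) simp
      then have 1: "cmod (?\<phi> u - complex_of_real (1 - a / real n)) \<le> t\<^sup>2 / (6 * real n) * I n"
        unfolding ua u2 I_def[symmetric] by (simp add: a_def mult.commute)
      have "cmod (?\<phi> u - complex_of_real (exp (- (a / real n))))
          \<le> cmod (?\<phi> u - complex_of_real (1 - a / real n))
            + cmod (complex_of_real (1 - a / real n) - complex_of_real (exp (- (a / real n))))"
        using norm_triangle_ineq[of "?\<phi> u - complex_of_real (1 - a / real n)"
            "complex_of_real (1 - a / real n) - complex_of_real (exp (- (a / real n)))"] by (simp only: diff_add_cancel add_diff_eq)
      also have "cmod (complex_of_real (1 - a / real n) - complex_of_real (exp (- (a / real n))))
          = \<bar>exp (- (a / real n)) - (1 - a / real n)\<bar>"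
        by (simp only: of_real_diff[symmetric] norm_of_real abs_minus_commute)
      finally show "cmod (?\<phi> (t * s k / sqrt (real n)) - complex_of_real (exp (- (a / real n))))
          \<le> t\<^sup>2 / (6 * real n) * I n + \<bar>exp (- (a / real n)) - (1 - a / real n)\<bar>"
        using 1 unfolding u_def[symmetric] by linarith
    qed
    also have "\<dots> = r n" using n unfolding r_def by (simp add: field_simps)
    finally show ?thesis .
  qed
  with r show ?thesis by blast
qed

end

section \<open>Moments and sums in the design\<close>

text \<open>All covariates share one index range below \<open>d\<close>. The split into included and
  omitted ones comes in later through \<open>p\<close> and \<open>omitted\<close>, so moments and
  sums are treated uniformly.\<close>

locale covariate_adaptive_design = prob_space M + P: prob_space P
  for M :: "'a measure" and P :: "'b measure" +
  fixes d :: nat and X :: "nat \<Rightarrow> 'b \<Rightarrow> real" and VX :: "nat \<Rightarrow> real"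
    and x :: "nat \<Rightarrow> nat \<Rightarrow> 'a \<Rightarrow> real" and T \<epsilon> :: "nat \<Rightarrow> 'a \<Rightarrow> real" and \<sigma> :: real
  assumes X_indep: "P.indep_vars (\<lambda>_. borel) X {..<d}"
    and X_int: "\<And>j. j < d \<Longrightarrow> integrable P (X j)"
    and X_sq: "\<And>j. j < d \<Longrightarrow> integrable P (\<lambda>\<omega>. (X j \<omega>)\<^sup>2)"
    and X_mean: "\<And>j. j < d \<Longrightarrow> P.expectation (X j) = 0"
    and X_var: "\<And>j. P.variance (X j) = VX j"
    and VX_pos: "\<And>j. j < d \<Longrightarrow> 0 < VX j"
    and x_indep: "indep_vars (\<lambda>_. \<Pi>\<^sub>M j\<in>{..<d}. borel) (cov_vec d x) UNIV"
    and x_distr: "\<And>i. distr M (\<Pi>\<^sub>M j\<in>{..<d}. borel) (cov_vec d x i)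
      = distr P (\<Pi>\<^sub>M j\<in>{..<d}. borel) (\<lambda>\<omega>. \<lambda>j\<in>{..<d}. X j \<omega>)"
    and \<sigma>_pos: "0 < \<sigma>"
    and \<epsilon>_indep: "indep_vars (\<lambda>_. borel) \<epsilon> UNIV"
    and \<epsilon>_ident: "\<And>i. distr M borel (\<epsilon> i) = distr M borel (\<epsilon> 0)"
    and \<epsilon>_int: "\<And>i. integrable M (\<epsilon> i)"
    and \<epsilon>_sq: "\<And>i. integrable M (\<lambda>\<omega>. (\<epsilon> i \<omega>)\<^sup>2)"
    and \<epsilon>_mean: "\<And>i. expectation (\<epsilon> i) = 0"
    and \<epsilon>_var: "\<And>i. variance (\<epsilon> i) = \<sigma>\<^sup>2"
    and joint_indep: "\<And>n. indep_set
      (sets (vimage_algebra (space M)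
        (\<lambda>\<omega>. (\<lambda>i\<in>{..<n}. T i \<omega>, \<lambda>i\<in>{..<n}. cov_vec d x i \<omega>))
        ((\<Pi>\<^sub>M i\<in>{..<n}. borel) \<Otimes>\<^sub>M (\<Pi>\<^sub>M i\<in>{..<n}. \<Pi>\<^sub>M j\<in>{..<d}. borel))))
      (sets (vimage_algebra (space M) (\<lambda>\<omega>. \<lambda>i\<in>{..<n}. \<epsilon> i \<omega>) (\<Pi>\<^sub>M i\<in>{..<n}. borel)))"
    and T_meas [measurable]: "\<And>i. T i \<in> borel_measurable M"
    and T_01: "\<And>i \<omega>. \<omega> \<in> space M \<Longrightarrow> T i \<omega> \<in> {0, 1}"
    and balance: "conv_in_prob M (\<lambda>n \<omega>. (\<Sum>i<n. 2 * T i \<omega> - 1) / real n) 0"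
    and balance_covariates: "conv_in_distr_vec d M
      (\<lambda>n \<omega>. \<lambda>j\<in>{..<d}. (\<Sum>i<n. (2 * T i \<omega> - 1) * x i j \<omega>) / sqrt (real n))
      (mv_normal_law d (0\<^sub>v d) ((1 / 5) \<cdot>\<^sub>m mat_diag d VX))"
begin

abbreviation sgn_T :: "nat \<Rightarrow> 'a \<Rightarrow> real" where
  "sgn_T i \<omega> \<equiv> 2 * T i \<omega> - 1"

text \<open>Names the first sigma-algebra of \<open>joint_indep\<close>: a variable is independent
  of the errors of the block as soon as it is measurable here.\<close>

definition design_algebra :: "nat \<Rightarrow> 'a measure" where
  "design_algebra n = vimage_algebra (space M)
    (\<lambda>\<omega>. (\<lambda>i\<in>{..<n}. T i \<omega>, \<lambda>i\<in>{..<n}. cov_vec d x i \<omega>))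
    ((\<Pi>\<^sub>M i\<in>{..<n}. borel) \<Otimes>\<^sub>M (\<Pi>\<^sub>M i\<in>{..<n}. \<Pi>\<^sub>M j\<in>{..<d}. borel))"

definition error_algebra :: "nat \<Rightarrow> 'a measure" where
  "error_algebra n = vimage_algebra (space M) (\<lambda>\<omega>. \<lambda>i\<in>{..<n}. \<epsilon> i \<omega>) (\<Pi>\<^sub>M i\<in>{..<n}. borel)"

lemma space_algebras [simp]: "space (design_algebra n) = space M" "space (error_algebra n) = space M"
  by (simp_all add: design_algebra_def error_algebra_def)

lemma cov_vec_meas [measurable]: "cov_vec d x i \<in> measurable M (\<Pi>\<^sub>M j\<in>{..<d}. borel)"
  using x_indep unfolding indep_vars_def by simp

lemma \<epsilon>_meas [measurable]: "\<epsilon> i \<in> borel_measurable M"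
  using \<epsilon>_indep unfolding indep_vars_def by simp

lemma x_meas: "j < d \<Longrightarrow> x i j \<in> borel_measurable M"
  using measurable_compose[OF cov_vec_meas measurable_component_singleton[of j "{..<d}"], of i]
  by (simp add: cov_vec_def)

lemma T_design_algebra:
  assumes "i < n" shows "T i \<in> borel_measurable (design_algebra n)"
proof -
  have *: "(\<lambda>\<omega>. (\<lambda>i\<in>{..<n}. T i \<omega>, \<lambda>i\<in>{..<n}. cov_vec d x i \<omega>))
      \<in> measurable (design_algebra n) ((\<Pi>\<^sub>M i\<in>{..<n}. borel) \<Otimes>\<^sub>M (\<Pi>\<^sub>M i\<in>{..<n}. \<Pi>\<^sub>M j\<in>{..<d}. borel))"
    unfolding design_algebra_def
    by (rule measurable_vimage_algebra1) (auto simp: space_pair_measure space_PiM cov_vec_def)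
  have "(\<lambda>\<omega>. fst (\<lambda>i\<in>{..<n}. T i \<omega>, \<lambda>i\<in>{..<n}. cov_vec d x i \<omega>) i) \<in> borel_measurable (design_algebra n)"
    by (rule measurable_compose[OF measurable_compose[OF * measurable_fst] measurable_component_singleton])
      (use assms in auto)
  then show ?thesis using assms by simp
qed

lemma x_design_algebra:
  assumes "i < n" "j < d" shows "x i j \<in> borel_measurable (design_algebra n)"
proof -
  have *: "(\<lambda>\<omega>. (\<lambda>i\<in>{..<n}. T i \<omega>, \<lambda>i\<in>{..<n}. cov_vec d x i \<omega>))
      \<in> measurable (design_algebra n) ((\<Pi>\<^sub>M i\<in>{..<n}. borel) \<Otimes>\<^sub>M (\<Pi>\<^sub>M i\<in>{..<n}. \<Pi>\<^sub>M j\<in>{..<d}. borel))"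
    unfolding design_algebra_def
    by (rule measurable_vimage_algebra1) (auto simp: space_pair_measure space_PiM cov_vec_def)
  have "(\<lambda>\<omega>. snd (\<lambda>i\<in>{..<n}. T i \<omega>, \<lambda>i\<in>{..<n}. cov_vec d x i \<omega>) i j) \<in> borel_measurable (design_algebra n)"
    by (rule measurable_compose[OF measurable_compose[OF measurable_compose[OF * measurable_snd]
          measurable_component_singleton[of i]] measurable_component_singleton])
      (use assms in auto)
  then show ?thesis using assms by (simp add: cov_vec_def)
qed

lemma \<epsilon>_error_algebra:
  assumes "i < n" shows "\<epsilon> i \<in> borel_measurable (error_algebra n)"
proof -
  have *: "(\<lambda>\<omega>. \<lambda>i\<in>{..<n}. \<epsilon> i \<omega>) \<in> measurable (error_algebra n) (\<Pi>\<^sub>M i\<in>{..<n}. borel)"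
    unfolding error_algebra_def by (rule measurable_vimage_algebra1) (auto simp: space_PiM)
  have "(\<lambda>\<omega>. (\<lambda>i\<in>{..<n}. \<epsilon> i \<omega>) i) \<in> borel_measurable (error_algebra n)"
    by (rule measurable_compose[OF * measurable_component_singleton]) (use assms in auto)
  then show ?thesis using assms by simp
qed

text \<open>The sigma-algebras generated by \<open>f\<close> and \<open>g\<close> lie inside the two
  independent ones. The common value type is left open, so the lemma serves real products as well as
  complex exponentials.\<close>

lemma indep_design_error:
  assumes f: "f \<in> borel_measurable (design_algebra n)" and g: "g \<in> borel_measurable (error_algebra n)"
  shows "indep_var borel f borel g"
proof -
  have J: "indep_set (sets (design_algebra n)) (sets (error_algebra n))"
    unfolding design_algebra_def error_algebra_def by (rule joint_indep)
  have sub: "sets (design_algebra n) \<subseteq> events" "sets (error_algebra n) \<subseteq> events"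
    using indep_setD_ev1[OF J] indep_setD_ev2[OF J] .
  have pre: "sigma_sets (space M) {h -` A \<inter> space M |A. A \<in> sets borel} \<subseteq> sets N"
    if "h \<in> borel_measurable N" "space N = space M" for h :: "'a \<Rightarrow> 'c::topological_space" and N
    using that measurable_sets[OF that(1)] sets.sigma_sets_subset[of "{h -` A \<inter> space M |A. A \<in> sets borel}" N]
    by auto
  have "random_variable borel f" "random_variable borel g"
    using measurable_sets[OF f] measurable_sets[OF g] sub by (auto intro!: measurableI)
  moreover have "indep_set (sigma_sets (space M) {f -` A \<inter> space M |A. A \<in> sets borel})
      (sigma_sets (space M) {g -` A \<inter> space M |A. A \<in> sets borel})"
    using J pre[OF f space_algebras(1)] pre[OF g space_algebras(2)] unfolding indep_sets2_eq by blast
  ultimately show ?thesis unfolding indep_var_eq by simp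
qed

text \<open>Carries moments over from the model variables along \<open>x_distr\<close>. Two
  coordinates suffice, since every moment used involves at most two covariates of a unit.\<close>

lemma x_moments:
  assumes jk: "j < d" "k < d" and f [measurable]: "(\<lambda>(a, b). f a b :: real) \<in> borel_measurable (borel \<Otimes>\<^sub>M borel)"
  shows "integrable M (\<lambda>\<omega>. f (x i j \<omega>) (x i k \<omega>)) \<longleftrightarrow> integrable P (\<lambda>\<omega>. f (X j \<omega>) (X k \<omega>))"
    and "expectation (\<lambda>\<omega>. f (x i j \<omega>) (x i k \<omega>)) = P.expectation (\<lambda>\<omega>. f (X j \<omega>) (X k \<omega>))"
proof -
  let ?N = "\<Pi>\<^sub>M j\<in>{..<d}. borel :: real measure"
  let ?h = "\<lambda>v::nat \<Rightarrow> real. f (v j) (v k)"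
  have [measurable]: "(\<lambda>v. v j) \<in> borel_measurable ?N" "(\<lambda>v. v k) \<in> borel_measurable ?N"
    using jk by (auto intro!: measurable_component_singleton)
  have h [measurable]: "?h \<in> borel_measurable ?N"
    using measurable_compose[OF _ f, of "\<lambda>v. (v j, v k)" ?N] by simp
  have "X l \<in> borel_measurable P" if "l < d" for l
    using X_indep that unfolding P.indep_vars_def by simp
  then have X [measurable]: "(\<lambda>\<omega>. \<lambda>j\<in>{..<d}. X j \<omega>) \<in> measurable P ?N"
    by (intro measurable_restrict) auto
  show "integrable M (\<lambda>\<omega>. f (x i j \<omega>) (x i k \<omega>)) \<longleftrightarrow> integrable P (\<lambda>\<omega>. f (X j \<omega>) (X k \<omega>))"
    using integrable_distr_eq[OF cov_vec_meas[of i] h] integrable_distr_eq[OF X h] x_distr[of i] jk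
    by (simp add: cov_vec_def)
  show "expectation (\<lambda>\<omega>. f (x i j \<omega>) (x i k \<omega>)) = P.expectation (\<lambda>\<omega>. f (X j \<omega>) (X k \<omega>))"
    using integral_distr[OF cov_vec_meas[of i] h] integral_distr[OF X h] x_distr[of i] jk
    by (simp add: cov_vec_def)
qed

lemma X_second_moment: "j < d \<Longrightarrow> P.expectation (\<lambda>\<omega>. (X j \<omega>)\<^sup>2) = VX j"
  using X_var[of j] X_mean[of j] by simp

text \<open>Used with the identity, for the vanishing mixed moments, and with the square, for the
  second moment of a product.\<close>

lemma X_product:
  fixes h :: "real \<Rightarrow> real"
  assumes "j < d" "k < d" "j \<noteq> k" and [measurable]: "h \<in> borel_measurable borel"
    and int: "\<And>l. l < d \<Longrightarrow> integrable P (\<lambda>\<omega>. h (X l \<omega>))"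
  shows "integrable P (\<lambda>\<omega>. h (X j \<omega>) * h (X k \<omega>))"
    and "P.expectation (\<lambda>\<omega>. h (X j \<omega>) * h (X k \<omega>)) = P.expectation (\<lambda>\<omega>. h (X j \<omega>)) * P.expectation (\<lambda>\<omega>. h (X k \<omega>))"
proof -
  have I: "P.indep_vars (\<lambda>_. borel) (\<lambda>l \<omega>. h (X l \<omega>)) {j, k}"
    by (rule P.indep_vars_compose2[OF P.indep_vars_subset[OF X_indep]]) (use assms in auto)
  have int': "integrable P (\<lambda>\<omega>. h (X l \<omega>))" if "l \<in> {j, k}" for l using that int assms by auto
  show "integrable P (\<lambda>\<omega>. h (X j \<omega>) * h (X k \<omega>))"
    using P.indep_vars_integrable[OF _ I int'] assms by simp
  show "P.expectation (\<lambda>\<omega>. h (X j \<omega>) * h (X k \<omega>)) = P.expectation (\<lambda>\<omega>. h (X j \<omega>)) * P.expectation (\<lambda>\<omega>. h (X k \<omega>))"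
    using P.indep_vars_lebesgue_integral[OF _ I int'] assms by simp
qed

lemma x_mean: "j < d \<Longrightarrow> integrable M (x i j)" "j < d \<Longrightarrow> expectation (x i j) = 0"
  using x_moments[of j j "\<lambda>a b. a" i] X_int[of j] X_mean[of j] by auto

lemma x_second_moment:
  assumes "j < d" "k < d"
  shows "integrable M (\<lambda>\<omega>. x i j \<omega> * x i k \<omega>)"
    and "expectation (\<lambda>\<omega>. x i j \<omega> * x i k \<omega>) = (if j = k then VX j else 0)"
  using x_moments[of j k "\<lambda>a b. a * b" i] assms X_sq[of j] X_second_moment[of j]
    X_product[of j k "\<lambda>a. a"] X_int X_mean by (auto simp: power2_eq_square)

lemma x_sq: "j < d \<Longrightarrow> integrable M (\<lambda>\<omega>. (x i j \<omega>)\<^sup>2)"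
  using x_second_moment(1)[of j j i] by (simp add: power2_eq_square)

text \<open>By independence the mixed fourth moment is a product of two variances. For
  \<open>j = k\<close> it would be a genuine fourth moment, which may be infinite.\<close>

lemma x_sq_product:
  assumes "j < d" "k < d" "j \<noteq> k"
  shows "integrable M (\<lambda>\<omega>. (x i j \<omega> * x i k \<omega>)\<^sup>2)"
  using x_moments(1)[of j k "\<lambda>a b. a\<^sup>2 * b\<^sup>2" i] assms
    X_product(1)[of j k "\<lambda>a. a\<^sup>2"] X_sq by (simp add: power_mult_distrib)

lemma \<epsilon>_second_moment: "expectation (\<lambda>\<omega>. (\<epsilon> i \<omega>)\<^sup>2) = \<sigma>\<^sup>2"
  using \<epsilon>_var[of i] \<epsilon>_mean[of i] by simp

section \<open>Orders of magnitude of unsigned sums\<close>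

lemma cov_fun_iid:
  assumes h: "h \<in> borel_measurable (\<Pi>\<^sub>M j\<in>{..<d}. borel)"
  shows "indep_vars (\<lambda>_. borel) (\<lambda>i \<omega>. h (cov_vec d x i \<omega>) :: real) UNIV"
    and "distr M borel (\<lambda>\<omega>. h (cov_vec d x i \<omega>)) = distr M borel (\<lambda>\<omega>. h (cov_vec d x 0 \<omega>))"
proof -
  show "indep_vars (\<lambda>_. borel) (\<lambda>i \<omega>. h (cov_vec d x i \<omega>)) UNIV"
    by (rule indep_vars_compose2[OF x_indep]) (rule h)
  show "distr M borel (\<lambda>\<omega>. h (cov_vec d x i \<omega>)) = distr M borel (\<lambda>\<omega>. h (cov_vec d x 0 \<omega>))"
    using distr_distr[OF h cov_vec_meas[of i]] distr_distr[OF h cov_vec_meas[of 0]] x_distr[of i] x_distr[of 0]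
    by (simp add: comp_def)
qed

lemma iid_centered_stoch_bounded:
  fixes Z :: "nat \<Rightarrow> 'a \<Rightarrow> real"
  assumes indep: "indep_vars (\<lambda>_. borel) Z UNIV" and ident: "\<And>i. distr M borel (Z i) = distr M borel (Z 0)"
    and mean: "\<And>i. expectation (Z i) = 0" and sq: "\<And>i. integrable M (\<lambda>\<omega>. (Z i \<omega>)\<^sup>2)"
  shows "stoch_bounded (\<lambda>n \<omega>. (\<Sum>i<n. Z i \<omega>) / sqrt (real n))"
proof (rule stoch_bounded_uncorrelated_sum)
  show meas: "Z i \<in> borel_measurable M" for i using indep unfolding indep_vars_def by simp
  have int: "integrable M (Z i)" for i using square_integrable_imp_integrable[OF meas sq] .
  show "expectation (\<lambda>\<omega>. Z i \<omega> * Z j \<omega>) = 0" if "i \<noteq> j" for i j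
    using indep_vars_expectation_mult[OF indep that int] mean by simp
  show "expectation (\<lambda>\<omega>. (Z i \<omega>)\<^sup>2) \<le> expectation (\<lambda>\<omega>. (Z 0 \<omega>)\<^sup>2)" for i
    using expectation_identically_distributed(2)[OF meas meas _ ident, of "\<lambda>z. z\<^sup>2" i] by simp
qed (rule sq)

lemma cov_coordinate: "j < d \<Longrightarrow> cov_vec d x i \<omega> j = x i j \<omega>"
  by (simp add: cov_vec_def)

lemma x_sum_stoch_bounded:
  assumes j: "j < d"
  shows "stoch_bounded (\<lambda>n \<omega>. (\<Sum>i<n. x i j \<omega>) / sqrt (real n))"
proof -
  have h: "(\<lambda>v. v j) \<in> borel_measurable (\<Pi>\<^sub>M j\<in>{..<d}. borel :: real measure)"
    using j by (intro measurable_component_singleton) auto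
  show ?thesis
    using iid_centered_stoch_bounded[OF cov_fun_iid[OF h]] x_mean(2)[OF j] x_sq[OF j]
    by (simp add: cov_coordinate[OF j])
qed

lemma x_product_sum_stoch_bounded:
  assumes jk: "j < d" "k < d" "j \<noteq> k"
  shows "stoch_bounded (\<lambda>n \<omega>. (\<Sum>i<n. x i j \<omega> * x i k \<omega>) / sqrt (real n))"
proof -
  have h: "(\<lambda>v. v j * v k) \<in> borel_measurable (\<Pi>\<^sub>M j\<in>{..<d}. borel :: real measure)"
    using jk by (intro borel_measurable_times measurable_component_singleton) auto
  show ?thesis
    using iid_centered_stoch_bounded[OF cov_fun_iid[OF h]] x_second_moment(2)[of j k] x_sq_product[OF jk] jk
    by (simp add: cov_coordinate)
qed

text \<open>For \<open>j = k\<close> the summands are squares with a first moment only, the case for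
  which the law of large numbers was proved by truncation.\<close>

lemma x_product_mean_to_prob:
  assumes jk: "j < d" "k < d"
  shows "to_prob (\<lambda>n \<omega>. (\<Sum>i<n. x i j \<omega> * x i k \<omega>) / real n) (if j = k then VX j else 0)"
proof -
  have h: "(\<lambda>v. v j * v k) \<in> borel_measurable (\<Pi>\<^sub>M j\<in>{..<d}. borel :: real measure)"
    using jk by (intro borel_measurable_times measurable_component_singleton) auto
  show ?thesis
    using weak_law_of_large_numbers[OF cov_fun_iid[OF h]] x_second_moment[of j k] jk
    by (simp add: cov_coordinate)
qed

lemma \<epsilon>_sum_stoch_bounded: "stoch_bounded (\<lambda>n \<omega>. (\<Sum>i<n. \<epsilon> i \<omega>) / sqrt (real n))"
  by (rule iid_centered_stoch_bounded[OF \<epsilon>_indep \<epsilon>_ident \<epsilon>_mean \<epsilon>_sq])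

lemma \<epsilon>_sq_mean_to_prob: "to_prob (\<lambda>n \<omega>. (\<Sum>i<n. (\<epsilon> i \<omega>)\<^sup>2) / real n) (\<sigma>\<^sup>2)"
proof -
  have i: "indep_vars (\<lambda>_. borel) (\<lambda>i \<omega>. (\<epsilon> i \<omega>)\<^sup>2) UNIV"
    by (rule indep_vars_compose2[OF \<epsilon>_indep]) measurable
  have "distr M borel (\<lambda>\<omega>. (\<epsilon> i \<omega>)\<^sup>2) = distr M borel (\<lambda>\<omega>. (\<epsilon> 0 \<omega>)\<^sup>2)" for i
    using distr_distr[of "\<lambda>z::real. z\<^sup>2" borel borel "\<epsilon> i" M] distr_distr[of "\<lambda>z::real. z\<^sup>2" borel borel "\<epsilon> 0" M]
      \<epsilon>_ident[of i] by (simp add: comp_def)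
  from weak_law_of_large_numbers[OF i this \<epsilon>_sq] show ?thesis by (simp add: \<epsilon>_second_moment)
qed

text \<open>Uncorrelatedness is enough here: the covariate factor and the error factor separate by
  block independence, and errors of distinct units have zero mixed moment.\<close>

lemma x_\<epsilon>_sum_stoch_bounded:
  assumes j: "j < d"
  shows "stoch_bounded (\<lambda>n \<omega>. (\<Sum>i<n. x i j \<omega> * \<epsilon> i \<omega>) / sqrt (real n))"
proof (rule stoch_bounded_uncorrelated_sum)
  note [measurable] = x_meas[OF j]
  show "(\<lambda>\<omega>. x i j \<omega> * \<epsilon> i \<omega>) \<in> borel_measurable M" for i by measurable
  have "indep_var borel (\<lambda>\<omega>. (x i j \<omega>)\<^sup>2) borel (\<lambda>\<omega>. (\<epsilon> i \<omega>)\<^sup>2)" for i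
    by (rule indep_design_error[of _ "Suc i"])
      (use x_design_algebra[of i "Suc i" j] \<epsilon>_error_algebra[of i "Suc i"] j in auto)
  note I = this
  have eq: "(\<lambda>\<omega>. (x i j \<omega> * \<epsilon> i \<omega>)\<^sup>2) = (\<lambda>\<omega>. (x i j \<omega>)\<^sup>2 * (\<epsilon> i \<omega>)\<^sup>2)" for i
    by (simp add: power_mult_distrib)
  show "integrable M (\<lambda>\<omega>. (x i j \<omega> * \<epsilon> i \<omega>)\<^sup>2)" for i
    unfolding eq by (rule indep_var_integrable[OF I x_sq[OF j] \<epsilon>_sq])
  show "expectation (\<lambda>\<omega>. (x i j \<omega> * \<epsilon> i \<omega>)\<^sup>2) \<le> VX j * \<sigma>\<^sup>2" for i
    unfolding eq indep_var_lebesgue_integral[OF I x_sq[OF j] \<epsilon>_sq] \<epsilon>_second_moment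
    using x_second_moment(2)[OF j j, of i] by (simp flip: power2_eq_square)
  fix i k :: nat assume ik: "i \<noteq> k"
  \<comment> \<open>The smallest block that contains both units, to which joint independence
    applies.\<close>
  define n where "n = Suc (max i k)"
  have "i < n" "k < n" unfolding n_def by auto
  then have I2: "indep_var borel (\<lambda>\<omega>. x i j \<omega> * x k j \<omega>) borel (\<lambda>\<omega>. \<epsilon> i \<omega> * \<epsilon> k \<omega>)"
    by (intro indep_design_error[of _ n] borel_measurable_times x_design_algebra \<epsilon>_error_algebra j)
  have "expectation (\<lambda>\<omega>. (x i j \<omega> * \<epsilon> i \<omega>) * (x k j \<omega> * \<epsilon> k \<omega>))
      = expectation (\<lambda>\<omega>. (x i j \<omega> * x k j \<omega>) * (\<epsilon> i \<omega> * \<epsilon> k \<omega>))"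
    by (simp add: mult_ac)
  also have "\<dots> = expectation (\<lambda>\<omega>. x i j \<omega> * x k j \<omega>) * expectation (\<lambda>\<omega>. \<epsilon> i \<omega> * \<epsilon> k \<omega>)"
    by (rule indep_var_lebesgue_integral[OF I2]) (intro integrable_mult_of_squares x_sq \<epsilon>_sq j; measurable)+
  also have "expectation (\<lambda>\<omega>. \<epsilon> i \<omega> * \<epsilon> k \<omega>) = 0"
    using indep_vars_expectation_mult[OF \<epsilon>_indep ik \<epsilon>_int] \<epsilon>_mean by simp
  finally show "expectation (\<lambda>\<omega>. (x i j \<omega> * \<epsilon> i \<omega>) * (x k j \<omega> * \<epsilon> k \<omega>)) = 0" by simp
qed

end

section \<open>Limit law of signed sums\<close>

context covariate_adaptive_design
begin

text \<open>
  Given the covariates and the assignments, the signed error sum is a sum of independent variables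
  \<open>\<plusminus>\<epsilon>\<^sub>i\<close>, and the limit of its characteristic function does not depend on the signs.  Since
  there are finitely many sign patterns for each \<open>n\<close>, conditioning is a finite case distinction.
\<close>

lemma char_add_signed_error_sum:
  assumes A: "\<And>n. A n \<in> borel_measurable (design_algebra n)"
    and lim: "(\<lambda>n. expectation (\<lambda>\<omega>. iexp (t * A n \<omega>))) \<longlonglongrightarrow> a"
  shows "(\<lambda>n. expectation (\<lambda>\<omega>. iexp (t * (A n \<omega> + (\<Sum>i<n. sgn_T i \<omega> * \<epsilon> i \<omega>) / sqrt (real n)))))
    \<longlonglongrightarrow> exp (- (t\<^sup>2 * \<sigma>\<^sup>2 / 2)) * a"
proof -
  let ?\<phi> = "char (distr M borel (\<epsilon> 0))"
  let ?E = "complex_of_real (exp (- (t\<^sup>2 * \<sigma>\<^sup>2 / 2)))"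
  let ?full = "\<lambda>n \<omega>. iexp (t * (A n \<omega> + (\<Sum>i<n. sgn_T i \<omega> * \<epsilon> i \<omega>) / sqrt (real n)))"
  obtain r where r: "r \<longlonglongrightarrow> 0" and r_bound: "\<And>n s. 0 < n \<Longrightarrow> \<forall>k<n. \<bar>s k\<bar> = 1 \<Longrightarrow>
      cmod ((\<Prod>k<n. ?\<phi> (t * s k / sqrt (real n))) - ?E) \<le> r n"
    using char_sign_sum_uniform[OF \<epsilon>_meas \<epsilon>_int \<epsilon>_sq \<epsilon>_mean \<epsilon>_var, of 0 t] by auto
  have sub: "sets (design_algebra n) \<subseteq> events" "sets (error_algebra n) \<subseteq> events" for n
    using indep_setD_ev1[OF joint_indep[of n]] indep_setD_ev2[OF joint_indep[of n]]
    unfolding design_algebra_def error_algebra_def .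
  have lift: "f \<in> borel_measurable M" if "f \<in> borel_measurable (design_algebra n) \<or> f \<in> borel_measurable (error_algebra n)"
    for f :: "'a \<Rightarrow> complex" and n
  proof (rule measurableI)
    fix B :: "complex set" assume "B \<in> sets borel"
    then show "f -` B \<inter> space M \<in> events"
      using that measurable_sets[of f "design_algebra n" borel B] measurable_sets[of f "error_algebra n" borel B] sub[of n]
      by auto
  qed simp
  have bound: "cmod (expectation (?full n) - ?E * expectation (\<lambda>\<omega>. iexp (t * A n \<omega>))) \<le> r n" if n: "0 < n" for n
  proof -
    \<comment> \<open>Extensional functions, so that each sign pattern on the first \<open>n\<close>
      units is represented exactly once.\<close>
    define F where "F = PiE {..<n} (\<lambda>_. {- 1, 1 :: real})"
    have F: "finite F" unfolding F_def by (intro finite_PiE) auto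
    define D where "D \<tau> = {\<omega> \<in> space M. \<forall>i\<in>{..<n}. sgn_T i \<omega> = \<tau> i}" for \<tau> :: "nat \<Rightarrow> real"
    define g where "g \<tau> \<omega> = indicator (D \<tau>) \<omega> * iexp (t * A n \<omega>)" for \<tau> \<omega>
    \<comment> \<open>The signs are frozen at the pattern \<open>\<tau>\<close>: this factor depends
      on the errors only, while \<open>g\<close> collects everything known from the design.\<close>
    define e where "e \<tau> \<omega> = (\<Prod>k<n. iexp (t * \<tau> k / sqrt (real n) * \<epsilon> k \<omega>))" for \<tau> \<omega>
    have D: "D \<tau> \<in> sets (design_algebra n)" for \<tau>
    proof -
      have "{\<omega> \<in> space (design_algebra n). \<forall>i\<in>{..<n}. sgn_T i \<omega> = \<tau> i} \<in> sets (design_algebra n)"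
        by (intro sets.sets_Collect_finite_All borel_measurable_eq borel_measurable_diff borel_measurable_times
            borel_measurable_const T_design_algebra) auto
      then show ?thesis unfolding D_def by simp
    qed
    have iexp_meas: "(\<lambda>\<omega>. iexp (c * f \<omega>)) \<in> borel_measurable N"
      if [measurable]: "f \<in> borel_measurable N" for c and f :: "'a \<Rightarrow> real" and N by measurable
    have g_meas: "g \<tau> \<in> borel_measurable (design_algebra n)" for \<tau>
      unfolding g_def by (intro borel_measurable_times borel_measurable_indicator D iexp_meas A)
    have e_meas: "e \<tau> \<in> borel_measurable (error_algebra n)" for \<tau>
      unfolding e_def by (intro borel_measurable_prod iexp_meas \<epsilon>_error_algebra) auto
    have g_norm: "cmod (g \<tau> \<omega>) = indicator (D \<tau>) \<omega>" for \<tau> \<omega>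
      unfolding g_def by (simp add: norm_mult indicator_def)
    have e_norm: "cmod (e \<tau> \<omega>) = 1" for \<tau> \<omega>
      unfolding e_def by (simp add: prod_norm[symmetric])
    have g_int: "integrable M (g \<tau>)" for \<tau>
      by (rule integrable_const_bound[where B = 1]) (use lift[OF disjI1[OF g_meas]] in \<open>simp_all add: g_norm indicator_def\<close>)
    have e_int: "integrable M (e \<tau>)" for \<tau>
      by (rule integrable_const_bound[where B = 1]) (use lift[OF disjI2[OF e_meas]] in \<open>simp_all add: e_norm\<close>)
    have e_exp: "expectation (e \<tau>) = (\<Prod>k<n. ?\<phi> (t * \<tau> k / sqrt (real n)))" for \<tau>
    proof -
      have I: "indep_vars (\<lambda>_. borel) (\<lambda>k \<omega>. iexp (t * \<tau> k / sqrt (real n) * \<epsilon> k \<omega>)) {..<n}"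
        by (rule indep_vars_compose2[OF indep_vars_subset[OF \<epsilon>_indep]]) auto
      have "expectation (e \<tau>) = (\<Prod>k<n. expectation (\<lambda>\<omega>. iexp (t * \<tau> k / sqrt (real n) * \<epsilon> k \<omega>)))"
        unfolding e_def
        by (rule indep_vars_lebesgue_integral[OF _ I]) (auto intro!: integrable_const_bound[where B = 1])
      moreover have "expectation (\<lambda>\<omega>. iexp (c * \<epsilon> k \<omega>)) = ?\<phi> c" for c k
      proof -
        have "expectation (\<lambda>\<omega>. iexp (c * \<epsilon> k \<omega>)) = char (distr M borel (\<epsilon> k)) c"
          unfolding char_def by (subst integral_distr) auto
        then show ?thesis using \<epsilon>_ident[of k] by simp
      qed
      ultimately show ?thesis by (simp only:)
    qed
    \<comment> \<open>The events \<open>D\<close> partition the space, so exactly one summand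
      survives, the one at the realized signs.\<close>
    have F_single: "(\<Sum>\<tau>\<in>F. indicator (D \<tau>) \<omega> * f \<tau>) = f (\<lambda>i\<in>{..<n}. sgn_T i \<omega>)"
      if w: "\<omega> \<in> space M" for \<omega> and f :: "(nat \<Rightarrow> real) \<Rightarrow> complex"
    proof -
      let ?\<tau>0 = "\<lambda>i\<in>{..<n}. sgn_T i \<omega>"
      have mem: "?\<tau>0 \<in> F" unfolding F_def using T_01[OF w] by (intro restrict_PiE_iff[THEN iffD2]) force
      have "indicator (D \<tau>) \<omega> * f \<tau> = (if \<tau> = ?\<tau>0 then f ?\<tau>0 else 0)" if "\<tau> \<in> F" for \<tau>
      proof -
        have "\<omega> \<in> D \<tau> \<longleftrightarrow> \<tau> = ?\<tau>0"
        proof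
          assume "\<omega> \<in> D \<tau>"
          then show "\<tau> = ?\<tau>0"
            using that unfolding D_def F_def by (intro ext) (auto simp: PiE_def extensional_def)
        next
          assume "\<tau> = ?\<tau>0"
          then show "\<omega> \<in> D \<tau>" unfolding D_def using w by simp
        qed
        then show ?thesis by (auto simp: indicator_def)
      qed
      then have "(\<Sum>\<tau>\<in>F. indicator (D \<tau>) \<omega> * f \<tau>) = (\<Sum>\<tau>\<in>F. if \<tau> = ?\<tau>0 then f ?\<tau>0 else 0)"
        by (intro sum.cong) auto
      also have "\<dots> = f ?\<tau>0" using F mem by simp
      finally show ?thesis .
    qed
    have full: "?full n \<omega> = (\<Sum>\<tau>\<in>F. g \<tau> \<omega> * e \<tau> \<omega>)" if w: "\<omega> \<in> space M" for \<omega>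
    proof -
      have "(\<Sum>\<tau>\<in>F. g \<tau> \<omega> * e \<tau> \<omega>) = (\<Sum>\<tau>\<in>F. indicator (D \<tau>) \<omega> * (iexp (t * A n \<omega>) * e \<tau> \<omega>))"
        unfolding g_def by (simp add: mult.assoc)
      also have "\<dots> = iexp (t * A n \<omega>) * e (\<lambda>i\<in>{..<n}. sgn_T i \<omega>) \<omega>"
        by (rule F_single[OF w])
      also have "e (\<lambda>i\<in>{..<n}. sgn_T i \<omega>) \<omega> = iexp (\<Sum>k<n. t * sgn_T k \<omega> / sqrt (real n) * \<epsilon> k \<omega>)"
        unfolding e_def of_real_sum sum_distrib_left exp_sum[OF finite_lessThan] by (intro prod.cong) auto
      also have "(\<Sum>k<n. t * sgn_T k \<omega> / sqrt (real n) * \<epsilon> k \<omega>) = t * ((\<Sum>i<n. sgn_T i \<omega> * \<epsilon> i \<omega>) / sqrt (real n))"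
        by (simp add: sum_distrib_left sum_divide_distrib mult_ac)
      also have "iexp (t * A n \<omega>) * iexp (t * ((\<Sum>i<n. sgn_T i \<omega> * \<epsilon> i \<omega>) / sqrt (real n))) = ?full n \<omega>"
        unfolding exp_add[symmetric] distrib_left[symmetric] of_real_add[symmetric] by (rule refl)
      finally show ?thesis by (rule sym)
    qed
    have base: "iexp (t * A n \<omega>) = (\<Sum>\<tau>\<in>F. g \<tau> \<omega>)" if "\<omega> \<in> space M" for \<omega>
      unfolding g_def by (rule F_single[OF that, symmetric])
    have prob_sum: "(\<Sum>\<tau>\<in>F. prob (D \<tau>)) = 1"
    proof -
      have De: "D \<tau> \<in> events" for \<tau> using D sub by auto
      have ind_int: "complex_integrable M (indicator (D \<tau>))" for \<tau>
      proof (rule integrable_const_bound[where B = 1])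
        show "AE \<omega> in M. cmod (indicator (D \<tau>) \<omega>) \<le> 1" by (simp add: indicator_def)
        show "indicator (D \<tau>) \<in> borel_measurable M" using De by simp
      qed
      have "complex_of_real (\<Sum>\<tau>\<in>F. prob (D \<tau>)) = (\<Sum>\<tau>\<in>F. expectation (\<lambda>\<omega>. complex_of_real (indicator (D \<tau>) \<omega>)))"
        using De by (simp add: emeasure_eq_measure)
      also have "\<dots> = expectation (\<lambda>\<omega>. \<Sum>\<tau>\<in>F. indicator (D \<tau>) \<omega> * 1)"
        using ind_int by (subst Bochner_Integration.integral_sum) (auto simp: of_real_indicator)
      also have "\<dots> = expectation (\<lambda>\<omega>. 1)"
        by (intro Bochner_Integration.integral_cong refl F_single)
      finally have "complex_of_real (\<Sum>\<tau>\<in>F. prob (D \<tau>)) = 1" by (simp add: prob_space)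
      then show ?thesis by (simp only: of_real_eq_1_iff)
    qed
    have "expectation (?full n) = expectation (\<lambda>\<omega>. \<Sum>\<tau>\<in>F. g \<tau> \<omega> * e \<tau> \<omega>)"
      by (intro Bochner_Integration.integral_cong refl full)
    also have "\<dots> = (\<Sum>\<tau>\<in>F. expectation (\<lambda>\<omega>. g \<tau> \<omega> * e \<tau> \<omega>))"
      by (intro Bochner_Integration.integral_sum indep_var_integrable[OF indep_design_error[OF g_meas e_meas]] g_int e_int)
    also have "\<dots> = (\<Sum>\<tau>\<in>F. expectation (g \<tau>) * (\<Prod>k<n. ?\<phi> (t * \<tau> k / sqrt (real n))))"
      by (intro sum.cong refl)
        (simp only: indep_var_lebesgue_integral[OF indep_design_error[OF g_meas e_meas] g_int e_int] e_exp)
    finally have 1: "expectation (?full n) = (\<Sum>\<tau>\<in>F. expectation (g \<tau>) * (\<Prod>k<n. ?\<phi> (t * \<tau> k / sqrt (real n))))" .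
    have "expectation (\<lambda>\<omega>. iexp (t * A n \<omega>)) = expectation (\<lambda>\<omega>. \<Sum>\<tau>\<in>F. g \<tau> \<omega>)"
      by (intro Bochner_Integration.integral_cong refl base)
    also have "\<dots> = (\<Sum>\<tau>\<in>F. expectation (g \<tau>))"
      by (intro Bochner_Integration.integral_sum g_int)
    finally have 2: "expectation (\<lambda>\<omega>. iexp (t * A n \<omega>)) = (\<Sum>\<tau>\<in>F. expectation (g \<tau>))" .
    have "expectation (?full n) - ?E * expectation (\<lambda>\<omega>. iexp (t * A n \<omega>))
        = (\<Sum>\<tau>\<in>F. expectation (g \<tau>) * ((\<Prod>k<n. ?\<phi> (t * \<tau> k / sqrt (real n))) - ?E))"
      unfolding 1 2 by (simp add: sum_distrib_left sum_distrib_right sum_subtractf right_diff_distrib mult.commute)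
    \<comment> \<open>A mixture over the patterns: each weight has modulus at most the probability
      of its pattern, and these sum to 1, so the exponential number of patterns does no
      harm.\<close>
    also have "cmod \<dots> \<le> (\<Sum>\<tau>\<in>F. prob (D \<tau>) * r n)"
    proof (rule sum_norm_le)
      fix \<tau> assume "\<tau> \<in> F"
      then have "\<forall>k<n. \<bar>\<tau> k\<bar> = 1" unfolding F_def by (force simp: PiE_def Pi_def)
      then have 3: "cmod ((\<Prod>k<n. ?\<phi> (t * \<tau> k / sqrt (real n))) - ?E) \<le> r n" by (rule r_bound[OF n])
      have "cmod (expectation (g \<tau>)) \<le> expectation (\<lambda>\<omega>. cmod (g \<tau> \<omega>))" by (rule integral_norm_bound)
      also have "\<dots> = prob (D \<tau>)"
      proof -
        have "D \<tau> \<in> events" using D sub by auto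
        then show ?thesis unfolding g_norm by simp
      qed
      finally show "cmod (expectation (g \<tau>) * ((\<Prod>k<n. ?\<phi> (t * \<tau> k / sqrt (real n))) - ?E)) \<le> prob (D \<tau>) * r n"
        unfolding norm_mult using 3 by (intro mult_mono) auto
    qed
    also have "\<dots> = r n" unfolding sum_distrib_right[symmetric] prob_sum by simp
    finally show ?thesis .
  qed
  have "(\<lambda>n. expectation (?full n) - ?E * expectation (\<lambda>\<omega>. iexp (t * A n \<omega>))) \<longlonglongrightarrow> 0"
    by (rule Lim_null_comparison[OF eventually_mono[OF eventually_gt_at_top[of 0] bound] r])
  from tendsto_add[OF this tendsto_mult_left[OF lim, of ?E]] show ?thesis by simp
qed

text \<open>The coefficients stay arbitrary: besides those of the omitted covariates, a unit vector
  and the zero vector are used later to isolate a single covariate sum.\<close>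

definition signed_sum :: "(nat \<Rightarrow> real) \<Rightarrow> nat \<Rightarrow> 'a \<Rightarrow> real" where
  "signed_sum c n \<omega> = (\<Sum>j<d. c j * ((\<Sum>i<n. sgn_T i \<omega> * x i j \<omega>) / sqrt (real n)))
    + (\<Sum>i<n. sgn_T i \<omega> * \<epsilon> i \<omega>) / sqrt (real n)"

lemma signed_sum_meas [measurable]: "signed_sum c n \<in> borel_measurable M"
  unfolding signed_sum_def
  by (intro borel_measurable_add borel_measurable_sum borel_measurable_times borel_measurable_divide
      borel_measurable_const borel_measurable_diff T_meas \<epsilon>_meas x_meas) auto

text \<open>The easy half of the Cramer-Wold device: the exponential of a linear form is a bounded
  continuous test function of the vector.\<close>

lemma char_signed_covariate_sum:
  "(\<lambda>n. expectation (\<lambda>\<omega>. iexp (t * (\<Sum>j<d. c j * ((\<Sum>i<n. sgn_T i \<omega> * x i j \<omega>) / sqrt (real n))))))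
    \<longlonglongrightarrow> complex_of_real (exp (- (t\<^sup>2 * ((\<Sum>j<d. (c j)\<^sup>2 * VX j) / 5) / 2)))"
proof -
  let ?Z = "\<lambda>n \<omega>. \<lambda>j\<in>{..<d}. (\<Sum>i<n. sgn_T i \<omega> * x i j \<omega>) / sqrt (real n)"
  let ?B = "\<Pi>\<^sub>M j\<in>{..<d}. borel :: real measure"
  define N where "N = mv_normal_law d (0\<^sub>v d) ((1 / 5) \<cdot>\<^sub>m mat_diag d VX)"
  define L where "L y = (\<Sum>j<d. t * c j * y j)" for y :: "nat \<Rightarrow> real"
  have diag: "(1 / 5) \<cdot>\<^sub>m mat_diag d VX = mat_diag d (\<lambda>j. VX j / 5)"
    by (intro eq_matI) (auto simp: mat_diag_def)
  have intN: "integrable N (\<lambda>y. iexp (L y))"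
    and valN: "(CLINT y|N. iexp (L y)) = exp (- (\<Sum>j<d. (t * c j)\<^sup>2 * (VX j / 5)) / 2)"
    unfolding N_def diag L_def using integral_mv_normal_law_iexp[of d "\<lambda>j. VX j / 5" "\<lambda>j. t * c j"] VX_pos by auto
  have Z [measurable]: "?Z n \<in> measurable M ?B" for n
    by (intro measurable_restrict borel_measurable_sum borel_measurable_times borel_measurable_divide
      borel_measurable_const borel_measurable_diff T_meas x_meas) auto
  have L_meas [measurable]: "L \<in> borel_measurable ?B"
    unfolding L_def by (intro borel_measurable_sum borel_measurable_times borel_measurable_const measurable_component_singleton)
  have L_cont: "continuous_on ({..<d} \<rightarrow>\<^sub>E UNIV) L"
    unfolding L_def
    by (intro continuous_on_sum continuous_on_mult continuous_on_const
        continuous_on_subset[OF continuous_on_product_coordinates]) auto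
  \<comment> \<open>Vector convergence is tested on real functions only, so cosine and sine are
    treated separately and recombined in \<open>main\<close>.\<close>
  have lim: "(\<lambda>n. expectation (\<lambda>\<omega>. f (L (?Z n \<omega>)))) \<longlonglongrightarrow> integral\<^sup>L N (\<lambda>y. f (L y))"
    if f: "continuous_on UNIV f" "\<And>z. \<bar>f z\<bar> \<le> 1" for f :: "real \<Rightarrow> real"
  proof -
    have [measurable]: "f \<in> borel_measurable borel" using f(1) by (rule borel_measurable_continuous_onI)
    have "continuous_on ({..<d} \<rightarrow>\<^sub>E UNIV) (\<lambda>y. f (L y))"
      by (rule continuous_on_compose2[OF f(1) L_cont]) simp
    moreover have "bounded ((\<lambda>y. f (L y)) ` ({..<d} \<rightarrow>\<^sub>E UNIV))"
      by (rule boundedI[of _ 1]) (use f(2) in auto)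
    ultimately have "(\<lambda>n. integral\<^sup>L (distr M ?B (?Z n)) (\<lambda>y. f (L y))) \<longlonglongrightarrow> integral\<^sup>L N (\<lambda>y. f (L y))"
      using balance_covariates unfolding conv_in_distr_vec_def N_def by blast
    moreover have "integral\<^sup>L (distr M ?B (?Z n)) (\<lambda>y. f (L y)) = expectation (\<lambda>\<omega>. f (L (?Z n \<omega>)))" for n
      by (rule integral_distr[OF Z]) measurable
    ultimately show ?thesis by simp
  qed
  have int: "integrable M (\<lambda>\<omega>. iexp (L (?Z n \<omega>)))" for n
    by (rule integrable_const_bound[where B = 1]) auto
  have main: "(\<lambda>n. expectation (\<lambda>\<omega>. iexp (L (?Z n \<omega>)))) \<longlonglongrightarrow> (CLINT y|N. iexp (L y))"
    unfolding tendsto_complex_iff integral_Re[OF int, symmetric] integral_Im[OF int, symmetric]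
      integral_Re[OF intN, symmetric] integral_Im[OF intN, symmetric]
    using lim[of cos] lim[of sin] by (simp add: continuous_on_cos continuous_on_sin Re_exp Im_exp)
  have L_Z: "L (?Z n \<omega>) = t * (\<Sum>j<d. c j * ((\<Sum>i<n. sgn_T i \<omega> * x i j \<omega>) / sqrt (real n)))" for n \<omega>
    unfolding L_def sum_distrib_left by (intro sum.cong) auto
  have var: "- (\<Sum>j<d. (t * c j)\<^sup>2 * (VX j / 5)) / 2 = - (t\<^sup>2 * ((\<Sum>j<d. (c j)\<^sup>2 * VX j) / 5) / 2)"
    by (simp add: sum_distrib_left sum_divide_distrib power_mult_distrib mult_ac)
  show ?thesis using main unfolding valN L_Z var .
qed

text \<open>The limiting variance before studentization: errors count in full, while balance leaves
  one fifth of the covariate variance.\<close>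

definition signed_var :: "(nat \<Rightarrow> real) \<Rightarrow> real" where
  "signed_var c = \<sigma>\<^sup>2 + (\<Sum>j<d. (c j)\<^sup>2 * VX j) / 5"

lemma signed_var_pos: "0 < signed_var c"
  unfolding signed_var_def using \<sigma>_pos VX_pos
  by (intro add_pos_nonneg divide_nonneg_nonneg sum_nonneg mult_nonneg_nonneg) (auto simp: less_imp_le)

text \<open>The covariate part is determined by the design and plays the role of \<open>A\<close> in
  \<open>char_add_signed_error_sum\<close>; the product of the exponentials adds the
  variances.\<close>

lemma char_signed_sum:
  "(\<lambda>n. char (distr M borel (signed_sum c n)) t) \<longlonglongrightarrow> complex_of_real (exp (- (t\<^sup>2 * signed_var c / 2)))"
proof -
  have meas: "(\<lambda>\<omega>. \<Sum>j<d. c j * ((\<Sum>i<n. sgn_T i \<omega> * x i j \<omega>) / sqrt (real n))) \<in> borel_measurable (design_algebra n)" for n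
    by (intro borel_measurable_sum borel_measurable_times borel_measurable_divide
      borel_measurable_const borel_measurable_diff T_design_algebra x_design_algebra) auto
  have "char (distr M borel (signed_sum c n)) t = expectation (\<lambda>\<omega>. iexp (t * signed_sum c n \<omega>))" for n
    unfolding char_def by (subst integral_distr) auto
  moreover have "exp (- (t\<^sup>2 * \<sigma>\<^sup>2 / 2)) * exp (- (t\<^sup>2 * ((\<Sum>j<d. (c j)\<^sup>2 * VX j) / 5) / 2)) = exp (- (t\<^sup>2 * signed_var c / 2))"
    unfolding exp_add[symmetric] signed_var_def by (simp add: algebra_simps add_divide_distrib)
  ultimately show ?thesis
    using char_add_signed_error_sum[OF meas char_signed_covariate_sum[of t c]]
    unfolding signed_sum_def of_real_mult[symmetric] by simp
qed

text \<open>Tightness is read off from the limit law, as the dependence of signs and covariates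
  leaves no moment bound at hand.\<close>

lemma signed_sum_stoch_bounded: "stoch_bounded (signed_sum c)"
proof (rule weak_conv_stoch_bounded)
  show "conv_in_distr M (signed_sum c) (normal_law 0 (signed_var c))"
    using char_signed_sum[of c]
    by (intro levy_continuity real_distribution_distr real_distribution_normal_law signed_var_pos signed_sum_meas)
      (simp add: char_normal_law[OF signed_var_pos])
qed (auto simp: real_distribution_normal_law[OF signed_var_pos] normal_law_atomless)

text \<open>In the difference of two signed sums, with the unit vector and the zero vector as
  coefficients, the error parts cancel. This avoids computing marginals of the vector limit.\<close>

lemma signed_covariate_sum_stoch_bounded:
  assumes j: "j < d"
  shows "stoch_bounded (\<lambda>n \<omega>. (\<Sum>i<n. sgn_T i \<omega> * x i j \<omega>) / sqrt (real n))"
proof -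
  have "signed_sum (\<lambda>k. if k = j then 1 else 0) n \<omega> - signed_sum (\<lambda>_. 0) n \<omega>
      = (\<Sum>i<n. sgn_T i \<omega> * x i j \<omega>) / sqrt (real n)" for n \<omega>
  proof -
    have "(\<Sum>k<d. (if k = j then 1 else 0) * ((\<Sum>i<n. sgn_T i \<omega> * x i k \<omega>) / sqrt (real n)))
        = (\<Sum>k<d. if k = j then (\<Sum>i<n. sgn_T i \<omega> * x i k \<omega>) / sqrt (real n) else 0)"
      by (intro sum.cong) auto
    then show ?thesis unfolding signed_sum_def using j by simp
  qed
  then show ?thesis
    using stoch_bounded_diff[OF signed_sum_stoch_bounded[of "\<lambda>k. if k = j then 1 else 0"]
        signed_sum_stoch_bounded[of "\<lambda>_. 0"]] by simp
qed

end

section \<open>Gram matrix and scores\<close>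

context covariate_adaptive_design
begin

lemma div_real_to_prob_zero:
  assumes "stoch_bounded (\<lambda>n \<omega>. Y n \<omega> / sqrt (real n))"
  shows "to_prob (\<lambda>n \<omega>. Y n \<omega> / real n) 0"
proof -
  have "Y n \<omega> / sqrt (real n) / sqrt (real n) = Y n \<omega> / real n" for n \<omega>
    by (simp add: divide_divide_eq_left)
  then show ?thesis using stoch_bounded_div_sqrt[OF assms] by (simp only:)
qed

lemma sgn_T_mean_to_prob: "to_prob (\<lambda>n \<omega>. (\<Sum>i<n. sgn_T i \<omega>) / real n) 0"
  using conv_in_prob_to_prob[OF balance] by simp

text \<open>Since \<open>T i = (1 + sgn_T i) / 2\<close>, sums over an arm reduce to the unsigned
  and the signed sum, whose orders are known.\<close>

lemma treated_sum_eq: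
  fixes y :: "nat \<Rightarrow> 'a \<Rightarrow> real"
  shows "(\<Sum>i<n. T i \<omega> * y i \<omega>) = ((\<Sum>i<n. y i \<omega>) + (\<Sum>i<n. sgn_T i \<omega> * y i \<omega>)) / 2"
    and "(\<Sum>i<n. (1 - T i \<omega>) * y i \<omega>) = ((\<Sum>i<n. y i \<omega>) - (\<Sum>i<n. sgn_T i \<omega> * y i \<omega>)) / 2"
proof -
  have "(\<Sum>i<n. sgn_T i \<omega> * y i \<omega>) = 2 * (\<Sum>i<n. T i \<omega> * y i \<omega>) - (\<Sum>i<n. y i \<omega>)"
    "(\<Sum>i<n. (1 - T i \<omega>) * y i \<omega>) = (\<Sum>i<n. y i \<omega>) - (\<Sum>i<n. T i \<omega> * y i \<omega>)"
    by (simp_all add: left_diff_distrib sum_subtractf sum_distrib_left mult.assoc)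
  then show "(\<Sum>i<n. T i \<omega> * y i \<omega>) = ((\<Sum>i<n. y i \<omega>) + (\<Sum>i<n. sgn_T i \<omega> * y i \<omega>)) / 2"
    "(\<Sum>i<n. (1 - T i \<omega>) * y i \<omega>) = ((\<Sum>i<n. y i \<omega>) - (\<Sum>i<n. sgn_T i \<omega> * y i \<omega>)) / 2" by simp_all
qed

abbreviation col :: "nat \<Rightarrow> nat \<Rightarrow> 'a \<Rightarrow> real" where
  "col k i \<omega> \<equiv> design_col (\<lambda>i. T i \<omega>) (\<lambda>i j. x i j \<omega>) k i"

abbreviation gram_at :: "nat \<Rightarrow> nat \<Rightarrow> 'a \<Rightarrow> real mat" where
  "gram_at p n \<omega> \<equiv> gram p (\<lambda>i. T i \<omega>) (\<lambda>i j. x i j \<omega>) n"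

text \<open>The diagonal of the limit of G^t G / n: balance gives each arm half of the units, and
  off the diagonal everything vanishes.\<close>

definition gram_limit :: "nat \<Rightarrow> real" where
  "gram_limit k = (if k < 2 then 1 / 2 else VX (k - 2))"

lemma gram_limit_nonzero: "p \<le> d \<Longrightarrow> k < p + 2 \<Longrightarrow> gram_limit k \<noteq> 0"
  using less_imp_neq[OF VX_pos[of "k - 2"]] unfolding gram_limit_def by (cases "k < 2") auto

text \<open>The two arms have disjoint supports, each holds a fraction tending to one half, and
  against a covariate column both the unsigned and the signed sum are O(sqrt n).\<close>

lemma treated_column_mean_to_prob:
  assumes "k < d + 2"
  shows "to_prob (\<lambda>n \<omega>. (\<Sum>i<n. T i \<omega> * col k i \<omega>) / real n) (if k = 0 then 1 / 2 else 0)"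
    and "to_prob (\<lambda>n \<omega>. (\<Sum>i<n. (1 - T i \<omega>) * col k i \<omega>) / real n) (if k = 1 then 1 / 2 else 0)"
proof -
  \<comment> \<open>\<open>T\<close> is 0/1-valued on the space of \<open>M\<close> only, hence the
    congruences restricted to that space.\<close>
  have sq: "T i \<omega> * T i \<omega> = T i \<omega>" if "\<omega> \<in> space M" for i \<omega> using T_01[OF that, of i] by auto
  have half: "to_prob (\<lambda>n \<omega>. (1 + (\<Sum>i<n. sgn_T i \<omega>) / real n) / 2) (1 / 2)"
    "to_prob (\<lambda>n \<omega>. (1 - (\<Sum>i<n. sgn_T i \<omega>) / real n) / 2) (1 / 2)"
    using to_prob_divide[OF to_prob_add[OF to_prob_const[of 1] sgn_T_mean_to_prob] to_prob_const[of 2]]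
      to_prob_divide[OF to_prob_diff[OF to_prob_const[of 1] sgn_T_mean_to_prob] to_prob_const[of 2]] by simp_all
  \<comment> \<open>Positive \<open>n\<close> is required: at 0 the left sides are 0 and the right
    sides 1/2.\<close>
  have ev: "\<forall>\<^sub>F n in sequentially. \<forall>\<omega>\<in>space M. (\<Sum>i<n. T i \<omega>) / real n = (1 + (\<Sum>i<n. sgn_T i \<omega>) / real n) / 2"
    "\<forall>\<^sub>F n in sequentially. \<forall>\<omega>\<in>space M. (\<Sum>i<n. 1 - T i \<omega>) / real n = (1 - (\<Sum>i<n. sgn_T i \<omega>) / real n) / 2"
    by (rule eventually_mono[OF eventually_gt_at_top[of 0]],
        simp add: sum_subtractf sum_distrib_left[symmetric] field_simps)+
  consider "k = 0" | "k = 1" | l where "k = l + 2" "l < d"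
    using assms by (metis add_2_eq_Suc' add_less_cancel_right not0_implies_Suc One_nat_def)
  then have "to_prob (\<lambda>n \<omega>. (\<Sum>i<n. T i \<omega> * col k i \<omega>) / real n) (if k = 0 then 1 / 2 else 0) \<and>
      to_prob (\<lambda>n \<omega>. (\<Sum>i<n. (1 - T i \<omega>) * col k i \<omega>) / real n) (if k = 1 then 1 / 2 else 0)"
  proof cases
    case 1
    have "to_prob (\<lambda>n \<omega>. (\<Sum>i<n. T i \<omega> * col k i \<omega>) / real n) (1 / 2)"
      by (rule to_prob_cong[OF half(1)], rule eventually_mono[OF ev(1)]) (simp add: 1 design_col_def sq)
    moreover have "to_prob (\<lambda>n \<omega>. (\<Sum>i<n. (1 - T i \<omega>) * col k i \<omega>) / real n) 0"
      by (rule to_prob_cong[OF to_prob_const[of 0]]) (simp add: 1 design_col_def sq algebra_simps)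
    ultimately show ?thesis using 1 by simp
  next
    case 2
    have "to_prob (\<lambda>n \<omega>. (\<Sum>i<n. (1 - T i \<omega>) * col k i \<omega>) / real n) (1 / 2)"
      by (rule to_prob_cong[OF half(2)], rule eventually_mono[OF ev(2)])
        (simp add: 2 design_col_def sq left_diff_distrib right_diff_distrib)
    moreover have "to_prob (\<lambda>n \<omega>. (\<Sum>i<n. T i \<omega> * col k i \<omega>) / real n) 0"
      by (rule to_prob_cong[OF to_prob_const[of 0]]) (simp add: 2 design_col_def sq algebra_simps)
    ultimately show ?thesis using 2 by simp
  next
    case (3 l)
    note A = div_real_to_prob_zero[OF x_sum_stoch_bounded[OF 3(2)]]
    note B = div_real_to_prob_zero[OF signed_covariate_sum_stoch_bounded[OF 3(2)]]
    have "((a + b) / 2) / r = (a / r + b / r) / 2" "((a - b) / 2) / r = (a / r - b / r) / 2" for a b r :: real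
      by (simp_all add: add_divide_distrib diff_divide_distrib)
    note halves = this
    have col: "col k i \<omega> = x i l \<omega>" for i \<omega> using 3(1) by (simp add: design_col_def)
    have "to_prob (\<lambda>n \<omega>. (\<Sum>i<n. T i \<omega> * x i l \<omega>) / real n) 0"
      "to_prob (\<lambda>n \<omega>. (\<Sum>i<n. (1 - T i \<omega>) * x i l \<omega>) / real n) 0"
      using to_prob_divide[OF to_prob_add[OF A B] to_prob_const[of 2]]
        to_prob_divide[OF to_prob_diff[OF A B] to_prob_const[of 2]]
      unfolding treated_sum_eq[where y = "\<lambda>i. x i l"] halves by simp_all
    then show ?thesis unfolding col using 3(1) by simp
  qed
  then show "to_prob (\<lambda>n \<omega>. (\<Sum>i<n. T i \<omega> * col k i \<omega>) / real n) (if k = 0 then 1 / 2 else 0)"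
    "to_prob (\<lambda>n \<omega>. (\<Sum>i<n. (1 - T i \<omega>) * col k i \<omega>) / real n) (if k = 1 then 1 / 2 else 0)" by auto
qed

lemma gram_to_prob:
  assumes p: "p \<le> d" and kl: "k < p + 2" "l < p + 2"
  shows "to_prob (\<lambda>n \<omega>. ((1 / real n) \<cdot>\<^sub>m gram_at p n \<omega>) $$ (k, l)) (mat_diag (p + 2) gram_limit $$ (k, l))"
proof -
  have col: "col 0 = T" "col 1 = (\<lambda>i \<omega>. 1 - T i \<omega>)" by (auto simp: design_col_def fun_eq_iff)
  have "to_prob (\<lambda>n \<omega>. (\<Sum>i<n. col k i \<omega> * col l i \<omega>) / real n) (if k = l then gram_limit k else 0)"
  proof (cases "k < 2 \<or> l < 2")
    case True
    \<comment> \<open>Treats a treatment column on the left; a treatment column on the right follows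
      by symmetry.\<close>
    have base: "to_prob (\<lambda>n \<omega>. (\<Sum>i<n. col k i \<omega> * col l i \<omega>) / real n) (if k = l then gram_limit k else 0)"
      if "k < 2" "l < p + 2" for k l
      using that treated_column_mean_to_prob[of l] p unfolding gram_limit_def
      by (cases "k = 0") (auto simp: design_col_def less_2_cases_iff)
    show ?thesis
    proof (cases "k < 2")
      case True
      then show ?thesis using base kl by simp
    next
      case False
      then show ?thesis using base[of l k] kl True by (simp add: mult.commute eq_commute)
    qed
  next
    case False
    then have "k - 2 < d" "l - 2 < d" "k - 2 = l - 2 \<longleftrightarrow> k = l" using kl p by auto
    then show ?thesis
      using x_product_mean_to_prob[of "k - 2" "l - 2"] False
      by (cases "k = l") (simp_all add: design_col_def gram_limit_def)
  qed
  then show ?thesis using kl by (cases "k = l") (simp_all add: gram_def mat_diag_def)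
qed

text \<open>Padding with zeros keeps the index range of all covariates, so \<open>signed_sum\<close>
  and \<open>working_error\<close> apply without reindexing.\<close>

definition omitted :: "nat \<Rightarrow> (nat \<Rightarrow> real) \<Rightarrow> nat \<Rightarrow> real" where
  "omitted p \<beta> j = (if j < p then 0 else \<beta> j)"

definition working_error :: "(nat \<Rightarrow> real) \<Rightarrow> nat \<Rightarrow> 'a \<Rightarrow> real" where
  "working_error c i \<omega> = (\<Sum>j<d. c j * x i j \<omega>) + \<epsilon> i \<omega>"

text \<open>With \<open>c = omitted p \<beta>\<close> this is the square of sigma_w.\<close>

definition working_var :: "(nat \<Rightarrow> real) \<Rightarrow> real" where
  "working_var c = \<sigma>\<^sup>2 + (\<Sum>j<d. (c j)\<^sup>2 * VX j)"

lemma working_var_pos: "0 < working_var c"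
  unfolding working_var_def using \<sigma>_pos VX_pos
  by (intro add_pos_nonneg sum_nonneg mult_nonneg_nonneg) (auto simp: less_imp_le)

lemma working_error_meas [measurable]: "working_error c i \<in> borel_measurable M"
  unfolding working_error_def
  by (intro borel_measurable_add borel_measurable_sum borel_measurable_times borel_measurable_const x_meas \<epsilon>_meas) auto

text \<open>The weights will be the constant 1, the signs, a covariate, an error, and the working
  error itself.\<close>

lemma weighted_working_error_sum:
  "(\<Sum>i<n. w i * working_error c i \<omega>) = (\<Sum>j<d. c j * (\<Sum>i<n. w i * x i j \<omega>)) + (\<Sum>i<n. w i * \<epsilon> i \<omega>)"
proof -
  have "(\<Sum>i<n. w i * working_error c i \<omega>) = (\<Sum>i<n. \<Sum>j<d. c j * (w i * x i j \<omega>)) + (\<Sum>i<n. w i * \<epsilon> i \<omega>)"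
    unfolding working_error_def by (simp add: distrib_left sum.distrib sum_distrib_left mult_ac)
  also have "(\<Sum>i<n. \<Sum>j<d. c j * (w i * x i j \<omega>)) = (\<Sum>j<d. c j * (\<Sum>i<n. w i * x i j \<omega>))"
    by (subst sum.swap) (simp add: sum_distrib_left)
  finally show ?thesis .
qed

lemma weighted_working_error_sum_divide:
  "(\<Sum>i<n. w i * working_error c i \<omega>) / r
    = (\<Sum>j<d. c j * ((\<Sum>i<n. w i * x i j \<omega>) / r)) + (\<Sum>i<n. w i * \<epsilon> i \<omega>) / r"
  by (simp only: weighted_working_error_sum add_divide_distrib times_divide_eq_right sum_divide_distrib[symmetric])

lemma signed_sum_working_error:
  "(\<Sum>i<n. sgn_T i \<omega> * working_error c i \<omega>) / sqrt (real n) = signed_sum c n \<omega>"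
  unfolding weighted_working_error_sum_divide signed_sum_def ..

lemma working_error_sum_stoch_bounded:
  "stoch_bounded (\<lambda>n \<omega>. (\<Sum>i<n. working_error c i \<omega>) / sqrt (real n))"
proof -
  have "stoch_bounded (\<lambda>n \<omega>. (\<Sum>j<d. c j * ((\<Sum>i<n. x i j \<omega>) / sqrt (real n))) + (\<Sum>i<n. \<epsilon> i \<omega>) / sqrt (real n))"
    by (intro stoch_bounded_add stoch_bounded_sum stoch_bounded_cmult x_sum_stoch_bounded \<epsilon>_sum_stoch_bounded) auto
  then show ?thesis
    using weighted_working_error_sum_divide[where w = "\<lambda>_. 1" and c = c] by (simp only: mult_1)
qed

text \<open>On expanding the square, covariate products and squared errors obey laws of large
  numbers, while mixed terms are O(sqrt n) and vanish after division by n.\<close>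

lemma working_error_sq_mean_to_prob:
  "to_prob (\<lambda>n \<omega>. (\<Sum>i<n. (working_error c i \<omega>)\<^sup>2) / real n) (working_var c)"
proof -
  have sq: "(\<Sum>i<n. (working_error c i \<omega>)\<^sup>2)
      = (\<Sum>j<d. \<Sum>k<d. c j * c k * (\<Sum>i<n. x i j \<omega> * x i k \<omega>))
        + 2 * (\<Sum>j<d. c j * (\<Sum>i<n. x i j \<omega> * \<epsilon> i \<omega>)) + (\<Sum>i<n. (\<epsilon> i \<omega>)\<^sup>2)" for n \<omega>
  proof -
    have "(\<Sum>i<n. (working_error c i \<omega>)\<^sup>2) = (\<Sum>i<n. working_error c i \<omega> * working_error c i \<omega>)"
      by (simp add: power2_eq_square)
    also have "\<dots> = (\<Sum>j<d. c j * (\<Sum>i<n. x i j \<omega> * working_error c i \<omega>)) + (\<Sum>i<n. \<epsilon> i \<omega> * working_error c i \<omega>)"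
      unfolding weighted_working_error_sum[of "\<lambda>i. working_error c i \<omega>"] by (simp add: mult.commute)
    also have "\<dots> = (\<Sum>j<d. \<Sum>k<d. c j * c k * (\<Sum>i<n. x i j \<omega> * x i k \<omega>))
        + (\<Sum>j<d. c j * (\<Sum>i<n. x i j \<omega> * \<epsilon> i \<omega>))
        + ((\<Sum>j<d. c j * (\<Sum>i<n. \<epsilon> i \<omega> * x i j \<omega>)) + (\<Sum>i<n. \<epsilon> i \<omega> * \<epsilon> i \<omega>))"
      unfolding weighted_working_error_sum by (simp add: distrib_left sum.distrib sum_distrib_left mult.assoc)
    finally show ?thesis by (simp add: power2_eq_square mult.commute)
  qed
  have "to_prob (\<lambda>n \<omega>. (\<Sum>j<d. \<Sum>k<d. c j * c k * ((\<Sum>i<n. x i j \<omega> * x i k \<omega>) / real n))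
        + 2 * (\<Sum>j<d. c j * ((\<Sum>i<n. x i j \<omega> * \<epsilon> i \<omega>) / real n)) + (\<Sum>i<n. (\<epsilon> i \<omega>)\<^sup>2) / real n)
      ((\<Sum>j<d. \<Sum>k<d. c j * c k * (if j = k then VX j else 0)) + 2 * (\<Sum>j<d. c j * 0) + \<sigma>\<^sup>2)"
    by (intro to_prob_add to_prob_sum to_prob_mult to_prob_const x_product_mean_to_prob \<epsilon>_sq_mean_to_prob
        div_real_to_prob_zero x_\<epsilon>_sum_stoch_bounded) auto
  moreover have "(\<Sum>k<d. c j * c k * (if j = k then VX j else 0)) = (c j)\<^sup>2 * VX j" if "j < d" for j
  proof -
    have "(\<Sum>k<d. c j * c k * (if j = k then VX j else 0)) = (\<Sum>k<d. if j = k then c j * c k * VX j else 0)"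
      by (intro sum.cong) auto
    then show ?thesis using that by (simp add: power2_eq_square)
  qed
  then have "(\<Sum>j<d. \<Sum>k<d. c j * c k * (if j = k then VX j else 0)) + 2 * (\<Sum>j<d. c j * 0) + \<sigma>\<^sup>2 = working_var c"
    unfolding working_var_def by simp
  ultimately show ?thesis
    by (simp only: sq add_divide_distrib times_divide_eq_right sum_divide_distrib[symmetric])
qed

text \<open>The scores of the two arms are half the sum and half the difference of the unsigned and
  the signed error sum. For a covariate column it matters that the working error contains omitted
  covariates only.\<close>

lemma score_stoch_bounded:
  assumes p: "p \<le> d" and k: "k < p + 2"
  shows "stoch_bounded (\<lambda>n \<omega>. (\<Sum>i<n. col k i \<omega> * working_error (omitted p \<beta>) i \<omega>) / sqrt (real n))"
proof -
  let ?c = "omitted p \<beta>"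
  consider "k = 0" | "k = 1" | l where "k = l + 2" "l < p"
    using k by (metis add_2_eq_Suc' add_less_cancel_right not0_implies_Suc One_nat_def)
  then show ?thesis
  proof cases
    case 1
    have "stoch_bounded (\<lambda>n \<omega>. (1 / 2) * ((\<Sum>i<n. working_error ?c i \<omega>) / sqrt (real n) + signed_sum ?c n \<omega>))"
      by (intro stoch_bounded_cmult stoch_bounded_add working_error_sum_stoch_bounded signed_sum_stoch_bounded)
    moreover have "(\<Sum>i<n. col k i \<omega> * working_error ?c i \<omega>) / sqrt (real n)
        = (1 / 2) * ((\<Sum>i<n. working_error ?c i \<omega>) / sqrt (real n) + signed_sum ?c n \<omega>)" for n \<omega>
    proof -
      have "(\<Sum>i<n. col k i \<omega> * working_error ?c i \<omega>)
          = ((\<Sum>i<n. working_error ?c i \<omega>) + (\<Sum>i<n. sgn_T i \<omega> * working_error ?c i \<omega>)) / 2"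
        using treated_sum_eq(1)[where y = "working_error ?c"] by (simp add: 1 design_col_def)
      moreover have "((a + b) / 2) / r = (1 / 2) * (a / r + b / r)" for a b r :: real
        by (simp add: add_divide_distrib)
      ultimately show ?thesis unfolding signed_sum_working_error[symmetric] by (simp only:)
    qed
    ultimately show ?thesis by (simp only:)
  next
    case 2
    have "stoch_bounded (\<lambda>n \<omega>. (1 / 2) * ((\<Sum>i<n. working_error ?c i \<omega>) / sqrt (real n) - signed_sum ?c n \<omega>))"
      by (intro stoch_bounded_cmult stoch_bounded_diff working_error_sum_stoch_bounded signed_sum_stoch_bounded)
    moreover have "(\<Sum>i<n. col k i \<omega> * working_error ?c i \<omega>) / sqrt (real n)
        = (1 / 2) * ((\<Sum>i<n. working_error ?c i \<omega>) / sqrt (real n) - signed_sum ?c n \<omega>)" for n \<omega>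
    proof -
      have "(\<Sum>i<n. col k i \<omega> * working_error ?c i \<omega>)
          = ((\<Sum>i<n. working_error ?c i \<omega>) - (\<Sum>i<n. sgn_T i \<omega> * working_error ?c i \<omega>)) / 2"
        using treated_sum_eq(2)[where y = "working_error ?c"] by (simp add: 2 design_col_def)
      moreover have "((a - b) / 2) / r = (1 / 2) * (a / r - b / r)" for a b r :: real
        by (simp add: diff_divide_distrib)
      ultimately show ?thesis unfolding signed_sum_working_error[symmetric] by (simp only:)
    qed
    ultimately show ?thesis by (simp only:)
  next
    case (3 l)
    have "stoch_bounded (\<lambda>n \<omega>. ?c j * ((\<Sum>i<n. x i l \<omega> * x i j \<omega>) / sqrt (real n)))" if "j < d" for j
    \<comment> \<open>As \<open>omitted\<close> vanishes at included indices, the sum of squares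
      with \<open>j = l\<close>, which is of order n, never occurs.\<close>
    proof (cases "j < p")
      case True
      then show ?thesis using to_prob_stoch_bounded[OF to_prob_const[of 0]] by (simp add: omitted_def)
    next
      case False
      then show ?thesis using that 3 p by (intro stoch_bounded_cmult x_product_sum_stoch_bounded) auto
    qed
    then have "stoch_bounded (\<lambda>n \<omega>. (\<Sum>j<d. ?c j * ((\<Sum>i<n. x i l \<omega> * x i j \<omega>) / sqrt (real n)))
        + (\<Sum>i<n. x i l \<omega> * \<epsilon> i \<omega>) / sqrt (real n))"
      using 3 p by (intro stoch_bounded_add stoch_bounded_sum x_\<epsilon>_sum_stoch_bounded) auto
    then show ?thesis
      unfolding weighted_working_error_sum_divide using 3(1) by (simp add: design_col_def)
  qed
qed

end

section \<open>Limit law of the statistic\<close>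

context covariate_adaptive_design
begin

lemma col_meas:
  assumes "k < d + 2"
  shows "col k i \<in> borel_measurable M"
proof (cases "k < 2")
  case True
  then show ?thesis by (auto simp: design_col_def less_2_cases_iff)
next
  case False
  then have "k - 2 < d" using assms by simp
  from x_meas[OF this] False show ?thesis by (simp add: design_col_def)
qed

text \<open>The determinant and the inverse entries are rational in the Gram entries, and the
  singular case is covered by the measurability of \<open>s0\<close>. Without it the law of the
  statistic would not be a real distribution.\<close>

lemma S_stat_meas:
  assumes p: "p \<le> d" and [measurable]: "s0 \<in> borel_measurable M"
  shows "(\<lambda>\<omega>. if Determinant.det (gram_at p n \<omega>) = 0 then s0 \<omega> else
     (a + (\<Sum>k<p + 2. (inv_entry (gram_at p n \<omega>) 0 k - inv_entry (gram_at p n \<omega>) 1 k)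
        * (\<Sum>i<n. col k i \<omega> * working_error c i \<omega>))) /
     sqrt (((\<Sum>i<n. (working_error c i \<omega>)\<^sup>2)
       - (\<Sum>k<p + 2. \<Sum>l<p + 2. (\<Sum>i<n. col k i \<omega> * working_error c i \<omega>)
          * inv_entry (gram_at p n \<omega>) k l * (\<Sum>i<n. col l i \<omega> * working_error c i \<omega>))) / (real n - real p - 2)
       * (inv_entry (gram_at p n \<omega>) 0 0 - inv_entry (gram_at p n \<omega>) 0 1
          - inv_entry (gram_at p n \<omega>) 1 0 + inv_entry (gram_at p n \<omega>) 1 1))) \<in> borel_measurable M"
proof -
  have gram: "(\<lambda>\<omega>. gram_at p n \<omega> $$ (k, l)) \<in> borel_measurable M" if "k < p + 2" "l < p + 2" for k l
  proof -
    have "(\<lambda>\<omega>. \<Sum>i<n. col k i \<omega> * col l i \<omega>) \<in> borel_measurable M"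
      using that p by (intro borel_measurable_sum borel_measurable_times col_meas) auto
    then show ?thesis using that by (simp add: gram_def)
  qed
  have det: "(\<lambda>\<omega>. Determinant.det (gram_at p n \<omega>)) \<in> borel_measurable M"
    by (rule measurable_det[OF gram_carrier gram])
  have b: "(\<lambda>\<omega>. inv_entry (gram_at p n \<omega>) k l) \<in> borel_measurable M" for k l
    by (rule measurable_inv_entry[OF gram_carrier gram])
  have g: "(\<lambda>\<omega>. \<Sum>i<n. col k i \<omega> * working_error c i \<omega>) \<in> borel_measurable M" if "k \<in> {..<p + 2}" for k
    using that p by (intro borel_measurable_sum borel_measurable_times col_meas working_error_meas) auto
  show ?thesis
    by (intro measurable_If borel_measurable_eq det borel_measurable_const assms(2) borel_measurable_divide
        borel_measurable_add borel_measurable_sum borel_measurable_times borel_measurable_diff b g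
        borel_measurable_power working_error_meas measurable_compose[OF _ borel_measurable_sqrt])
qed

lemma outcome_eq:
  assumes "p \<le> d"
  shows "outcome d \<mu>1 \<mu>2 \<beta> T x \<epsilon> i \<omega>
    = \<mu>1 * T i \<omega> + \<mu>2 * (1 - T i \<omega>) + (\<Sum>j<p. \<beta> j * x i j \<omega>) + working_error (omitted p \<beta>) i \<omega>"
proof -
  have "(\<Sum>j<d. \<beta> j * x i j \<omega>) = (\<Sum>j<d. (if j < p then \<beta> j * x i j \<omega> else 0) + omitted p \<beta> j * x i j \<omega>)"
    by (intro sum.cong) (auto simp: omitted_def)
  also have "\<dots> = (\<Sum>j<d. if j < p then \<beta> j * x i j \<omega> else 0) + (\<Sum>j<d. omitted p \<beta> j * x i j \<omega>)"
    by (rule sum.distrib)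
  also have "(\<Sum>j<d. if j < p then \<beta> j * x i j \<omega> else 0) = (\<Sum>j<p. \<beta> j * x i j \<omega>)"
    using assms by (intro sum.mono_neutral_cong_right) auto
  finally show ?thesis unfolding outcome_def working_error_def by simp
qed

text \<open>Both claims at once: \<open>\<delta> = 0\<close> is the null hypothesis, and the two
  means may vary with \<open>n\<close> as long as their difference has the right size. The mean of
  the limit is the quotient of \<open>\<delta>\<close> and the limit of \<open>den\<close>
  below.\<close>

theorem S_stat_weak_limit:
  fixes \<beta> :: "nat \<Rightarrow> real"
  assumes p: "p \<le> d" and \<delta>: "\<And>n. 0 < n \<Longrightarrow> \<mu>1 n - \<mu>2 n = \<delta> / sqrt (real n)"
    and s0: "\<And>n. s0 n \<in> borel_measurable M"
  defines "c \<equiv> omitted p \<beta>"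
  shows "conv_in_distr M
    (\<lambda>n \<omega>. S_stat p (\<lambda>i. T i \<omega>) (\<lambda>i j. x i j \<omega>) (\<lambda>i. outcome d (\<mu>1 n) (\<mu>2 n) \<beta> T x \<epsilon> i \<omega>) (s0 n \<omega>) n)
    (normal_law (\<delta> / (2 * sqrt (working_var c))) (signed_var c / working_var c))"
proof -
  let ?u = "working_error c"
  let ?W = "signed_sum c"
  define \<sigma>w where "\<sigma>w = sqrt (working_var c)"
  have \<sigma>w: "0 < \<sigma>w" "\<sigma>w\<^sup>2 = working_var c"
    using working_var_pos[of c] unfolding \<sigma>w_def by auto
  define S where "S n \<omega> = S_stat p (\<lambda>i. T i \<omega>) (\<lambda>i j. x i j \<omega>)
    (\<lambda>i. outcome d (\<mu>1 n) (\<mu>2 n) \<beta> T x \<epsilon> i \<omega>) (s0 n \<omega>) n" for n \<omega>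
  define g where "g k n \<omega> = (\<Sum>i<n. col k i \<omega> * ?u i \<omega>)" for k n \<omega>
  have S_eq: "S n \<omega> = (if Determinant.det (gram_at p n \<omega>) = 0 then s0 n \<omega> else
     (\<mu>1 n - \<mu>2 n + (\<Sum>k<p + 2. (inv_entry (gram_at p n \<omega>) 0 k - inv_entry (gram_at p n \<omega>) 1 k) * g k n \<omega>)) /
     sqrt (((\<Sum>i<n. (?u i \<omega>)\<^sup>2)
       - (\<Sum>k<p + 2. \<Sum>l<p + 2. g k n \<omega> * inv_entry (gram_at p n \<omega>) k l * g l n \<omega>)) / (real n - real p - 2)
       * (inv_entry (gram_at p n \<omega>) 0 0 - inv_entry (gram_at p n \<omega>) 0 1
          - inv_entry (gram_at p n \<omega>) 1 0 + inv_entry (gram_at p n \<omega>) 1 1)))" for n \<omega>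
    unfolding S_def g_def by (rule S_stat_eq) (simp add: outcome_eq[OF p] c_def)
  have S_meas: "S n \<in> borel_measurable M" for n
    unfolding S_eq[abs_def] g_def by (rule S_stat_meas[OF p s0])
  define A where "A n \<omega> = (1 / real n) \<cdot>\<^sub>m gram_at p n \<omega>" for n \<omega>
  define Q where "Q = mat_diag (p + 2) gram_limit"
  define b where "b k l n \<omega> = inv_entry (A n \<omega>) k l" for k l n \<omega>
  define h where "h k n \<omega> = g k n \<omega> / sqrt (real n)" for k n \<omega>
  have A_carrier: "A n \<omega> \<in> carrier_mat (p + 2) (p + 2)" for n \<omega>
    unfolding A_def by (intro smult_carrier_mat gram_carrier)
  have Q_carrier: "Q \<in> carrier_mat (p + 2) (p + 2)" unfolding Q_def by (rule mat_diag_dim)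
  have A_lim: "to_prob (\<lambda>n \<omega>. A n \<omega> $$ (k, l)) (Q $$ (k, l))" if "k < p + 2" "l < p + 2" for k l
    unfolding A_def Q_def by (rule gram_to_prob[OF p that])
  have det_Q: "Determinant.det Q \<noteq> 0"
    unfolding Q_def det_mat_diag using gram_limit_nonzero[OF p] by simp
  have b_lim: "to_prob (b k l) (if k = l then 1 / gram_limit k else 0)" if "k < p + 2" "l < p + 2" for k l
    using to_prob_inv_entry[OF A_carrier Q_carrier A_lim det_Q, of k l]
      inv_entry_mat_diag[OF gram_limit_nonzero[OF p] that] unfolding b_def Q_def by simp
  have h_bounded: "stoch_bounded (h k)" if "k < p + 2" for k
    using score_stoch_bounded[OF p that, of \<beta>] unfolding h_def g_def c_def .
  \<comment> \<open>Numerator and denominator of the statistic, each multiplied by sqrt n and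
    written in the normalized quantities \<open>b\<close> and \<open>h\<close>.\<close>
  define num where "num n \<omega> = \<delta> + (\<Sum>k<p + 2. (b 0 k n \<omega> - b 1 k n \<omega>) * h k n \<omega>)" for n \<omega>
  define den where "den n \<omega> = sqrt (((\<Sum>i<n. (?u i \<omega>)\<^sup>2) / real n
      - (\<Sum>k<p + 2. \<Sum>l<p + 2. h k n \<omega> * b k l n \<omega> * h l n \<omega>) / real n)
      * (real n / (real n - real p - 2)) * (b 0 0 n \<omega> - b 0 1 n \<omega> - b 1 0 n \<omega> + b 1 1 n \<omega>))" for n \<omega>

  have S_ratio: "S n \<omega> = num n \<omega> / den n \<omega>"
    if n: "p + 2 < n" and det: "Determinant.det (gram_at p n \<omega>) \<noteq> 0" for n \<omega>
  proof -
    define r where "r = sqrt (real n)"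
    have r: "0 < r" "real n = r * r" "0 < real n" using n unfolding r_def by auto
    have inv: "inv_entry (gram_at p n \<omega>) k l = b k l n \<omega> / (r * r)" if "k < p + 2" "l < p + 2" for k l
      using inv_entry_smult[OF gram_carrier det _ that, of "1 / real n"] r unfolding b_def A_def by simp
    have g: "g k n \<omega> = r * h k n \<omega>" for k using r unfolding h_def r_def[symmetric] by simp
    have d: "\<mu>1 n - \<mu>2 n = \<delta> / r" using \<delta>[of n] r(3) unfolding r_def by simp
    have "\<mu>1 n - \<mu>2 n + (\<Sum>k<p + 2. (inv_entry (gram_at p n \<omega>) 0 k - inv_entry (gram_at p n \<omega>) 1 k) * g k n \<omega>)
        = \<delta> / r + (\<Sum>k<p + 2. (b 0 k n \<omega> - b 1 k n \<omega>) * h k n \<omega> / r)"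
      unfolding g d using r(1)
      by (intro arg_cong2[where f = "(+)"] sum.cong refl) (simp add: inv diff_divide_distrib[symmetric])
    also have "\<dots> = num n \<omega> / r"
      unfolding num_def by (simp add: add_divide_distrib sum_divide_distrib del: sum.lessThan_Suc)
    finally have N: "\<mu>1 n - \<mu>2 n + (\<Sum>k<p + 2. (inv_entry (gram_at p n \<omega>) 0 k - inv_entry (gram_at p n \<omega>) 1 k) * g k n \<omega>)
        = num n \<omega> / r" .
    have Qf: "(\<Sum>k<p + 2. \<Sum>l<p + 2. g k n \<omega> * inv_entry (gram_at p n \<omega>) k l * g l n \<omega>)
        = (\<Sum>k<p + 2. \<Sum>l<p + 2. h k n \<omega> * b k l n \<omega> * h l n \<omega>)"
      unfolding g using r(1) by (intro sum.cong refl) (simp add: inv)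
    have ident: "((\<Sum>i<n. (?u i \<omega>)\<^sup>2) - q) / (real n - real p - 2) * (b00 / (r * r) - b01 / (r * r) - b10 / (r * r) + b11 / (r * r))
        = (((\<Sum>i<n. (?u i \<omega>)\<^sup>2) / real n - q / real n) * (real n / (real n - real p - 2)) * (b00 - b01 - b10 + b11)) / (r * r)"
      for q b00 b01 b10 b11 :: real
      using r(3) unfolding diff_divide_distrib[symmetric] add_divide_distrib[symmetric] by simp
    have inv4: "inv_entry (gram_at p n \<omega>) 0 0 = b 0 0 n \<omega> / (r * r)"
      "inv_entry (gram_at p n \<omega>) 0 1 = b 0 1 n \<omega> / (r * r)"
      "inv_entry (gram_at p n \<omega>) 1 0 = b 1 0 n \<omega> / (r * r)"
      "inv_entry (gram_at p n \<omega>) 1 1 = b 1 1 n \<omega> / (r * r)"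
      by (rule inv; simp)+
    have sqrt_rr: "sqrt (r * r) = r" using r(1) by simp
    have "sqrt (((\<Sum>i<n. (?u i \<omega>)\<^sup>2)
       - (\<Sum>k<p + 2. \<Sum>l<p + 2. g k n \<omega> * inv_entry (gram_at p n \<omega>) k l * g l n \<omega>)) / (real n - real p - 2)
       * (inv_entry (gram_at p n \<omega>) 0 0 - inv_entry (gram_at p n \<omega>) 0 1
          - inv_entry (gram_at p n \<omega>) 1 0 + inv_entry (gram_at p n \<omega>) 1 1)) = den n \<omega> / r"
      unfolding Qf den_def inv4 ident real_sqrt_divide[of _ "r * r"] sqrt_rr ..
    then show ?thesis unfolding S_eq using det N r(1) by simp
  qed

  \<comment> \<open>The limiting inverse is diagonal with entry 2 at both arms, so the contrast
    picks out 2 and -2 and ignores the covariate columns. As \<open>T - (1 - T)\<close> is the sign,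
    twice the signed sum results.\<close>
  have lim_coeff: "to_prob (\<lambda>n \<omega>. b 0 k n \<omega> - b 1 k n \<omega>) (if k = 0 then 2 else if k = 1 then - 2 else 0)"
    if "k < p + 2" for k
    using to_prob_diff[OF b_lim[of 0 k] b_lim[of 1 k]] that by (auto simp: gram_limit_def split: if_splits)
  have num_lim: "to_prob (\<lambda>n \<omega>. num n \<omega> - (\<delta> + 2 * ?W n \<omega>)) 0"
  proof -
    let ?l = "\<lambda>k. if k = 0 then 2 else if k = 1 then - 2 else (0::real)"
    have "to_prob (\<lambda>n \<omega>. \<Sum>k<p + 2. (b 0 k n \<omega> - b 1 k n \<omega> - ?l k) * h k n \<omega>) (\<Sum>k<p + 2. 0)"
    proof (intro to_prob_sum to_prob_zero_mult_bounded)
      fix k assume k: "k \<in> {..<p + 2}"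
      show "to_prob (\<lambda>n \<omega>. b 0 k n \<omega> - b 1 k n \<omega> - ?l k) 0"
        using to_prob_diff[OF lim_coeff to_prob_const[of "?l k"], of k] k by (simp only: lessThan_iff diff_self)
      show "stoch_bounded (h k)" using k by (intro h_bounded) simp
    qed
    moreover have "(\<Sum>k<p + 2. (b 0 k n \<omega> - b 1 k n \<omega> - ?l k) * h k n \<omega>) = num n \<omega> - (\<delta> + 2 * ?W n \<omega>)" for n \<omega>
    proof -
      have "(\<Sum>k<p + 2. ?l k * h k n \<omega>) = 2 * (h 0 n \<omega> - h 1 n \<omega>)"
        unfolding sum_lessThan_Suc_Suc_shift by simp
      also have "h 0 n \<omega> - h 1 n \<omega> = (g 0 n \<omega> - g 1 n \<omega>) / sqrt (real n)"
        unfolding h_def by (simp add: diff_divide_distrib)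
      also have "g 0 n \<omega> - g 1 n \<omega> = (\<Sum>i<n. sgn_T i \<omega> * ?u i \<omega>)"
        unfolding g_def sum_subtractf[symmetric] by (intro sum.cong refl) (simp add: design_col_def algebra_simps)
      finally show ?thesis
        unfolding num_def signed_sum_working_error[symmetric]
        by (simp add: left_diff_distrib sum_subtractf del: sum.lessThan_Suc)
    qed
    ultimately show ?thesis by simp
  qed
  have den_lim: "to_prob den (2 * \<sigma>w)"
  proof -
    \<comment> \<open>The part of the error absorbed by the fit stays bounded, so its contribution
      to the variance estimate is of order 1/n.\<close>
    have "stoch_bounded (\<lambda>n \<omega>. \<Sum>k<p + 2. \<Sum>l<p + 2. h k n \<omega> * b k l n \<omega> * h l n \<omega>)"
      by (intro stoch_bounded_sum stoch_bounded_mult h_bounded to_prob_stoch_bounded[OF b_lim]) auto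
    moreover have "(\<lambda>n. 1 / real n) \<longlonglongrightarrow> 0" by real_asymp
    ultimately have "to_prob (\<lambda>n \<omega>. (1 / real n) * (\<Sum>k<p + 2. \<Sum>l<p + 2. h k n \<omega> * b k l n \<omega> * h l n \<omega>)) 0"
      by (intro to_prob_zero_mult_bounded to_prob_seq)
    then have q: "to_prob (\<lambda>n \<omega>. (\<Sum>k<p + 2. \<Sum>l<p + 2. h k n \<omega> * b k l n \<omega> * h l n \<omega>) / real n) 0"
      by (simp del: sum.lessThan_Suc)
    have "(\<lambda>n. real n / (real n - real p - 2)) \<longlonglongrightarrow> 1" by real_asymp
    note f = to_prob_seq[OF this]
    \<comment> \<open>The limit of n times the quadratic form of \<open>L_vec\<close>: 2 from either
      arm, 0 from the off-diagonal entries.\<close>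
    have B: "to_prob (\<lambda>n \<omega>. b 0 0 n \<omega> - b 0 1 n \<omega> - b 1 0 n \<omega> + b 1 1 n \<omega>) 4"
      using to_prob_add[OF to_prob_diff[OF to_prob_diff[OF b_lim[of 0 0] b_lim[of 0 1]] b_lim[of 1 0]] b_lim[of 1 1]]
      by (simp add: gram_limit_def)
    have "to_prob den (sqrt ((working_var c - 0) * 1 * 4))"
      unfolding den_def
      by (intro to_prob_sqrt to_prob_mult to_prob_diff working_error_sq_mean_to_prob q f B)
    then show ?thesis unfolding \<sigma>w_def by (simp add: real_sqrt_mult mult.commute)
  qed

  define Z where "Z n \<omega> = (\<delta> / 2 + ?W n \<omega>) / \<sigma>w" for n \<omega>
  have Z_meas [measurable]: "Z n \<in> borel_measurable M" for n unfolding Z_def by measurable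
  \<comment> \<open>With \<open>w = \<delta> + 2 * ?W\<close> the difference is (num - w) / den plus
    w * (1 / den - 1 / (2 sigma_w)): a vanishing term times a convergent one, and a vanishing term
    times a bounded one.\<close>
  have "to_prob (\<lambda>n \<omega>. num n \<omega> / den n \<omega> - Z n \<omega>) 0"
  proof -
    have inv: "to_prob (\<lambda>n \<omega>. 1 / den n \<omega>) (1 / (2 * \<sigma>w))"
      using \<sigma>w by (intro to_prob_divide to_prob_const den_lim) auto
    have "stoch_bounded (\<lambda>n \<omega>. \<delta> + 2 * ?W n \<omega>)"
      by (intro stoch_bounded_add stoch_bounded_cmult signed_sum_stoch_bounded to_prob_stoch_bounded[OF to_prob_const])
    moreover have "to_prob (\<lambda>n \<omega>. 1 / den n \<omega> - 1 / (2 * \<sigma>w)) 0"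
      using to_prob_diff[OF inv to_prob_const[of "1 / (2 * \<sigma>w)"]] by simp
    ultimately have "to_prob (\<lambda>n \<omega>. (1 / den n \<omega> - 1 / (2 * \<sigma>w)) * (\<delta> + 2 * ?W n \<omega>)) 0"
      by (intro to_prob_zero_mult_bounded)
    from to_prob_add[OF to_prob_mult[OF num_lim inv] this]
    have "to_prob (\<lambda>n \<omega>. (num n \<omega> - (\<delta> + 2 * ?W n \<omega>)) * (1 / den n \<omega>)
        + (1 / den n \<omega> - 1 / (2 * \<sigma>w)) * (\<delta> + 2 * ?W n \<omega>)) 0" by simp
    moreover have "(a - w) * (1 / e) + (1 / e - 1 / (2 * \<sigma>w)) * w = a / e - w / (2 * \<sigma>w)" for a w e :: real
      by (simp add: algebra_simps diff_divide_distrib)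
    moreover have "(\<delta> + 2 * ?W n \<omega>) / (2 * \<sigma>w) = Z n \<omega>" for n \<omega>
      unfolding Z_def using \<sigma>w by (simp add: field_simps)
    ultimately show ?thesis by (simp only:)
  qed
  then have diff: "to_prob (\<lambda>n \<omega>. S n \<omega> - Z n \<omega>) 0"
  proof (rule to_prob_off_small_cong)
    fix e :: real assume e: "0 < e"
    have "off_small e (\<lambda>n \<omega>. Determinant.det (A n \<omega>) \<noteq> 0)"
      by (rule off_small_nonzero[OF to_prob_det[OF A_carrier Q_carrier A_lim] det_Q e])
    \<comment> \<open>A deterministic restriction on \<open>n\<close> costs no probability, so the
      whole budget \<open>e\<close> is left for the singular event.\<close>
    moreover have "off_small 0 (\<lambda>n \<omega>. p + 2 < n)"
      by (rule off_small_always) (use eventually_gt_at_top[of "p + 2"] in \<open>auto elim: eventually_mono\<close>)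
    ultimately show "off_small e (\<lambda>n \<omega>. S n \<omega> - Z n \<omega> = num n \<omega> / den n \<omega> - Z n \<omega>)"
    proof (rule off_small_conj)
      fix n \<omega> assume "Determinant.det (A n \<omega>) \<noteq> 0" "p + 2 < n"
      then show "S n \<omega> - Z n \<omega> = num n \<omega> / den n \<omega> - Z n \<omega>"
        using S_ratio[of n \<omega>] unfolding A_def by (auto simp: det_smult)
    qed simp
  qed

  let ?m = "\<delta> / (2 * sqrt (working_var c))" and ?v = "signed_var c / working_var c"
  have v: "0 < ?v" using signed_var_pos working_var_pos by simp
  have "conv_in_distr M S (normal_law ?m ?v)"
  proof (rule levy_continuity)
    show "real_distribution (distr M borel (S n))" for n by (rule real_distribution_distr[OF S_meas])
    show "real_distribution (normal_law ?m ?v)" by (rule real_distribution_normal_law[OF v])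
    fix t
    \<comment> \<open>\<open>Z\<close> is affine in the signed sum: the shift becomes a phase and
      the scaling moves into the argument.\<close>
    have "char (distr M borel (Z n)) t = iexp (t * ?m) * char (distr M borel (?W n)) (t / \<sigma>w)" for n
    proof -
      have "char (distr M borel (Z n)) t = expectation (\<lambda>\<omega>. iexp (t * Z n \<omega>))"
        unfolding char_def by (subst integral_distr) auto
      also have "\<dots> = expectation (\<lambda>\<omega>. iexp (t * ?m) * iexp (t / \<sigma>w * ?W n \<omega>))"
      proof (intro Bochner_Integration.integral_cong refl)
        fix \<omega>
        have "t * Z n \<omega> = t * ?m + t / \<sigma>w * ?W n \<omega>"
          unfolding Z_def \<sigma>w_def[symmetric] by (simp add: algebra_simps add_divide_distrib)
        then show "iexp (t * Z n \<omega>) = iexp (t * ?m) * iexp (t / \<sigma>w * ?W n \<omega>)"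
          by (simp only: of_real_add distrib_left exp_add)
      qed
      also have "\<dots> = iexp (t * ?m) * expectation (\<lambda>\<omega>. iexp (t / \<sigma>w * ?W n \<omega>))"
        by (rule integral_mult_right_zero)
      also have "expectation (\<lambda>\<omega>. iexp (t / \<sigma>w * ?W n \<omega>)) = char (distr M borel (?W n)) (t / \<sigma>w)"
        unfolding char_def by (subst integral_distr) auto
      finally show ?thesis .
    qed
    moreover have "(t / \<sigma>w)\<^sup>2 * signed_var c / 2 = t\<^sup>2 * ?v / 2"
      by (simp add: power_divide \<sigma>w(2))
    ultimately have "(\<lambda>n. char (distr M borel (Z n)) t) \<longlonglongrightarrow> char (normal_law ?m ?v) t"
      using tendsto_mult_left[OF char_signed_sum[of c "t / \<sigma>w"], of "iexp (t * ?m)"]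
      unfolding char_normal_law[OF v] by (simp only:)
    then show "(\<lambda>n. char (distr M borel (S n)) t) \<longlonglongrightarrow> char (normal_law ?m ?v) t"
      by (rule char_slutsky[OF Z_meas S_meas diff])
  qed
  then show ?thesis unfolding S_def .
qed

end

theorem theorem4p3:
  fixes M :: "'a measure" and P :: "'b measure"
    and p q :: nat
    and X :: "nat \<Rightarrow> 'b \<Rightarrow> real"
    and x :: "nat \<Rightarrow> nat \<Rightarrow> 'a \<Rightarrow> real"
    and T \<epsilon> :: "nat \<Rightarrow> 'a \<Rightarrow> real"
    and \<beta> :: "nat \<Rightarrow> real"
    and s0 :: "nat \<Rightarrow> 'a \<Rightarrow> real"
    and \<sigma>_\<epsilon> :: real
  defines "VX \<equiv> \<lambda>j. prob_space.variance P (X j)"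
  defines "\<sigma>_w \<equiv> sqrt (\<sigma>_\<epsilon>\<^sup>2 + (\<Sum>j<q. (\<beta> (p + j))\<^sup>2 * VX (p + j)))"
  defines "v \<equiv> (\<sigma>_\<epsilon>\<^sup>2 + 1 / 5 * (\<Sum>j<q. (\<beta> (p + j))\<^sup>2 * VX (p + j)))
              / (\<sigma>_\<epsilon>\<^sup>2 + (\<Sum>j<q. (\<beta> (p + j))\<^sup>2 * VX (p + j)))"
  defines "lambda2 \<equiv> 1 / \<sigma>_w"
  defines "S \<equiv> \<lambda>\<mu>1 \<mu>2 n \<omega>. S_stat p (\<lambda>i. T i \<omega>) (\<lambda>i j. x i j \<omega>)
              (\<lambda>i. outcome (p + q) \<mu>1 \<mu>2 \<beta> T x \<epsilon> i \<omega>) (s0 n \<omega>) n"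
  assumes "prob_space M" and "prob_space P"
    \<comment> \<open>the covariates\<close>
    and "prob_space.indep_vars P (\<lambda>_. borel) X {..<p + q}"
    and "\<And>j. j < p + q \<Longrightarrow> integrable P (X j)"
    and "\<And>j. j < p + q \<Longrightarrow> integrable P (\<lambda>\<omega>. (X j \<omega>)\<^sup>2)"
    and "\<And>j. j < p + q \<Longrightarrow> prob_space.expectation P (X j) = 0"
    and "\<And>j. j < p + q \<Longrightarrow> 0 < VX j"
    and "prob_space.indep_vars M (\<lambda>_. \<Pi>\<^sub>M j\<in>{..<p + q}. borel) (cov_vec (p + q) x) UNIV"
    and "\<And>i. distr M (\<Pi>\<^sub>M j\<in>{..<p + q}. borel) (cov_vec (p + q) x i) =
             distr P (\<Pi>\<^sub>M j\<in>{..<p + q}. borel) (\<lambda>\<omega>. \<lambda>j\<in>{..<p + q}. X j \<omega>)"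
    \<comment> \<open>the errors\<close>
    and "0 < \<sigma>_\<epsilon>"
    and "prob_space.indep_vars M (\<lambda>_. borel) \<epsilon> UNIV"
    and "\<And>i. distr M borel (\<epsilon> i) = distr M borel (\<epsilon> 0)"
    and "\<And>i. integrable M (\<epsilon> i)"
    and "\<And>i. integrable M (\<lambda>\<omega>. (\<epsilon> i \<omega>)\<^sup>2)"
    and "\<And>i. prob_space.expectation M (\<epsilon> i) = 0"
    and "\<And>i. prob_space.variance M (\<epsilon> i) = \<sigma>_\<epsilon>\<^sup>2"
    \<comment> \<open>treatments and covariates are jointly independent of the errors\<close>
    and "\<And>n. prob_space.indep_set M
           (sets (vimage_algebra (space M)
             (\<lambda>\<omega>. (\<lambda>i\<in>{..<n}. T i \<omega>, \<lambda>i\<in>{..<n}. cov_vec (p + q) x i \<omega>))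
             ((\<Pi>\<^sub>M i\<in>{..<n}. borel) \<Otimes>\<^sub>M (\<Pi>\<^sub>M i\<in>{..<n}. \<Pi>\<^sub>M j\<in>{..<p + q}. borel))))
           (sets (vimage_algebra (space M)
             (\<lambda>\<omega>. \<lambda>i\<in>{..<n}. \<epsilon> i \<omega>) (\<Pi>\<^sub>M i\<in>{..<n}. borel)))"
    \<comment> \<open>the design and its balance properties\<close>
    and "DA_BCD M (p + q) T x"
    and "conv_in_prob M (\<lambda>n \<omega>. (\<Sum>i<n. 2 * T i \<omega> - 1) / real n) 0"
    and "conv_in_distr_vec (p + q) M
           (\<lambda>n \<omega>. \<lambda>j\<in>{..<p + q}. (\<Sum>i<n. (2 * T i \<omega> - 1) * x i j \<omega>) / sqrt (real n))
           (mv_normal_law (p + q) (0\<^sub>v (p + q)) ((1 / 5) \<cdot>\<^sub>m mat_diag (p + q) VX))"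
    \<comment> \<open>the arbitrary values of the statistic on the singular event are measurable\<close>
    and "\<And>n. s0 n \<in> borel_measurable M"
  shows "(\<forall>\<mu>1 \<mu>2. \<mu>1 - \<mu>2 = 0 \<longrightarrow> conv_in_distr M (S \<mu>1 \<mu>2) (normal_law 0 v)) \<and>
         (\<forall>\<delta> \<mu>1 \<mu>2. \<delta> \<noteq> 0 \<and> (\<forall>n>0. \<mu>1 n - \<mu>2 n = \<delta> / sqrt (real n)) \<longrightarrow>
           conv_in_distr M (\<lambda>n. S (\<mu>1 n) (\<mu>2 n) n) (normal_law (1 / 2 * lambda2 * \<delta>) v))"
proof -
  interpret covariate_adaptive_design M P "p + q" X VX x T \<epsilon> \<sigma>_\<epsilon>
  proof (intro covariate_adaptive_design.intro covariate_adaptive_design_axioms.intro)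
    show "prob_space.variance P (X j) = VX j" for j unfolding VX_def by (rule refl)
    show "T i \<in> borel_measurable M" for i
      using \<open>DA_BCD M (p + q) T x\<close> unfolding DA_BCD_def by blast
    show "T i \<omega> \<in> {0, 1}" if "\<omega> \<in> space M" for i \<omega>
      using \<open>DA_BCD M (p + q) T x\<close> that unfolding DA_BCD_def by blast
  qed (fact assms)+
  let ?c = "omitted p \<beta>"
  \<comment> \<open>Turns the zero-padded sums over all covariates into sums over the
    \<open>q\<close> omitted ones, numbered from \<open>p\<close> on.\<close>
  have sum_omitted: "(\<Sum>j<p + q. (?c j)\<^sup>2 * VX j) = (\<Sum>j<q. (\<beta> (p + j))\<^sup>2 * VX (p + j))"
  proof -
    have "(\<Sum>j<p + q. (?c j)\<^sup>2 * VX j) = (\<Sum>j\<in>{p..<p + q}. (\<beta> j)\<^sup>2 * VX j)"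
      by (intro sum.mono_neutral_cong_right) (auto simp: omitted_def)
    also have "\<dots> = (\<Sum>j<q. (\<beta> (p + j))\<^sup>2 * VX (p + j))"
      by (rule sum.reindex_bij_witness[of _ "\<lambda>j. p + j" "\<lambda>j. j - p"]) auto
    finally show ?thesis .
  qed
  have mean: "\<delta> / (2 * sqrt (working_var ?c)) = 1 / 2 * lambda2 * \<delta>" for \<delta>
    unfolding working_var_def sum_omitted lambda2_def \<sigma>_w_def by simp
  have var: "signed_var ?c / working_var ?c = v"
    unfolding signed_var_def working_var_def sum_omitted v_def by simp
  have limit: "conv_in_distr M (\<lambda>n. S (\<mu>1 n) (\<mu>2 n) n) (normal_law (1 / 2 * lambda2 * \<delta>) v)"
    if "\<forall>n>0. \<mu>1 n - \<mu>2 n = \<delta> / sqrt (real n)" for \<mu>1 \<mu>2 \<delta>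
  proof -
    have "s0 n \<in> borel_measurable M" for n by (fact assms)
    from S_stat_weak_limit[of p \<mu>1 \<mu>2 \<delta> s0 \<beta>, OF _ _ this] that
    show ?thesis unfolding mean var S_def by simp
  qed
  show ?thesis
  proof (intro conjI allI impI)
    \<comment> \<open>Constant means, with \<open>\<delta> = 0\<close> in the common limit
      statement.\<close>
    fix \<mu>1 \<mu>2 :: real assume "\<mu>1 - \<mu>2 = 0"
    then show "conv_in_distr M (S \<mu>1 \<mu>2) (normal_law 0 v)"
      using limit[of "\<lambda>_. \<mu>1" "\<lambda>_. \<mu>2" 0] by simp
  next
    fix \<delta> :: real and \<mu>1 \<mu>2 :: "nat \<Rightarrow> real"
    assume "\<delta> \<noteq> 0 \<and> (\<forall>n>0. \<mu>1 n - \<mu>2 n = \<delta> / sqrt (real n))"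
    then show "conv_in_distr M (\<lambda>n. S (\<mu>1 n) (\<mu>2 n) n) (normal_law (1 / 2 * lambda2 * \<delta>) v)"
      by (intro limit) simp
  qed
qed

end
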